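(* Let $F,G,q,\phi$ satisfy Hypothesis (FG) and Hypothesis (Q) of the context, with $A$ satisfying Hypothesis (A'), and let $v\in C^0(\Lambda)$. Assume: (i) for any $\varepsilon>0$ there exist $F^\varepsilon,G^\varepsilon,q^\varepsilon,\phi^\varepsilon$ and $v^\varepsilon\in C^0(\Lambda)$ such that $F^\varepsilon,G^\varepsilon,q^\varepsilon,\phi^\varepsilon$ satisfy Hypotheses (FG) and (Q) and $v^\varepsilon$ is a viscosity subsolution (resp. supersolution) of the PHJB equation with generators $F^\varepsilon,G^\varepsilon,q^\varepsilon,\phi^\varepsilon$; (ii) as $\varepsilon\to0$, $(F^\varepsilon,G^\varepsilon,q^\varepsilon,\phi^\varepsilon,v^\varepsilon)$ converges to $(F,G,q,\phi,v)$ uniformly in the following sense: $$\lim_{\varepsilon\to0}\ \sup_{(t,\gamma_t,x,y,u)\in[0,T]\times\Lambda\times\mathbb R\times H\times U}\ \sup_{\eta_T\in\Lambda_T}\Big[(|F^\varepsilon-F|+|G^\varepsilon-G|)(\gamma_t,u)+|q^\varepsilon-q|(\gamma_t,x,yG(\gamma_t,u),u)+|\phi^\varepsilon-\phi|(\eta_T)+|v^\varepsilon-v|(\gamma_t)\Big]=0.$$ Then $v$ is a viscosity subsolution (resp. supersolution) of the PHJB equation with generators $F,G,q,\phi$.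
   Context: **Paths.** $H$, $\Xi$ are real separable Hilbert spaces with scalar products $(\cdot,\cdot)_H$, $(\cdot,\cdot)_\Xi$; $|\cdot|$ denotes norms; $L_2(\Xi,H)$ is the space of Hilbert-Schmidt operators and $\mathcal S(H)$ the space of bounded self-adjoint operators on $H$ with the operator norm. $T>0$ is fixed. $A$ generates a strongly continuous semigroup $\{e^{sA}\}_{s\ge0}$ of bounded linear operators on $H$; $A^*$ is its adjoint, with domain $\mathcal D(A^* )$. $\Lambda_t=C([0,t];H)$, $\hat\Lambda_t=D([0,t];H)$ (càdlàg paths), $\Lambda^t=\bigcup_{s\in[t,T]}\Lambda_s$, $\hat\Lambda^t=\bigcup_{s\in[t,T]}\hat\Lambda_s$, $\Lambda=\Lambda^0$, $\hat\Lambda=\hat\Lambda^0$. An element of $\hat\Lambda_t$ is written $\gamma_t$, with value $\gamma_t(s)$ at time $s$; "$(t,\gamma_t)\in[0,T]\times\Lambda$" means $\gamma_t\in\Lambda_t$. For $x\in H$, $\gamma_t\in\hat\Lambda_t$, $t\le s\le T$: $\gamma_t^x$ equals $\gamma_t$ on $[0,t)$ and $\gamma_t^x(t)=\gamma_t(t)+x$; $\gamma_{t,s}\in\hat\Lambda_s$ equals $\gamma_t$ on $[0,t]$ and $\gamma_t(t)$ on $(t,s]$; $\gamma_{t,s,A}\in\hat\Lambda_s$ equals $\gamma_t$ on $[0,t]$ and $\gamma_{t,s,A}(\sigma)=e^{(\sigma-t)A}\gamma_t(t)$ for $\sigma\in(t,s]$. Put $\|\gamma_t\|_0=\sup_{0\le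 s\le t}|\gamma_t(s)|$ and $d_\infty(\gamma_t,\eta_s)=|t-s|+\|\gamma_{t,T,A}-\eta_{s,T,A}\|_0$. **Pathwise derivatives and function classes.** For $f:\hat\Lambda^t\to\mathbb R$ and $\gamma_s\in\hat\Lambda^t$: $\partial_tf(\gamma_s)=\lim_{h\downarrow0}\frac1h[f(\gamma_{s,s+h})-f(\gamma_s)]$ for $s<T$, and $\partial_tf(\gamma_T)=\lim_{s\uparrow T}\partial_tf(\gamma_T|_{[0,s]})$; $\partial_xf(\gamma_s)\in H$ and $\partial_{xx}f(\gamma_s)\in\mathcal S(H)$ are the first and second Fréchet derivatives at $h=0$ of $h\mapsto f(\gamma_s^h)$, $h\in H$. $f\in C^{1,2}_p(\hat\Lambda^t)$ means $f,\partial_tf,\partial_xf,\partial_{xx}f$ exist on $\hat\Lambda^t$, are continuous under $d_\infty$ and have polynomial growth in $\|\gamma_s\|_0$. $C^0(\Lambda^t)$ is the set of $d_\infty$-continuous functionals on $\Lambda^t$, and $C^0_p(\Lambda^t)$ those of polynomial growth (the same notation is used for vector-valued functionals). $f\in C^{1,2}_p(\Lambda^t)$ means $f$ is the restriction to $\Lambda^t$ of some $\hat f\in C^{1,2}_p(\hat\Lambda^t)$; then the derivatives of $f$ are defined as those of $\hat f$ on $\Lambda^t$ (independent of $\hat f$). $A^*\partial_xf\in C^0_p(\Lambda^t)$ means $\partial_xf$ takes values in $\mathcal D(A^* )$ and $A^*\partial_xf$ is $d_\infty$-continuous with polynomial growth. $(U,d)$ is a metric space. **Hypothesis (A').** $\{e^{sA}\}_{s\ge0}$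 is a $C_0$ contraction semigroup. **Hypothesis (FG).** $F:\Lambda\times U\to H$ and $G:\Lambda\times U\to L_2(\Xi,H)$ are continuous and there is $L>0$ such that for all $t\in[0,T]$, $\gamma_t,\eta_t\in\Lambda_t$, $u\in U$: $|F(\gamma_t,u)|^2\vee|G(\gamma_t,u)|^2_{L_2(\Xi,H)}\le L^2(1+\|\gamma_t\|_0^2)$ and $|F(\gamma_t,u)-F(\eta_t,u)|\vee|G(\gamma_t,u)-G(\eta_t,u)|_{L_2(\Xi,H)}\le L\|\gamma_t-\eta_t\|_0$. **Hypothesis (Q).** $q:\Lambda\times\mathbb R\times\Xi\times U\to\mathbb R$ and $\phi:\Lambda_T\to\mathbb R$ are continuous and there is $L>0$ such that for all $t$, $\gamma_t,\gamma_t'\in\Lambda_t$, $\eta_T,\eta_T'\in\Lambda_T$, $y,y'\in\mathbb R$, $z,z'\in\Xi$, $u\in U$: $|q(\gamma_t,y,z,u)|\le L(1+\|\gamma_t\|_0+|y|+|z|)$, $|q(\gamma_t,y,z,u)-q(\gamma'_t,y',z',u)|\le L(\|\gamma_t-\gamma_t'\|_0+|y-y'|+|z-z'|)$, $|\phi(\eta_T)-\phi(\eta_T')|\le L\|\eta_T-\eta_T'\|_0$. **PHJB equation with generators $F,G,q,\phi$.** $$\begin{cases}\partial_tV(\gamma_t)+(A^*\partial_xV(\gamma_t),\gamma_t(t))_H+\mathbf H(\gamma_t,V(\gamma_t),\partial_xV(\gamma_t),\partial_{xx}V(\gamma_t))=0,& (t,\gamma_t)\in[0,T)\times\Lambda,\\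 V(\gamma_T)=\phi(\gamma_T),&\gamma_T\in\Lambda_T,\end{cases}$$ where, for $(t,\gamma_t,r,p,l)\in[0,T]\times\Lambda\times\mathbb R\times H\times\mathcal S(H)$, $$\mathbf H(\gamma_t,r,p,l)=\sup_{u\in U}\Big[(p,F(\gamma_t,u))_H+\tfrac12\mathrm{Tr}[l\,G(\gamma_t,u)G^*(\gamma_t,u)]+q(\gamma_t,r,pG(\gamma_t,u),u)\Big],$$ and $pG(\gamma_t,u)\in\Xi$ denotes $G(\gamma_t,u)^*p$ for $p\in H$. **Test functionals.** $S(\gamma_t)=\frac{(\|\gamma_t\|_0^6-|\gamma_t(t)|^6)^3}{\|\gamma_t\|_0^{12}}$ if $\|\gamma_t\|_0\ne0$, and $S(\gamma_t)=0$ otherwise; $\Upsilon^3(\gamma_t)=S(\gamma_t)+3|\gamma_t(t)|^6$; for $t\le s$, $\overline\Upsilon^3(\gamma_t,\eta_s)=\overline\Upsilon^3(\eta_s,\gamma_t)=\Upsilon^3(\eta_s-\gamma_{t,s,A})+|s-t|^2$. $\Phi=\{\varphi\in C^{1,2}_p(\Lambda): A^*\partial_x\varphi\in C^0_p(\Lambda)\}$. $\mathcal G_t$ is the set of $g\in C^0_p(\Lambda^t)$ for which there exist $h\in C^1([0,T];\mathbb R)$ with $h\ge0$, $N>0$, $\delta_i,\delta_i'\ge0$, $t_i\le t$, $\gamma^i_{t_i}\in\Lambda_{t_i}$ ($i=0,1,2,\dots$) with $\|\gamma^i_{t_i}\|_0\le N$, $\sum_i(\delta_i+\delta'_i)\le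 N$, and for all $\gamma_s\in\Lambda^t$ $$g(\gamma_s)=h(s)\Upsilon^3(\gamma_s)+\sum_{i=0}^\infty\big[\delta_i\overline\Upsilon^3(\gamma_s,\gamma^i_{t_i})+\delta_i'|\gamma_s(s)-e^{(s-t_i)A}\gamma^i_{t_i}(t_i)|^6\big].$$ For such $g$ one writes $\partial_tg(\gamma_s)=h'(s)\Upsilon^3(\gamma_s)+2\sum_i\delta_i(s-t_i)$, $\partial_xg(\gamma_s)=h(s)\partial_x\Upsilon^3(\gamma_s)+\sum_i\partial_x[\delta_i\Upsilon^3(\gamma_s-\gamma^i_{t_i,s,A})+\delta_i'|\gamma_s(s)-e^{(s-t_i)A}\gamma^i_{t_i}(t_i)|^6]$, and $\partial_{xx}g$ likewise with $\partial_{xx}$ in place of $\partial_x$. **Viscosity sub/supersolution.** $w\in C^0(\Lambda)$ is a viscosity subsolution (resp. supersolution) if $w(\gamma_T)\le\phi(\gamma_T)$ (resp. $\ge$) for all $\gamma_T\in\Lambda_T$ and, for any $\varphi\in\Phi$, $t\in[0,T)$, $g\in\mathcal G_t$ and $\gamma_t\in\Lambda_t$, whenever $0=(w-\varphi-g)(\gamma_t)=\sup_{(s,\eta_s)\in[t,T]\times\Lambda^t}(w-\varphi-g)(\eta_s)$ (resp. $0=(w+\varphi+g)(\gamma_t)=\inf_{(s,\eta_s)\in[t,T]\times\Lambda^t}(w+\varphi+g)(\eta_s)$), one has $$\partial_t\varphi(\gamma_t)+\partial_tg(\gamma_t)+(A^*\partial_x\varphi(\gamma_t),\gamma_t(t))_H+\mathbf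 H(\gamma_t,(\varphi+g)(\gamma_t),\partial_x(\varphi+g)(\gamma_t),\partial_{xx}(\varphi+g)(\gamma_t))\ge0$$ (resp. $$-\partial_t\varphi(\gamma_t)-\partial_tg(\gamma_t)-(A^*\partial_x\varphi(\gamma_t),\gamma_t(t))_H+\mathbf H(\gamma_t,-(\varphi+g)(\gamma_t),-\partial_x(\varphi+g)(\gamma_t),-\partial_{xx}(\varphi+g)(\gamma_t))\le0).$$
   Formalization: In the subsolution case the limit Hamiltonian H(γ,r,p,l) is additionally assumed continuous in γ for each fixed r, p, l, and in (i) the constant L of Hypothesis (Q) is the same for all ε; the statement is false without these. *)

theory Defs
  imports "HOL-Analysis.Analysis"
begin

section \<open>Hilbert--Schmidt operators and trace\<close>

definition orthonormal_basis :: "'a::real_inner set \<Rightarrow> bool" where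
  "orthonormal_basis B \<longleftrightarrow>
     pairwise orthogonal B \<and> (\<forall>e\<in>B. norm e = 1) \<and> closure (span B) = UNIV"

text \<open>Every Hilbert space has such a basis, and the Hilbert--Schmidt norm and the trace of a
  trace-class operator do not depend on it.\<close>

definition some_basis :: "'a::real_inner set" where
  "some_basis = (SOME B. orthonormal_basis B)"

definition hilbert_schmidt :: "('x::real_inner \<Rightarrow>\<^sub>L 'h::real_inner) \<Rightarrow> bool" where
  "hilbert_schmidt G \<longleftrightarrow> (\<lambda>e. (norm (blinfun_apply G e))\<^sup>2) summable_on some_basis"

definition hs_norm :: "('x::real_inner \<Rightarrow>\<^sub>L 'h::real_inner) \<Rightarrow> real" where
  "hs_norm G = sqrt (\<Sum>\<^sub>\<infinity>e\<in>some_basis. (norm (blinfun_apply G e))\<^sup>2)"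

definition trace_op :: "('h::real_inner \<Rightarrow> 'h) \<Rightarrow> real" where
  "trace_op K = (\<Sum>\<^sub>\<infinity>e\<in>some_basis. K e \<bullet> e)"

definition self_adjoint :: "('h::real_inner \<Rightarrow>\<^sub>L 'h) \<Rightarrow> bool" where
  "self_adjoint l \<longleftrightarrow> (\<forall>x y. blinfun_apply l x \<bullet> y = x \<bullet> blinfun_apply l y)"


section \<open>Semigroups, generators and the adjoint of an unbounded operator\<close>

text \<open>A semigroup is only constrained at times \<open>s \<ge> 0\<close>. Unbounded operators are represented
  by their graphs, so the domain of an operator is the \<^const>\<open>Domain\<close> of its graph.\<close>

definition c0_semigroup :: "(real \<Rightarrow> 'h::real_normed_vector \<Rightarrow>\<^sub>L 'h) \<Rightarrow> bool" where
  "c0_semigroup S \<longleftrightarrow>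
     S 0 = id_blinfun \<and>
     (\<forall>s\<ge>0. \<forall>t\<ge>0. S (s + t) = S s o\<^sub>L S t) \<and>
     (\<forall>x. ((\<lambda>s. blinfun_apply (S s) x) \<longlongrightarrow> x) (at_right 0))"

definition generates :: "('h \<times> 'h) set \<Rightarrow> (real \<Rightarrow> 'h::real_normed_vector \<Rightarrow>\<^sub>L 'h) \<Rightarrow> bool" where
  "generates A S \<longleftrightarrow>
     c0_semigroup S \<and>
     A = {(x, y). ((\<lambda>h. (1 / h) *\<^sub>R (blinfun_apply (S h) x - x)) \<longlongrightarrow> y) (at_right 0)}"

definition contraction_semigroup :: "(real \<Rightarrow> 'h::real_normed_vector \<Rightarrow>\<^sub>L 'h) \<Rightarrow> bool" where
  "contraction_semigroup S \<longleftrightarrow> c0_semigroup S \<and> (\<forall>s\<ge>0. norm (S s) \<le> 1)"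

definition adj_graph :: "('h::real_inner \<times> 'h) set \<Rightarrow> ('h \<times> 'h) set" where
  "adj_graph A = {(y, z). \<forall>(x, w)\<in>A. w \<bullet> y = x \<bullet> z}"

definition adj_op :: "('h::real_inner \<times> 'h) set \<Rightarrow> 'h \<Rightarrow> 'h" where
  "adj_op A y = (THE z. (y, z) \<in> adj_graph A)"


section \<open>Paths\<close>

text \<open>A path \<open>\<gamma>\<^sub>t\<close> is a pair of its terminal time \<open>t\<close> and a function that is fixed to
  \<^const>\<open>undefined\<close> outside \<open>[0, t]\<close>, so that equality of pairs is equality of paths.\<close>

type_synonym 'h path = "real \<times> (real \<Rightarrow> 'h)"

definition endpt :: "'h path \<Rightarrow> 'h" where
  "endpt \<gamma> = snd \<gamma> (fst \<gamma>)"

definition cadlag_on :: "real \<Rightarrow> (real \<Rightarrow> 'h::topological_space) \<Rightarrow> bool" where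
  "cadlag_on t f \<longleftrightarrow>
     (\<forall>s. 0 \<le> s \<and> s < t \<longrightarrow> (f \<longlongrightarrow> f s) (at_right s)) \<and>
     (\<forall>s. 0 < s \<and> s \<le> t \<longrightarrow> (\<exists>l. (f \<longlongrightarrow> l) (at_left s)))"

definition Cpaths :: "real \<Rightarrow> 'h::topological_space path set" where
  "Cpaths t = {t} \<times> {f \<in> extensional {0..t}. continuous_on {0..t} f}"

definition Dpaths :: "real \<Rightarrow> 'h::topological_space path set" where
  "Dpaths t = {t} \<times> {f \<in> extensional {0..t}. cadlag_on t f}"

definition Lam :: "real \<Rightarrow> real \<Rightarrow> 'h::topological_space path set" where
  "Lam T t = (\<Union>s\<in>{t..T}. Cpaths s)"

definition Lam_hat :: "real \<Rightarrow> real \<Rightarrow> 'h::topological_space path set" where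
  "Lam_hat T t = (\<Union>s\<in>{t..T}. Dpaths s)"

text \<open>\<open>\<gamma>\<^sub>t\<^sup>x\<close>, \<open>\<gamma>\<^bsub>t,s\<^esub>\<close>, \<open>\<gamma>\<^bsub>t,s,A\<^esub>\<close>, the restriction of \<open>\<gamma>\<^sub>t\<close> to \<open>[0, s]\<close>, and the pointwise
  difference on the lifetime of the first path.\<close>

definition vshift :: "'h::real_vector \<Rightarrow> 'h path \<Rightarrow> 'h path" where
  "vshift x \<gamma> = (fst \<gamma>, (snd \<gamma>)(fst \<gamma> := endpt \<gamma> + x))"

definition flat :: "real \<Rightarrow> 'h path \<Rightarrow> 'h path" where
  "flat s \<gamma> = (s, \<lambda>\<sigma>\<in>{0..s}. if \<sigma> \<le> fst \<gamma> then snd \<gamma> \<sigma> else endpt \<gamma>)"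

definition flow ::
  "(real \<Rightarrow> 'h::real_normed_vector \<Rightarrow>\<^sub>L 'h) \<Rightarrow> real \<Rightarrow> 'h path \<Rightarrow> 'h path" where
  "flow S s \<gamma> =
     (s, \<lambda>\<sigma>\<in>{0..s}. if \<sigma> \<le> fst \<gamma> then snd \<gamma> \<sigma> else blinfun_apply (S (\<sigma> - fst \<gamma>)) (endpt \<gamma>))"

definition cut :: "real \<Rightarrow> 'h path \<Rightarrow> 'h path" where
  "cut s \<gamma> = (s, restrict (snd \<gamma>) {0..s})"

definition pdiff :: "'h::real_vector path \<Rightarrow> 'h path \<Rightarrow> 'h path" where
  "pdiff \<eta> \<gamma> = (fst \<eta>, \<lambda>\<sigma>\<in>{0..fst \<eta>}. snd \<eta> \<sigma> - snd \<gamma> \<sigma>)"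

definition pnorm :: "'h::real_normed_vector path \<Rightarrow> real" where
  "pnorm \<gamma> = (SUP s\<in>{0..fst \<gamma>}. norm (snd \<gamma> s))"

definition dinf ::
  "real \<Rightarrow> (real \<Rightarrow> 'h::real_normed_vector \<Rightarrow>\<^sub>L 'h) \<Rightarrow> 'h path \<Rightarrow> 'h path \<Rightarrow> real" where
  "dinf T S \<gamma> \<eta> = \<bar>fst \<gamma> - fst \<eta>\<bar> + pnorm (pdiff (flow S T \<gamma>) (flow S T \<eta>))"

text \<open>The filter of neighbourhoods of \<open>\<gamma>\<close> in the space \<open>(X, d\<^sub>\<infinity>)\<close>.\<close>

definition path_nhds ::
  "real \<Rightarrow> (real \<Rightarrow> 'h::real_normed_vector \<Rightarrow>\<^sub>L 'h) \<Rightarrow> 'h path set \<Rightarrow> 'h path \<Rightarrow> 'h path filter"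
where
  "path_nhds T S X \<gamma> = (INF r\<in>{0<..}. principal {\<eta> \<in> X. dinf T S \<gamma> \<eta> < r})"

definition path_continuous ::
  "real \<Rightarrow> (real \<Rightarrow> 'h::real_normed_vector \<Rightarrow>\<^sub>L 'h) \<Rightarrow> 'h path set \<Rightarrow>
   ('h path \<Rightarrow> 'b::topological_space) \<Rightarrow> bool" where
  "path_continuous T S X f \<longleftrightarrow> (\<forall>\<gamma>\<in>X. (f \<longlongrightarrow> f \<gamma>) (path_nhds T S X \<gamma>))"

definition poly_growth ::
  "'h::real_normed_vector path set \<Rightarrow> ('h path \<Rightarrow> 'b::real_normed_vector) \<Rightarrow> bool" where
  "poly_growth X f \<longleftrightarrow> (\<exists>C k. \<forall>\<gamma>\<in>X. norm (f \<gamma>) \<le> C * (1 + pnorm \<gamma> ^ k))"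

definition C0p ::
  "real \<Rightarrow> (real \<Rightarrow> 'h::real_normed_vector \<Rightarrow>\<^sub>L 'h) \<Rightarrow> 'h path set \<Rightarrow>
   ('h path \<Rightarrow> 'b::real_normed_vector) \<Rightarrow> bool" where
  "C0p T S X f \<longleftrightarrow> path_continuous T S X f \<and> poly_growth X f"


section \<open>Pathwise derivatives\<close>

definition has_pd_t0 :: "('h path \<Rightarrow> real) \<Rightarrow> real \<Rightarrow> 'h path \<Rightarrow> bool" where
  "has_pd_t0 f D \<gamma> \<longleftrightarrow>
     ((\<lambda>h. (1 / h) * (f (flat (fst \<gamma> + h) \<gamma>) - f \<gamma>)) \<longlongrightarrow> D) (at_right 0)"

definition pd_t0 :: "('h path \<Rightarrow> real) \<Rightarrow> 'h path \<Rightarrow> real" where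
  "pd_t0 f \<gamma> = (THE D. has_pd_t0 f D \<gamma>)"

definition has_pd_t :: "real \<Rightarrow> ('h path \<Rightarrow> real) \<Rightarrow> real \<Rightarrow> 'h path \<Rightarrow> bool" where
  "has_pd_t T f D \<gamma> \<longleftrightarrow>
     (if fst \<gamma> < T then has_pd_t0 f D \<gamma>
      else ((\<lambda>s. pd_t0 f (cut s \<gamma>)) \<longlongrightarrow> D) (at_left T))"

definition pd_t :: "real \<Rightarrow> ('h path \<Rightarrow> real) \<Rightarrow> 'h path \<Rightarrow> real" where
  "pd_t T f \<gamma> = (THE D. has_pd_t T f D \<gamma>)"

definition has_pd_x :: "('h::real_inner path \<Rightarrow> real) \<Rightarrow> 'h \<Rightarrow> 'h path \<Rightarrow> bool" where
  "has_pd_x f p \<gamma> \<longleftrightarrow> (GDERIV (\<lambda>h. f (vshift h \<gamma>)) 0 :> p)"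

definition pd_x :: "('h::real_inner path \<Rightarrow> real) \<Rightarrow> 'h path \<Rightarrow> 'h" where
  "pd_x f \<gamma> = (THE p. has_pd_x f p \<gamma>)"

text \<open>Since \<open>(\<gamma>\<^sup>h)\<^sup>k = \<gamma>\<^bsup>h+k\<^esup>\<close>, the gradient of \<open>k \<mapsto> f(\<gamma>\<^sup>k)\<close> at the point \<open>h\<close> is \<open>\<partial>\<^sub>xf(\<gamma>\<^sup>h)\<close>; the second
  derivative at \<open>0\<close> is the derivative at \<open>0\<close> of this gradient map.\<close>

definition has_pd_xx :: "('h::real_inner path \<Rightarrow> real) \<Rightarrow> ('h \<Rightarrow>\<^sub>L 'h) \<Rightarrow> 'h path \<Rightarrow> bool" where
  "has_pd_xx f l \<gamma> \<longleftrightarrow>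
     (\<forall>\<^sub>F h in nhds 0. \<exists>p. has_pd_x f p (vshift h \<gamma>)) \<and>
     ((\<lambda>h. pd_x f (vshift h \<gamma>)) has_derivative blinfun_apply l) (at 0)"

definition pd_xx :: "('h::real_inner path \<Rightarrow> real) \<Rightarrow> 'h path \<Rightarrow> 'h \<Rightarrow>\<^sub>L 'h" where
  "pd_xx f \<gamma> = (THE l. has_pd_xx f l \<gamma>)"

definition C12p_hat ::
  "real \<Rightarrow> (real \<Rightarrow> 'h::real_inner \<Rightarrow>\<^sub>L 'h) \<Rightarrow> real \<Rightarrow> ('h path \<Rightarrow> real) \<Rightarrow> bool" where
  "C12p_hat T S t f \<longleftrightarrow>
     (\<forall>\<gamma>\<in>Lam_hat T t.
        (\<exists>D. has_pd_t T f D \<gamma>) \<and> (\<exists>p. has_pd_x f p \<gamma>) \<and> (\<exists>l. self_adjoint l \<and> has_pd_xx f l \<gamma>)) \<and>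
     C0p T S (Lam_hat T t) f \<and>
     C0p T S (Lam_hat T t) (pd_t T f) \<and>
     C0p T S (Lam_hat T t) (pd_x f) \<and>
     C0p T S (Lam_hat T t) (pd_xx f)"

text \<open>\<open>f\<close> is the restriction to \<open>\<Lambda>\<^sup>t\<close> of the smooth functional \<open>f'\<close> on cadlag paths, whose
  derivatives are by definition the derivatives of \<open>f\<close>.\<close>

definition C12p_ext ::
  "real \<Rightarrow> (real \<Rightarrow> 'h::real_inner \<Rightarrow>\<^sub>L 'h) \<Rightarrow> real \<Rightarrow>
   ('h path \<Rightarrow> real) \<Rightarrow> ('h path \<Rightarrow> real) \<Rightarrow> bool" where
  "C12p_ext T S t f f' \<longleftrightarrow> C12p_hat T S t f' \<and> (\<forall>\<gamma>\<in>Lam T t. f \<gamma> = f' \<gamma>)"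


section \<open>Coefficients and Hamiltonian\<close>

definition hyp_FG ::
  "real \<Rightarrow> (real \<Rightarrow> 'h::real_inner \<Rightarrow>\<^sub>L 'h) \<Rightarrow>
   ('h path \<Rightarrow> 'u::metric_space \<Rightarrow> 'h) \<Rightarrow> ('h path \<Rightarrow> 'u \<Rightarrow> 'x::real_inner \<Rightarrow>\<^sub>L 'h) \<Rightarrow> bool" where
  "hyp_FG T S F G \<longleftrightarrow>
     (\<forall>\<gamma>\<in>Lam T 0. \<forall>u. hilbert_schmidt (G \<gamma> u)) \<and>
     (\<forall>\<gamma>\<in>Lam T 0. \<forall>u.
        ((\<lambda>(\<eta>, u'). F \<eta> u') \<longlongrightarrow> F \<gamma> u) (path_nhds T S (Lam T 0) \<gamma> \<times>\<^sub>F nhds u) \<and>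
        ((\<lambda>(\<eta>, u'). hs_norm (G \<eta> u' - G \<gamma> u)) \<longlongrightarrow> 0) (path_nhds T S (Lam T 0) \<gamma> \<times>\<^sub>F nhds u)) \<and>
     (\<exists>L>0. \<forall>t\<in>{0..T}. \<forall>\<gamma>\<in>Cpaths t. \<forall>\<eta>\<in>Cpaths t. \<forall>u.
        max ((norm (F \<gamma> u))\<^sup>2) ((hs_norm (G \<gamma> u))\<^sup>2) \<le> L\<^sup>2 * (1 + (pnorm \<gamma>)\<^sup>2) \<and>
        max (norm (F \<gamma> u - F \<eta> u)) (hs_norm (G \<gamma> u - G \<eta> u)) \<le> L * pnorm (pdiff \<gamma> \<eta>))"

text \<open>The constant \<open>L\<close> is exposed so that a family of generators can share it.\<close>

definition hyp_Q_const ::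
  "real \<Rightarrow> (real \<Rightarrow> 'h::real_inner \<Rightarrow>\<^sub>L 'h) \<Rightarrow> real \<Rightarrow>
   ('h path \<Rightarrow> real \<Rightarrow> 'x::real_inner \<Rightarrow> 'u::metric_space \<Rightarrow> real) \<Rightarrow> ('h path \<Rightarrow> real) \<Rightarrow> bool" where
  "hyp_Q_const T S L q \<phi> \<longleftrightarrow>
     (\<forall>\<gamma>\<in>Lam T 0. \<forall>y z u.
        ((\<lambda>(\<eta>, y', z', u'). q \<eta> y' z' u') \<longlongrightarrow> q \<gamma> y z u)
          (path_nhds T S (Lam T 0) \<gamma> \<times>\<^sub>F nhds y \<times>\<^sub>F nhds z \<times>\<^sub>F nhds u)) \<and>
     path_continuous T S (Cpaths T) \<phi> \<and>
     (\<forall>t\<in>{0..T}. \<forall>\<gamma>\<in>Cpaths t. \<forall>\<gamma>'\<in>Cpaths t. \<forall>\<eta>\<in>Cpaths T. \<forall>\<eta>'\<in>Cpaths T. \<forall>y y' z z' u.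
        \<bar>q \<gamma> y z u\<bar> \<le> L * (1 + pnorm \<gamma> + \<bar>y\<bar> + norm z) \<and>
        \<bar>q \<gamma> y z u - q \<gamma>' y' z' u\<bar> \<le> L * (pnorm (pdiff \<gamma> \<gamma>') + \<bar>y - y'\<bar> + norm (z - z')) \<and>
        \<bar>\<phi> \<eta> - \<phi> \<eta>'\<bar> \<le> L * pnorm (pdiff \<eta> \<eta>'))"

definition hyp_Q ::
  "real \<Rightarrow> (real \<Rightarrow> 'h::real_inner \<Rightarrow>\<^sub>L 'h) \<Rightarrow>
   ('h path \<Rightarrow> real \<Rightarrow> 'x::real_inner \<Rightarrow> 'u::metric_space \<Rightarrow> real) \<Rightarrow> ('h path \<Rightarrow> real) \<Rightarrow> bool" where
  "hyp_Q T S q \<phi> \<longleftrightarrow> (\<exists>L>0. hyp_Q_const T S L q \<phi>)"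

definition Ham ::
  "('h path \<Rightarrow> 'u \<Rightarrow> 'h::real_inner) \<Rightarrow> ('h path \<Rightarrow> 'u \<Rightarrow> 'x::real_inner \<Rightarrow>\<^sub>L 'h) \<Rightarrow>
   ('h path \<Rightarrow> real \<Rightarrow> 'x \<Rightarrow> 'u \<Rightarrow> real) \<Rightarrow> 'h path \<Rightarrow> real \<Rightarrow> 'h \<Rightarrow> ('h \<Rightarrow>\<^sub>L 'h) \<Rightarrow> real" where
  "Ham F G q \<gamma> r p l =
     (SUP u. p \<bullet> F \<gamma> u
           + 1 / 2 * trace_op (\<lambda>x. blinfun_apply l (blinfun_apply (G \<gamma> u) (adjoint (G \<gamma> u) x)))
           + q \<gamma> r (adjoint (G \<gamma> u) p) u)"


section \<open>Test functionals\<close>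

definition Sfun :: "'h::real_normed_vector path \<Rightarrow> real" where
  "Sfun \<gamma> = (if pnorm \<gamma> \<noteq> 0
             then (pnorm \<gamma> ^ 6 - norm (endpt \<gamma>) ^ 6) ^ 3 / pnorm \<gamma> ^ 12 else 0)"

definition Ups :: "'h::real_normed_vector path \<Rightarrow> real" where
  "Ups \<gamma> = Sfun \<gamma> + 3 * norm (endpt \<gamma>) ^ 6"

definition Ups_bar ::
  "(real \<Rightarrow> 'h::real_normed_vector \<Rightarrow>\<^sub>L 'h) \<Rightarrow> 'h path \<Rightarrow> 'h path \<Rightarrow> real" where
  "Ups_bar S \<gamma> \<eta> =
     (if fst \<gamma> \<le> fst \<eta> then Ups (pdiff \<eta> (flow S (fst \<eta>) \<gamma>)) + \<bar>fst \<eta> - fst \<gamma>\<bar>\<^sup>2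
      else Ups (pdiff \<gamma> (flow S (fst \<gamma>) \<eta>)) + \<bar>fst \<gamma> - fst \<eta>\<bar>\<^sup>2)"

text \<open>A member of \<open>\<Phi>\<close> together with one of its smooth extensions.\<close>

definition Phi_ext ::
  "real \<Rightarrow> (real \<Rightarrow> 'h::real_inner \<Rightarrow>\<^sub>L 'h) \<Rightarrow> ('h \<times> 'h) set \<Rightarrow>
   ('h path \<Rightarrow> real) \<Rightarrow> ('h path \<Rightarrow> real) \<Rightarrow> bool" where
  "Phi_ext T S A f f' \<longleftrightarrow>
     C12p_ext T S 0 f f' \<and>
     (\<forall>\<gamma>\<in>Lam T 0. pd_x f' \<gamma> \<in> Domain (adj_graph A)) \<and>
     C0p T S (Lam T 0) (\<lambda>\<gamma>. adj_op A (pd_x f' \<gamma>))"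

text \<open>\<open>g \<in> \<G>\<^sub>t\<close> with its representation; \<open>h'\<close> is the derivative of \<open>h\<close>, and \<open>t\<^sub>i\<close> is the terminal
  time \<^term>\<open>fst (\<zeta> i)\<close> of the \<open>i\<close>-th path.\<close>

definition G_rep ::
  "real \<Rightarrow> (real \<Rightarrow> 'h::real_inner \<Rightarrow>\<^sub>L 'h) \<Rightarrow> real \<Rightarrow> ('h path \<Rightarrow> real) \<Rightarrow>
   (real \<Rightarrow> real) \<Rightarrow> (real \<Rightarrow> real) \<Rightarrow> (nat \<Rightarrow> real) \<Rightarrow> (nat \<Rightarrow> real) \<Rightarrow> (nat \<Rightarrow> 'h path) \<Rightarrow> bool" where
  "G_rep T S t g h h' \<delta> \<delta>' \<zeta> \<longleftrightarrow>
     C0p T S (Lam T t) g \<and>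
     (\<forall>s\<in>{0..T}. 0 \<le> h s \<and> (h has_real_derivative h' s) (at s within {0..T})) \<and>
     continuous_on {0..T} h' \<and>
     (\<forall>i. 0 \<le> \<delta> i \<and> 0 \<le> \<delta>' i \<and> \<zeta> i \<in> (\<Union>r\<in>{0..t}. Cpaths r)) \<and>
     (\<exists>N>0. (\<forall>i. pnorm (\<zeta> i) \<le> N) \<and>
            summable (\<lambda>i. \<delta> i + \<delta>' i) \<and> (\<Sum>i. \<delta> i + \<delta>' i) \<le> N) \<and>
     (\<forall>\<gamma>\<in>Lam T t. g \<gamma> = h (fst \<gamma>) * Ups \<gamma> +
        (\<Sum>i. \<delta> i * Ups_bar S \<gamma> (\<zeta> i)
           + \<delta>' i * norm (endpt \<gamma> - blinfun_apply (S (fst \<gamma> - fst (\<zeta> i))) (endpt (\<zeta> i))) ^ 6))"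

definition G_term ::
  "(real \<Rightarrow> 'h::real_inner \<Rightarrow>\<^sub>L 'h) \<Rightarrow> real \<Rightarrow> real \<Rightarrow> 'h path \<Rightarrow> 'h path \<Rightarrow> real" where
  "G_term S a b \<zeta> \<gamma> = a * Ups (pdiff \<gamma> (flow S (fst \<gamma>) \<zeta>))
     + b * norm (endpt \<gamma> - blinfun_apply (S (fst \<gamma> - fst \<zeta>)) (endpt \<zeta>)) ^ 6"

definition G_dt ::
  "(real \<Rightarrow> real) \<Rightarrow> (nat \<Rightarrow> real) \<Rightarrow> (nat \<Rightarrow> 'h::real_inner path) \<Rightarrow> 'h path \<Rightarrow> real" where
  "G_dt h' \<delta> \<zeta> \<gamma> = h' (fst \<gamma>) * Ups \<gamma> + 2 * (\<Sum>i. \<delta> i * (fst \<gamma> - fst (\<zeta> i)))"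

definition G_dx ::
  "(real \<Rightarrow> 'h::real_inner \<Rightarrow>\<^sub>L 'h) \<Rightarrow> (real \<Rightarrow> real) \<Rightarrow> (nat \<Rightarrow> real) \<Rightarrow> (nat \<Rightarrow> real) \<Rightarrow>
   (nat \<Rightarrow> 'h path) \<Rightarrow> 'h path \<Rightarrow> 'h" where
  "G_dx S h \<delta> \<delta>' \<zeta> \<gamma> =
     h (fst \<gamma>) *\<^sub>R pd_x Ups \<gamma> + (\<Sum>i. pd_x (G_term S (\<delta> i) (\<delta>' i) (\<zeta> i)) \<gamma>)"

definition G_dxx ::
  "(real \<Rightarrow> 'h::real_inner \<Rightarrow>\<^sub>L 'h) \<Rightarrow> (real \<Rightarrow> real) \<Rightarrow> (nat \<Rightarrow> real) \<Rightarrow> (nat \<Rightarrow> real) \<Rightarrow>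
   (nat \<Rightarrow> 'h path) \<Rightarrow> 'h path \<Rightarrow> 'h \<Rightarrow>\<^sub>L 'h" where
  "G_dxx S h \<delta> \<delta>' \<zeta> \<gamma> =
     h (fst \<gamma>) *\<^sub>R pd_xx Ups \<gamma> + (\<Sum>i. pd_xx (G_term S (\<delta> i) (\<delta>' i) (\<zeta> i)) \<gamma>)"


section \<open>Viscosity sub- and supersolutions\<close>

definition viscosity_subsolution ::
  "real \<Rightarrow> (real \<Rightarrow> 'h::real_inner \<Rightarrow>\<^sub>L 'h) \<Rightarrow> ('h \<times> 'h) set \<Rightarrow>
   ('h path \<Rightarrow> 'u \<Rightarrow> 'h) \<Rightarrow> ('h path \<Rightarrow> 'u \<Rightarrow> 'x::real_inner \<Rightarrow>\<^sub>L 'h) \<Rightarrow>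
   ('h path \<Rightarrow> real \<Rightarrow> 'x \<Rightarrow> 'u \<Rightarrow> real) \<Rightarrow> ('h path \<Rightarrow> real) \<Rightarrow> ('h path \<Rightarrow> real) \<Rightarrow> bool" where
  "viscosity_subsolution T S A F G q \<phi> w \<longleftrightarrow>
     path_continuous T S (Lam T 0) w \<and>
     (\<forall>\<gamma>\<in>Cpaths T. w \<gamma> \<le> \<phi> \<gamma>) \<and>
     (\<forall>f f' t g h h' \<delta> \<delta>' \<zeta>. \<forall>\<gamma>\<in>Cpaths t.
        Phi_ext T S A f f' \<longrightarrow> 0 \<le> t \<longrightarrow> t < T \<longrightarrow> G_rep T S t g h h' \<delta> \<delta>' \<zeta> \<longrightarrow>
        0 = w \<gamma> - f \<gamma> - g \<gamma> \<longrightarrow>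
        0 = (SUP \<eta>\<in>Lam T t. ereal (w \<eta> - f \<eta> - g \<eta>)) \<longrightarrow>
        pd_t T f' \<gamma> + G_dt h' \<delta> \<zeta> \<gamma> + adj_op A (pd_x f' \<gamma>) \<bullet> endpt \<gamma>
          + Ham F G q \<gamma> (f \<gamma> + g \<gamma>)
              (pd_x f' \<gamma> + G_dx S h \<delta> \<delta>' \<zeta> \<gamma>)
              (pd_xx f' \<gamma> + G_dxx S h \<delta> \<delta>' \<zeta> \<gamma>) \<ge> 0)"

definition viscosity_supersolution ::
  "real \<Rightarrow> (real \<Rightarrow> 'h::real_inner \<Rightarrow>\<^sub>L 'h) \<Rightarrow> ('h \<times> 'h) set \<Rightarrow>
   ('h path \<Rightarrow> 'u \<Rightarrow> 'h) \<Rightarrow> ('h path \<Rightarrow> 'u \<Rightarrow> 'x::real_inner \<Rightarrow>\<^sub>L 'h) \<Rightarrow>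
   ('h path \<Rightarrow> real \<Rightarrow> 'x \<Rightarrow> 'u \<Rightarrow> real) \<Rightarrow> ('h path \<Rightarrow> real) \<Rightarrow> ('h path \<Rightarrow> real) \<Rightarrow> bool" where
  "viscosity_supersolution T S A F G q \<phi> w \<longleftrightarrow>
     path_continuous T S (Lam T 0) w \<and>
     (\<forall>\<gamma>\<in>Cpaths T. w \<gamma> \<ge> \<phi> \<gamma>) \<and>
     (\<forall>f f' t g h h' \<delta> \<delta>' \<zeta>. \<forall>\<gamma>\<in>Cpaths t.
        Phi_ext T S A f f' \<longrightarrow> 0 \<le> t \<longrightarrow> t < T \<longrightarrow> G_rep T S t g h h' \<delta> \<delta>' \<zeta> \<longrightarrow>
        0 = w \<gamma> + f \<gamma> + g \<gamma> \<longrightarrow>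
        0 = (INF \<eta>\<in>Lam T t. ereal (w \<eta> + f \<eta> + g \<eta>)) \<longrightarrow>
        - pd_t T f' \<gamma> - G_dt h' \<delta> \<zeta> \<gamma> - adj_op A (pd_x f' \<gamma>) \<bullet> endpt \<gamma>
          + Ham F G q \<gamma> (- (f \<gamma> + g \<gamma>))
              (- (pd_x f' \<gamma> + G_dx S h \<delta> \<delta>' \<zeta> \<gamma>))
              (- (pd_xx f' \<gamma> + G_dxx S h \<delta> \<delta>' \<zeta> \<gamma>)) \<le> 0)"

end

theory Submission
  imports Defs
begin

text \<open>
  Let \<open>\<phi> + g\<close> touch \<open>v\<close> from above at \<open>\<gamma>\<^sub>t\<close>. If \<open>|v\<^sup>\<epsilon> - v| \<le> \<kappa>\<close>, then \<open>\<gamma>\<^sub>t\<close> maximizes \<open>v\<^sup>\<epsilon> - \<phi> - g\<close> on later paths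
  up to \<open>2\<kappa>\<close>. The Borwein--Preiss principle with the gauge \<^const>\<open>Ups_bar\<close>, run with increasing final
  times, gives a point \<open>x\<close> and centres \<open>y\<^sub>i\<close> whose final times lie between \<open>t\<close> and that of \<open>x\<close>, such
  that \<open>x\<close> is an exact maximum of \<open>v\<^sup>\<epsilon> - \<phi> - (g + \<Sum>\<^sub>i 2\<^sup>-\<^sup>i \<Upsilon>(\<cdot>, y\<^sub>i))\<close> on later paths, and the gauges between
  \<open>x\<close>, \<open>\<gamma>\<^sub>t\<close> and the \<open>y\<^sub>i\<close> are of the order of \<open>\<kappa>\<close>. The class of singular test functionals admits infinite
  sums, so the perturbed \<open>g\<close> is a test functional at the final time of \<open>x\<close> and the approximating
  equation yields its inequality there. As \<open>\<epsilon> \<rightarrow> 0\<close>, \<open>x\<close> tends to \<open>\<gamma>\<^sub>t\<close> and the derivatives of the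
  perturbation tend to \<open>0\<close>, because those of \<open>\<Upsilon>\<^sup>3\<close> are of order five and four in the distance. For
  subsolutions the supremum over the controls is passed to the limit by the continuity of the Hamiltonian; for
  supersolutions it suffices to pass to the limit for each fixed control. Contractivity of the
  semigroup makes the gauge comparable to \<open>D\<^sup>6 + |t - s|\<^sup>2\<close>, where \<open>D\<close> is the sup distance of the freely
  evolved paths.
\<close>

section \<open>Hilbert--Schmidt operators\<close>

text \<open>A representation \<open>G_rep\<close> at time t admits only centres that end no later
  than t, whereas the perturbed maximum point may end later than the original touching point. This
  is why the variational principle carries a clock and claims maximality only among later points.
  The perturbed maximum value is in general not 0; the correcting constant is put into the smooth
  part of the test functional, whose derivatives ignore it. The closeness of the approximating q to
  q is given only at arguments z = G^* p. The argument that actually occurs is built from the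
  approximating G and a moving p, and it is reached through the Lipschitz constant of the
  approximating q. One constant therefore has to serve the whole family. The second-order term, the
  trace of l G G^*, is read as a Hilbert-Schmidt scalar product of adjoints. It is then bilinear in
  the pair (G, l G) and bounded by Cauchy-Schwarz, uniformly in the control. Shifting the endpoint
  changes the sup norm as well, which would spoil differentiation of \<open>Ups\<close>; the
  truncated function \<open>kp\<close> allows the norm to be held fixed and reduces the calculus to
  functions of one real variable.\<close>

lemma riesz_subspace:
  fixes \<phi> :: "'a::{real_inner,banach} \<Rightarrow> real"
  assumes M: "subspace M" "closed M" and \<phi>: "bounded_linear \<phi>"
  shows "\<exists>y\<in>M. \<forall>v\<in>M. \<phi> v = y \<bullet> v"
proof -
  interpret \<phi>: bounded_linear \<phi> by fact
  \<comment> \<open>On M, \<open>J\<close> is the squared distance to the representing vector, up to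
    an additive constant, so minimizing it finds that vector. With M the whole space this is Riesz
    representation; with M a closed subspace it also yields orthogonal projections.\<close>
  define J where "J x = (norm x)\<^sup>2 - 2 * \<phi> x" for x
  obtain K where K: "\<And>x. norm (\<phi> x) \<le> norm x * K"
    using \<phi>.bounded by blast
  have Jlb: "- K\<^sup>2 \<le> J x" for x
  proof -
    have "0 \<le> (norm x - K)\<^sup>2" by simp
    moreover have "\<phi> x \<le> norm x * K" using K[of x] by simp
    ultimately show ?thesis unfolding J_def by (simp add: power2_diff mult.commute)
  qed
  define m where "m = (INF x\<in>M. J x)"
  have bdd: "bdd_below (J ` M)" using Jlb by (meson bdd_belowI2)
  have ne: "M \<noteq> {}" using subspace_0[OF M(1)] by auto
  have mJ: "m \<le> J x" if "x \<in> M" for x unfolding m_def by (rule cINF_lower[OF bdd that])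
  have "\<exists>x\<in>M. J x < m + 1 / real (Suc n)" for n
    using cINF_less_iff[OF ne bdd, of "m + 1 / real (Suc n)"] unfolding m_def by auto
  then obtain X where X: "\<And>n. X n \<in> M" "\<And>n. J (X n) < m + 1 / real (Suc n)"
    by metis
  \<comment> \<open>Parallelogram identity, with the value of \<open>J\<close> at the midpoint
    bounded below by m; it makes minimizing sequences Cauchy.\<close>
  have par: "(norm (x - y))\<^sup>2 \<le> 2 * (J x - m) + 2 * (J y - m)" if "x \<in> M" "y \<in> M" for x y
  proof -
    have z: "(1/2) *\<^sub>R (x + y) \<in> M" using M(1) that by (simp add: subspace_add subspace_scale)
    have "J ((1/2) *\<^sub>R (x + y)) = (norm (x + y))\<^sup>2 / 4 - (\<phi> x + \<phi> y)"
      unfolding J_def by (simp add: \<phi>.scaleR \<phi>.add power_divide add_divide_distrib del: scaleR_right_distrib)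
    moreover have "(norm (x + y))\<^sup>2 + (norm (x - y))\<^sup>2 = 2 * (norm x)\<^sup>2 + 2 * (norm y)\<^sup>2"
      by (simp add: power2_norm_eq_inner algebra_simps inner_commute)
    ultimately have "(norm (x - y))\<^sup>2 = 2 * J x + 2 * J y - 4 * J ((1/2) *\<^sub>R (x + y))"
      unfolding J_def by simp
    thus ?thesis using mJ[OF z] by simp
  qed
  have "Cauchy X"
  proof (rule metric_CauchyI)
    fix e :: real assume e: "0 < e"
    obtain N where N: "1 / real (Suc N) < e\<^sup>2 / 4"
      using nat_approx_posE[of "e\<^sup>2 / 4"] e by auto
    show "\<exists>N. \<forall>i\<ge>N. \<forall>j\<ge>N. dist (X i) (X j) < e"
    proof (intro exI allI impI)
      fix i j assume ij: "i \<ge> N" "j \<ge> N"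
      have "1 / real (Suc i) \<le> 1 / real (Suc N)" "1 / real (Suc j) \<le> 1 / real (Suc N)"
        using ij by (auto simp: field_simps)
      hence "(norm (X i - X j))\<^sup>2 < e\<^sup>2"
        using par[OF X(1)[of i] X(1)[of j]] X(2)[of i] X(2)[of j] N
        unfolding right_diff_distrib by (simp only: mult_2)
      thus "dist (X i) (X j) < e"
        using e by (simp add: dist_norm power_less_imp_less_base)
    qed
  qed
  then obtain y where y: "X \<longlonglongrightarrow> y" using Cauchy_convergent convergent_def by blast
  have yM: "y \<in> M" using M(2) X(1) y closed_sequentially by blast
  have "(\<lambda>n. J (X n)) \<longlonglongrightarrow> J y"
    unfolding J_def by (intro tendsto_intros y \<phi>.tendsto)
  moreover have "(\<lambda>n. m + 1 / real (Suc n)) \<longlonglongrightarrow> m + 0"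
    by (intro tendsto_intros LIMSEQ_Suc[OF lim_1_over_n])
  ultimately have "J y \<le> m + 0"
    by (rule LIMSEQ_le) (use X(2) less_imp_le in blast)
  hence Jy: "J y \<le> m" by simp
  have "\<phi> v = y \<bullet> v" if v: "v \<in> M" for v
  proof (cases "v = 0")
    case True thus ?thesis by simp
  next
    case False
    define b where "b = y \<bullet> v - \<phi> v"
    have "0 \<le> t\<^sup>2 * (norm v)\<^sup>2 + 2 * t * b" for t
    proof -
      have "y + t *\<^sub>R v \<in> M" using M(1) yM v by (simp add: subspace_add subspace_scale)
      hence "J y \<le> J (y + t *\<^sub>R v)" using mJ Jy by fastforce
      moreover have "(norm (y + t *\<^sub>R v))\<^sup>2 = (norm y)\<^sup>2 + 2 * t * (y \<bullet> v) + t\<^sup>2 * (norm v)\<^sup>2"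
        unfolding power2_norm_eq_inner
        by (simp add: algebra_simps inner_commute power2_eq_square)
      ultimately show ?thesis
        unfolding J_def b_def by (simp add: \<phi>.add \<phi>.scaleR algebra_simps)
    qed
    \<comment> \<open>The minimizer of the quadratic in t.\<close>
    from this[of "- b / (norm v)\<^sup>2"] have "b\<^sup>2 \<le> 0"
      using False by (simp add: power2_eq_square field_simps)
    thus ?thesis unfolding b_def by simp
  qed
  thus ?thesis using yM by blast
qed

text \<open>\<open>adjoint\<close> is a choice operator, so its defining identity holds only once
  some adjoint is known to exist. Riesz representation on the complete domain supplies one.\<close>

lemma adjoint_blinfun:
  fixes G :: "'x::{real_inner,banach} \<Rightarrow>\<^sub>L 'h::real_inner"
  shows "x \<bullet> adjoint (blinfun_apply G) y = blinfun_apply G x \<bullet> y"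
proof -
  have "\<exists>w. \<forall>x. blinfun_apply G x \<bullet> y = w \<bullet> x" for y
    using riesz_subspace[of UNIV "\<lambda>x. blinfun_apply G x \<bullet> y"]
    by (auto intro: bounded_linear_intros blinfun.bounded_linear_right bounded_linear_compose[OF bounded_linear_inner_left])
  then obtain f where "\<forall>x y. blinfun_apply G x \<bullet> y = x \<bullet> f y"
    by (metis inner_commute)
  hence "\<forall>x y. blinfun_apply G x \<bullet> y = x \<bullet> adjoint (blinfun_apply G) y"
    unfolding adjoint_def by (rule someI[where P = "\<lambda>f'. \<forall>x y. blinfun_apply G x \<bullet> y = x \<bullet> f' y"])
  thus ?thesis by simp
qed

lemma adjoint_blinfun_eqI:
  fixes G :: "'x::{real_inner,banach} \<Rightarrow>\<^sub>L 'h::real_inner"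
  assumes "\<And>x. x \<bullet> w = blinfun_apply G x \<bullet> y"
  shows "adjoint (blinfun_apply G) y = w"
proof -
  have "x \<bullet> (adjoint (blinfun_apply G) y - w) = 0" for x
    using assms[of x] by (simp add: inner_diff_right adjoint_blinfun)
  thus ?thesis using inner_eq_zero_iff right_minus_eq by blast
qed

lemma adjoint_blinfun_diff:
  fixes G :: "'x::{real_inner,banach} \<Rightarrow>\<^sub>L 'h::real_inner"
  shows "adjoint (blinfun_apply (G - G')) y
    = adjoint (blinfun_apply G) y - adjoint (blinfun_apply G') y"
  by (rule adjoint_blinfun_eqI) (simp add: inner_diff_right adjoint_blinfun blinfun.diff_left inner_diff_left)

lemma adjoint_blinfun_vec_diff:
  fixes G :: "'x::{real_inner,banach} \<Rightarrow>\<^sub>L 'h::real_inner"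
  shows "adjoint (blinfun_apply G) (y - z) = adjoint (blinfun_apply G) y - adjoint (blinfun_apply G) z"
  by (rule adjoint_blinfun_eqI) (simp add: inner_diff_right adjoint_blinfun)

section \<open>Orthonormal sets, Bessel and Parseval\<close>

lemma orthonormal_finite_norm:
  fixes F :: "'a::real_inner set"
  assumes "finite F" "pairwise orthogonal F" "\<forall>e\<in>F. norm e = 1"
  shows "(norm (\<Sum>e\<in>F. c e *\<^sub>R e))\<^sup>2 = (\<Sum>e\<in>F. (c e)\<^sup>2)"
proof -
  have "(norm (\<Sum>e\<in>F. c e *\<^sub>R e))\<^sup>2 = (\<Sum>e\<in>F. (norm (c e *\<^sub>R e))\<^sup>2)"
    using assms by (intro norm_sum_Pythagorean) (auto simp: pairwise_def orthogonal_def)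
  thus ?thesis using assms by (simp add: power_mult_distrib)
qed

lemma orthonormal_proj:
  fixes F :: "'a::real_inner set"
  assumes F: "finite F" "pairwise orthogonal F" "\<forall>e\<in>F. norm e = 1"
  shows "(norm (y - (\<Sum>e\<in>F. (y \<bullet> e) *\<^sub>R e)))\<^sup>2 = (norm y)\<^sup>2 - (\<Sum>e\<in>F. (y \<bullet> e)\<^sup>2)"
    and "(norm (y - (\<Sum>e\<in>F. (y \<bullet> e) *\<^sub>R e)))\<^sup>2 \<le> (norm (y - (\<Sum>e\<in>F. c e *\<^sub>R e)))\<^sup>2"
proof -
  \<comment> \<open>Completing the square in the coefficients: the last sum vanishes exactly at the
    Fourier coefficients, which gives both claims.\<close>
  have gen: "(norm (y - (\<Sum>e\<in>F. c e *\<^sub>R e)))\<^sup>2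
      = (norm y)\<^sup>2 - (\<Sum>e\<in>F. (y \<bullet> e)\<^sup>2) + (\<Sum>e\<in>F. (c e - y \<bullet> e)\<^sup>2)" for c
  proof -
    have "(norm (y - (\<Sum>e\<in>F. c e *\<^sub>R e)))\<^sup>2
        = (norm y)\<^sup>2 - 2 * (y \<bullet> (\<Sum>e\<in>F. c e *\<^sub>R e)) + (norm (\<Sum>e\<in>F. c e *\<^sub>R e))\<^sup>2"
      by (simp add: power2_norm_eq_inner algebra_simps inner_commute)
    also have "\<dots> = (norm y)\<^sup>2 - (\<Sum>e\<in>F. 2 * c e * (y \<bullet> e)) + (\<Sum>e\<in>F. (c e)\<^sup>2)"
      unfolding orthonormal_finite_norm[OF F] by (simp add: inner_sum_right sum_distrib_left mult.assoc)
    also have "\<dots> = (norm y)\<^sup>2 - (\<Sum>e\<in>F. (y \<bullet> e)\<^sup>2) + (\<Sum>e\<in>F. (c e - y \<bullet> e)\<^sup>2)"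
      by (simp add: power2_diff sum.distrib sum_subtractf mult.assoc mult.left_commute)
    finally show ?thesis .
  qed
  show 1: "(norm (y - (\<Sum>e\<in>F. (y \<bullet> e) *\<^sub>R e)))\<^sup>2 = (norm y)\<^sup>2 - (\<Sum>e\<in>F. (y \<bullet> e)\<^sup>2)"
    by (simp add: gen)
  show "(norm (y - (\<Sum>e\<in>F. (y \<bullet> e) *\<^sub>R e)))\<^sup>2 \<le> (norm (y - (\<Sum>e\<in>F. c e *\<^sub>R e)))\<^sup>2"
    unfolding 1 gen by (simp add: sum_nonneg)
qed

lemma bessel_finite:
  fixes F :: "'a::real_inner set"
  assumes F: "finite F" "pairwise orthogonal F" "\<forall>e\<in>F. norm e = 1"
  shows "(\<Sum>e\<in>F. (y \<bullet> e)\<^sup>2) \<le> (norm y)\<^sup>2"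
  using orthonormal_proj(1)[OF F, of y] by (metis diff_ge_0_iff_ge zero_le_power2)

text \<open>Zorn's lemma gives a maximal orthonormal set. If its closed span missed a vector x, the
  normalized residual of the projection of x would enlarge the set.\<close>

lemma ex_orthonormal_basis: "\<exists>B::'a::{real_inner,banach} set. orthonormal_basis B"
proof -
  define \<A> where "\<A> = {B::'a set. pairwise orthogonal B \<and> (\<forall>e\<in>B. norm e = 1)}"
  have "\<exists>M\<in>\<A>. \<forall>X\<in>\<A>. M \<subseteq> X \<longrightarrow> X = M"
  proof (rule subset_Zorn)
    fix C assume C: "subset.chain \<A> C"
    hence sub: "C \<subseteq> \<A>" and ch: "\<And>X Y. X \<in> C \<Longrightarrow> Y \<in> C \<Longrightarrow> X \<subseteq> Y \<or> Y \<subseteq> X"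
      by (auto simp: subset_chain_def)
    have "orthogonal x y" if xy: "x \<in> \<Union>C" "y \<in> \<Union>C" "x \<noteq> y" for x y
    proof -
      obtain X Y where XY: "X \<in> C" "Y \<in> C" "x \<in> X" "y \<in> Y" using xy by auto
      obtain Z where "Z \<in> C" "x \<in> Z" "y \<in> Z" using ch[OF XY(1,2)] XY by blast
      thus ?thesis using sub xy(3) unfolding \<A>_def pairwise_def by blast
    qed
    hence "\<Union>C \<in> \<A>" using sub unfolding \<A>_def by (auto simp: pairwise_def)
    thus "\<exists>U\<in>\<A>. \<forall>X\<in>C. X \<subseteq> U" by blast
  qed
  then obtain B where B: "B \<in> \<A>" and max: "\<And>X. X \<in> \<A> \<Longrightarrow> B \<subseteq> X \<Longrightarrow> X = B" by blast
  have "closure (span B) = UNIV"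
  proof (rule ccontr)
    assume "closure (span B) \<noteq> UNIV"
    then obtain x where x: "x \<notin> closure (span B)" by auto
    have "subspace (closure (span B))"
    proof (rule subspaceI)
      show "0 \<in> closure (span B)" using closure_subset span_zero by blast
    next
      fix u v assume "u \<in> closure (span B)" "v \<in> closure (span B)"
      then obtain U V where "\<And>n::nat. U n \<in> span B" "U \<longlonglongrightarrow> u" "\<And>n::nat. V n \<in> span B" "V \<longlonglongrightarrow> v"
        unfolding closure_sequential by metis
      hence "(\<lambda>n. U n + V n) \<longlonglongrightarrow> u + v" "\<forall>n. U n + V n \<in> span B"
        by (auto intro: tendsto_add span_add)
      thus "u + v \<in> closure (span B)" unfolding closure_sequential by (intro exI conjI)
    next
      fix c u assume "u \<in> closure (span B)"
      then obtain U where "\<And>n::nat. U n \<in> span B" "U \<longlonglongrightarrow> u"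
        unfolding closure_sequential by metis
      hence "(\<lambda>n. c *\<^sub>R U n) \<longlonglongrightarrow> c *\<^sub>R u" "\<forall>n. c *\<^sub>R U n \<in> span B"
        by (auto intro: tendsto_scaleR span_mul)
      thus "c *\<^sub>R u \<in> closure (span B)" unfolding closure_sequential by (intro exI conjI)
    qed
    \<comment> \<open>Representing the functional given by x on the closed span produces the
      orthogonal projection y of x.\<close>
    from riesz_subspace[OF this closed_closure bounded_linear_inner_right[of x]]
    obtain y where y: "y \<in> closure (span B)" "\<And>v. v \<in> closure (span B) \<Longrightarrow> x \<bullet> v = y \<bullet> v" by auto
    define z where "z = (1 / norm (x - y)) *\<^sub>R (x - y)"
    have xy: "x \<noteq> y" using x y(1) by auto
    have nz: "norm z = 1" using xy by (simp add: z_def)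
    have zB: "z \<bullet> e = 0" if "e \<in> B" for e
    proof -
      have "e \<in> closure (span B)" using that span_superset closure_subset by blast
      thus ?thesis using y(2) by (simp add: z_def inner_diff_left)
    qed
    have "z \<notin> B" using zB[of z] nz by auto
    moreover have "insert z B \<in> \<A>"
      using B zB nz unfolding \<A>_def by (auto simp: pairwise_insert orthogonal_def inner_commute)
    ultimately show False using max[of "insert z B"] by blast
  qed
  thus ?thesis using B unfolding \<A>_def orthonormal_basis_def by auto
qed

lemma some_basis:
  shows "pairwise orthogonal (some_basis :: 'a::{real_inner,banach} set)"
    and "\<And>e::'a. e \<in> some_basis \<Longrightarrow> norm e = 1"
    and "closure (span (some_basis :: 'a set)) = UNIV"
proof -
  have "orthonormal_basis (some_basis :: 'a set)"
    unfolding some_basis_def using ex_orthonormal_basis by (rule someI_ex)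
  thus "pairwise orthogonal (some_basis :: 'a set)" "\<And>e::'a. e \<in> some_basis \<Longrightarrow> norm e = 1"
    "closure (span (some_basis :: 'a set)) = UNIV"
    unfolding orthonormal_basis_def by auto
qed

lemma finite_basis_subset:
  assumes "F \<subseteq> (some_basis :: 'a::{real_inner,banach} set)"
  shows "pairwise orthogonal F" "\<forall>e\<in>F. norm e = 1"
proof -
  show "pairwise orthogonal F" using some_basis(1) assms by (rule pairwise_subset)
  show "\<forall>e\<in>F. norm e = 1" using some_basis(2) assms by auto
qed

text \<open>The converse of Bessel up to an error: density of the span gives a finite combination
  near y, and the Fourier sum over the same basis vectors is at least as close.\<close>

lemma parseval_le:
  fixes y :: "'a::{real_inner,banach}"
  assumes "0 < \<epsilon>"
  shows "\<exists>F. finite F \<and> F \<subseteq> some_basis \<and> (norm y)\<^sup>2 \<le> (\<Sum>e\<in>F. (y \<bullet> e)\<^sup>2) + \<epsilon>"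
proof -
  have "y \<in> closure (span some_basis)" by (simp add: some_basis)
  then obtain z where z: "z \<in> span some_basis" "dist z y < sqrt \<epsilon>"
    using assms unfolding closure_approachable by (meson real_sqrt_gt_zero)
  then obtain F c where F: "finite F" "F \<subseteq> some_basis" "z = (\<Sum>e\<in>F. c e *\<^sub>R e)"
    unfolding span_explicit by auto
  have "(norm (y - z))\<^sup>2 \<le> \<epsilon>"
  proof -
    have "(norm (y - z))\<^sup>2 \<le> (sqrt \<epsilon>)\<^sup>2"
      using z(2) by (intro power_mono) (auto simp: dist_norm norm_minus_commute)
    thus ?thesis using assms by simp
  qed
  moreover have "(norm y)\<^sup>2 - (\<Sum>e\<in>F. (y \<bullet> e)\<^sup>2) \<le> (norm (y - z))\<^sup>2"
    using orthonormal_proj[OF F(1) finite_basis_subset[OF F(2)], of y] F(3) by metis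
  ultimately show ?thesis using F by (intro exI[of _ F]) simp
qed

section \<open>Hilbert-Schmidt norms and the trace as a scalar product\<close>

lemma hs_norm_nonneg: "0 \<le> hs_norm G"
  unfolding hs_norm_def by (simp add: infsum_nonneg)

lemma hs_norm_sq: "(hs_norm G)\<^sup>2 = (\<Sum>\<^sub>\<infinity>e\<in>some_basis. (norm (blinfun_apply G e))\<^sup>2)"
  unfolding hs_norm_def by (simp add: infsum_nonneg)

lemma hs_finite_le:
  assumes "hilbert_schmidt G" "finite F" "F \<subseteq> some_basis"
  shows "(\<Sum>e\<in>F. (norm (blinfun_apply G e))\<^sup>2) \<le> (hs_norm G)\<^sup>2"
  unfolding hs_norm_sq using assms
  by (intro finite_sum_le_infsum) (auto simp: hilbert_schmidt_def)

text \<open>Summability belongs to the conclusion because \<open>infsum\<close> is 0 on families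
  that are not summable, so that a bound on \<open>hs_norm\<close> alone carries no
  information.\<close>

lemma hs_leI:
  assumes "\<And>F. finite F \<Longrightarrow> F \<subseteq> some_basis \<Longrightarrow> (\<Sum>e\<in>F. (norm (blinfun_apply G e))\<^sup>2) \<le> C"
  shows "hilbert_schmidt G" "(hs_norm G)\<^sup>2 \<le> C"
proof -
  have "(\<lambda>e. (norm (blinfun_apply G e))\<^sup>2) summable_on some_basis"
    by (rule nonneg_bdd_above_summable_on) (auto intro!: bdd_aboveI[of _ C] assms)
  thus "hilbert_schmidt G" "(hs_norm G)\<^sup>2 \<le> C"
    unfolding hilbert_schmidt_def hs_norm_sq by (auto intro!: infsum_le_finite_sums assms)
qed

text \<open>The factor 2 comes from |a + b|^2 \<le> 2 |a|^2 + 2 |b|^2 applied term by term; the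
  later estimates only ask for some constant.\<close>

lemma hs_add:
  assumes "hilbert_schmidt M" "hilbert_schmidt N"
  shows "hilbert_schmidt (M + N)" "(hs_norm (M + N))\<^sup>2 \<le> 2 * (hs_norm M)\<^sup>2 + 2 * (hs_norm N)\<^sup>2"
proof -
  have "(\<Sum>e\<in>F. (norm (blinfun_apply (M + N) e))\<^sup>2) \<le> 2 * (hs_norm M)\<^sup>2 + 2 * (hs_norm N)\<^sup>2"
    if F: "finite F" "F \<subseteq> some_basis" for F
  proof -
    have "(norm (a + b))\<^sup>2 \<le> 2 * (norm a)\<^sup>2 + 2 * (norm b)\<^sup>2" for a b :: 'b
    proof -
      have "(norm (a + b))\<^sup>2 \<le> (norm a + norm b)\<^sup>2"
        by (intro power_mono norm_triangle_ineq) simp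
      also have "\<dots> \<le> 2 * (norm a)\<^sup>2 + 2 * (norm b)\<^sup>2"
        using zero_le_power2[of "norm a - norm b"] by (simp add: power2_sum power2_diff)
      finally show ?thesis .
    qed
    hence "(\<Sum>e\<in>F. (norm (blinfun_apply (M + N) e))\<^sup>2)
        \<le> (\<Sum>e\<in>F. 2 * (norm (blinfun_apply M e))\<^sup>2 + 2 * (norm (blinfun_apply N e))\<^sup>2)"
      by (intro sum_mono) (simp add: blinfun.add_left)
    also have "\<dots> = 2 * (\<Sum>e\<in>F. (norm (blinfun_apply M e))\<^sup>2) + 2 * (\<Sum>e\<in>F. (norm (blinfun_apply N e))\<^sup>2)"
      by (simp add: sum.distrib sum_distrib_left)
    also have "\<dots> \<le> 2 * (hs_norm M)\<^sup>2 + 2 * (hs_norm N)\<^sup>2"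
      using hs_finite_le[OF assms(1) F] hs_finite_le[OF assms(2) F] by simp
    finally show ?thesis .
  qed
  thus "hilbert_schmidt (M + N)" "(hs_norm (M + N))\<^sup>2 \<le> 2 * (hs_norm M)\<^sup>2 + 2 * (hs_norm N)\<^sup>2"
    using hs_leI by blast+
qed

lemma hs_compose:
  fixes l :: "'h::real_inner \<Rightarrow>\<^sub>L 'h"
  assumes "hilbert_schmidt M"
  shows "hilbert_schmidt (l o\<^sub>L M)" "hs_norm (l o\<^sub>L M) \<le> norm l * hs_norm M"
proof -
  have "(\<Sum>e\<in>F. (norm (blinfun_apply (l o\<^sub>L M) e))\<^sup>2) \<le> (norm l * hs_norm M)\<^sup>2"
    if F: "finite F" "F \<subseteq> some_basis" for F
  proof -
    have "(\<Sum>e\<in>F. (norm (blinfun_apply (l o\<^sub>L M) e))\<^sup>2) \<le> (\<Sum>e\<in>F. (norm l * norm (blinfun_apply M e))\<^sup>2)"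
      by (intro sum_mono power_mono) (auto simp: norm_blinfun)
    also have "\<dots> = (norm l)\<^sup>2 * (\<Sum>e\<in>F. (norm (blinfun_apply M e))\<^sup>2)"
      by (simp add: power_mult_distrib sum_distrib_left)
    also have "\<dots> \<le> (norm l * hs_norm M)\<^sup>2"
      unfolding power_mult_distrib by (intro mult_left_mono hs_finite_le[OF assms F]) simp
    finally show ?thesis .
  qed
  hence *: "hilbert_schmidt (l o\<^sub>L M)" "(hs_norm (l o\<^sub>L M))\<^sup>2 \<le> (norm l * hs_norm M)\<^sup>2"
    using hs_leI by blast+
  show "hilbert_schmidt (l o\<^sub>L M)" by (rule *)
  show "hs_norm (l o\<^sub>L M) \<le> norm l * hs_norm M"
    using *(2) by (rule power2_le_imp_le) (intro mult_nonneg_nonneg norm_ge_zero hs_norm_nonneg)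
qed

lemma hs_diff:
  assumes "hilbert_schmidt M" "hilbert_schmidt N"
  shows "hilbert_schmidt (M - N)"
proof -
  have "hilbert_schmidt (- N)"
    using assms(2) unfolding hilbert_schmidt_def by (simp add: blinfun.minus_left)
  thus ?thesis using hs_add(1)[OF assms(1)] by (metis diff_conv_add_uminus)
qed

text \<open>Expand each G^* e in the basis of the domain (Parseval, up to an error), exchange the
  two finite sums, and apply Bessel to each G b with respect to E. The set E is arbitrary
  orthonormal and need not come from \<open>some_basis\<close>.\<close>

lemma adjoint_hs_finite:
  fixes G :: "'x::{real_inner,banach} \<Rightarrow>\<^sub>L 'h::real_inner"
  assumes G: "hilbert_schmidt G"
    and E: "finite E" "pairwise orthogonal E" "\<forall>e\<in>E. norm e = 1"
  shows "(\<Sum>e\<in>E. (norm (adjoint (blinfun_apply G) e))\<^sup>2) \<le> (hs_norm G)\<^sup>2"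
proof (rule field_le_epsilon)
  fix \<epsilon> :: real assume \<epsilon>: "0 < \<epsilon>"
  \<comment> \<open>The error is shared among the vectors of E; adding 1 keeps the divisor positive
    when E is empty.\<close>
  define \<epsilon>' where "\<epsilon>' = \<epsilon> / (card E + 1)"
  have \<epsilon>': "0 < \<epsilon>'" using \<epsilon> by (simp add: \<epsilon>'_def)
  have "\<forall>e. \<exists>F. finite F \<and> F \<subseteq> some_basis \<and>
      (norm (adjoint (blinfun_apply G) e))\<^sup>2 \<le> (\<Sum>b\<in>F. (adjoint (blinfun_apply G) e \<bullet> b)\<^sup>2) + \<epsilon>'"
    using parseval_le[OF \<epsilon>'] by blast
  then obtain F where F: "\<And>e. finite (F e)" "\<And>e. F e \<subseteq> some_basis"
    "\<And>e. (norm (adjoint (blinfun_apply G) e))\<^sup>2 \<le> (\<Sum>b\<in>F e. (adjoint (blinfun_apply G) e \<bullet> b)\<^sup>2) + \<epsilon>'"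
    by metis
  define U where "U = (\<Union>e\<in>E. F e)"
  have U: "finite U" "U \<subseteq> some_basis" using F E by (auto simp: U_def)
  have "(\<Sum>e\<in>E. (norm (adjoint (blinfun_apply G) e))\<^sup>2)
      \<le> (\<Sum>e\<in>E. (\<Sum>b\<in>U. (adjoint (blinfun_apply G) e \<bullet> b)\<^sup>2) + \<epsilon>')"
  proof (rule sum_mono)
    fix e assume "e \<in> E"
    hence "(\<Sum>b\<in>F e. (adjoint (blinfun_apply G) e \<bullet> b)\<^sup>2) \<le> (\<Sum>b\<in>U. (adjoint (blinfun_apply G) e \<bullet> b)\<^sup>2)"
      using U(1) by (intro sum_mono2) (auto simp: U_def)
    thus "(norm (adjoint (blinfun_apply G) e))\<^sup>2 \<le> (\<Sum>b\<in>U. (adjoint (blinfun_apply G) e \<bullet> b)\<^sup>2) + \<epsilon>'"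
      using F(3)[of e] by linarith
  qed
  also have "\<dots> = (\<Sum>b\<in>U. \<Sum>e\<in>E. (blinfun_apply G b \<bullet> e)\<^sup>2) + card E * \<epsilon>'"
    unfolding sum.distrib
    by (subst sum.swap) (simp add: adjoint_blinfun inner_commute[of "adjoint (blinfun_apply G) _"])
  also have "\<dots> \<le> (\<Sum>b\<in>U. (norm (blinfun_apply G b))\<^sup>2) + \<epsilon>"
  proof -
    have "card E * \<epsilon>' \<le> \<epsilon>" using \<epsilon> by (simp add: \<epsilon>'_def field_simps)
    thus ?thesis by (intro add_mono sum_mono bessel_finite E)
  qed
  also have "\<dots> \<le> (hs_norm G)\<^sup>2 + \<epsilon>"
    using hs_finite_le[OF G U] by simp
  finally show "(\<Sum>e\<in>E. (norm (adjoint (blinfun_apply G) e))\<^sup>2) \<le> (hs_norm G)\<^sup>2 + \<epsilon>" .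
qed

lemma adjoint_blinfun_scaleR:
  fixes G :: "'x::{real_inner,banach} \<Rightarrow>\<^sub>L 'h::real_inner"
  shows "adjoint (blinfun_apply G) (c *\<^sub>R y) = c *\<^sub>R adjoint (blinfun_apply G) y"
  by (rule adjoint_blinfun_eqI) (simp add: adjoint_blinfun)

text \<open>The previous bound applied to the single unit vector in the direction of y.\<close>

lemma norm_adjoint_le:
  fixes G :: "'x::{real_inner,banach} \<Rightarrow>\<^sub>L 'h::real_inner"
  assumes G: "hilbert_schmidt G"
  shows "norm (adjoint (blinfun_apply G) y) \<le> hs_norm G * norm y"
proof (cases "y = 0")
  case True
  have "adjoint (blinfun_apply G) (0 *\<^sub>R y) = 0"
    by (simp only: adjoint_blinfun_scaleR) simp
  thus ?thesis using True by simp
next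
  case False
  define e where "e = (1 / norm y) *\<^sub>R y"
  have "norm e = 1" using False by (simp add: e_def)
  hence "(norm (adjoint (blinfun_apply G) e))\<^sup>2 \<le> (hs_norm G)\<^sup>2"
    using adjoint_hs_finite[OF G, of "{e}"] by simp
  hence "norm (adjoint (blinfun_apply G) e) \<le> hs_norm G"
    by (rule power2_le_imp_le) (rule hs_norm_nonneg)
  thus ?thesis using False
    by (simp add: e_def adjoint_blinfun_scaleR field_simps)
qed

text \<open>Formally the trace of N M^*. Using the adjoints makes the sum run over the basis of the
  target space, the same one as in \<open>trace_op\<close>.\<close>

definition hs_inner ::
  "('x::real_inner \<Rightarrow>\<^sub>L 'h::real_inner) \<Rightarrow> ('x \<Rightarrow>\<^sub>L 'h) \<Rightarrow> real" where
  "hs_inner M N = (\<Sum>\<^sub>\<infinity>e\<in>some_basis. adjoint (blinfun_apply M) e \<bullet> adjoint (blinfun_apply N) e)"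

lemma trace_op_eq_hs_inner:
  fixes G :: "'x::{real_inner,banach} \<Rightarrow>\<^sub>L 'h::{real_inner,banach}"
  shows "trace_op (\<lambda>x. blinfun_apply l (blinfun_apply G (adjoint (blinfun_apply G) x)))
    = hs_inner G (l o\<^sub>L G)"
proof -
  have "blinfun_apply l (blinfun_apply G (adjoint (blinfun_apply G) x)) \<bullet> x
      = adjoint (blinfun_apply G) x \<bullet> adjoint (blinfun_apply (l o\<^sub>L G)) x" for x
    by (simp add: adjoint_blinfun)
  thus ?thesis unfolding trace_op_def hs_inner_def by simp
qed

lemma hs_inner_bound_finite:
  fixes M N :: "'x::{real_inner,banach} \<Rightarrow>\<^sub>L 'h::{real_inner,banach}"
  assumes M: "hilbert_schmidt M" and N: "hilbert_schmidt N"
    and F: "finite F" "F \<subseteq> some_basis"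
  shows "(\<Sum>e\<in>F. \<bar>adjoint (blinfun_apply M) e \<bullet> adjoint (blinfun_apply N) e\<bar>) \<le> hs_norm M * hs_norm N"
proof -
  let ?a = "\<lambda>e. norm (adjoint (blinfun_apply M) e)" and ?b = "\<lambda>e. norm (adjoint (blinfun_apply N) e)"
  have "(\<Sum>e\<in>F. \<bar>adjoint (blinfun_apply M) e \<bullet> adjoint (blinfun_apply N) e\<bar>) \<le> (\<Sum>e\<in>F. \<bar>?a e\<bar> * \<bar>?b e\<bar>)"
    by (intro sum_mono) (simp add: Cauchy_Schwarz_ineq2)
  also have "\<dots> \<le> L2_set ?a F * L2_set ?b F"
    by (rule L2_set_mult_ineq)
  also have "\<dots> \<le> hs_norm M * hs_norm N"
    unfolding L2_set_def
    using adjoint_hs_finite[OF M F(1) finite_basis_subset[OF F(2)]]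
      adjoint_hs_finite[OF N F(1) finite_basis_subset[OF F(2)]]
    by (intro mult_mono real_le_lsqrt) (auto simp: hs_norm_nonneg sum_nonneg)
  finally show ?thesis .
qed

lemma hs_inner_summable:
  fixes M N :: "'x::{real_inner,banach} \<Rightarrow>\<^sub>L 'h::{real_inner,banach}"
  assumes M: "hilbert_schmidt M" and N: "hilbert_schmidt N"
  shows "(\<lambda>e. adjoint (blinfun_apply M) e \<bullet> adjoint (blinfun_apply N) e) summable_on some_basis"
proof -
  have "(\<lambda>e. \<bar>adjoint (blinfun_apply M) e \<bullet> adjoint (blinfun_apply N) e\<bar>) summable_on some_basis"
    using hs_inner_bound_finite[OF M N]
    by (intro nonneg_bdd_above_summable_on) (auto intro!: bdd_aboveI[of _ "hs_norm M * hs_norm N"])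
  thus ?thesis using abs_summable_summable by (metis (no_types, lifting) real_norm_def summable_on_cong)
qed

lemma hs_inner_bound:
  fixes M N :: "'x::{real_inner,banach} \<Rightarrow>\<^sub>L 'h::{real_inner,banach}"
  assumes M: "hilbert_schmidt M" and N: "hilbert_schmidt N"
  shows "\<bar>hs_inner M N\<bar> \<le> hs_norm M * hs_norm N"
proof -
  let ?f = "\<lambda>e. adjoint (blinfun_apply M) e \<bullet> adjoint (blinfun_apply N) e"
  have fin: "\<bar>sum ?f F\<bar> \<le> hs_norm M * hs_norm N" if "finite F" "F \<subseteq> some_basis" for F
    using hs_inner_bound_finite[OF M N that] sum_abs[of ?f F] by linarith
  have "hs_inner M N \<le> hs_norm M * hs_norm N"
    unfolding hs_inner_def
    by (rule infsum_le_finite_sums[OF hs_inner_summable[OF M N]]) (use fin in fastforce)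
  moreover have "(\<Sum>\<^sub>\<infinity>e\<in>some_basis. - ?f e) \<le> hs_norm M * hs_norm N"
    by (rule infsum_le_finite_sums)
       (use fin summable_on_cmult_right[OF hs_inner_summable[OF M N], of "- 1"] in \<open>auto simp: sum_negf abs_le_iff\<close>)
  ultimately show ?thesis unfolding hs_inner_def by (simp add: infsum_uminus)
qed

lemma hs_inner_diff_left:
  fixes M N :: "'x::{real_inner,banach} \<Rightarrow>\<^sub>L 'h::{real_inner,banach}"
  assumes "hilbert_schmidt M" "hilbert_schmidt M'" "hilbert_schmidt N"
  shows "hs_inner (M - M') N = hs_inner M N - hs_inner M' N"
proof -
  let ?f = "\<lambda>M e. adjoint (blinfun_apply M) e \<bullet> adjoint (blinfun_apply N) e"
  have "(\<lambda>e. - 1 * ?f M' e) summable_on some_basis"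
    by (intro summable_on_cmult_right hs_inner_summable assms)
  from infsum_add[OF hs_inner_summable[OF assms(1,3)] this] show ?thesis
    unfolding hs_inner_def adjoint_blinfun_diff inner_diff_left by (simp add: infsum_uminus)
qed

lemma hs_inner_diff_right:
  fixes M N :: "'x::{real_inner,banach} \<Rightarrow>\<^sub>L 'h::{real_inner,banach}"
  assumes "hilbert_schmidt M" "hilbert_schmidt N" "hilbert_schmidt N'"
  shows "hs_inner M (N - N') = hs_inner M N - hs_inner M N'"
proof -
  have "hs_inner M N = hs_inner N M" for M N :: "'x \<Rightarrow>\<^sub>L 'h"
    unfolding hs_inner_def by (simp add: inner_commute)
  thus ?thesis using hs_inner_diff_left assms by metis
qed

text \<open>Bilinearity splits the difference of the traces into one in \<open>G\<^sub>1 - G\<close> (twice) and one in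
  \<open>l\<^sub>1 - l\<close>.\<close>

lemma hs_trace_diff:
  fixes G G\<^sub>1 :: "'x::{real_inner,banach} \<Rightarrow>\<^sub>L 'h::{real_inner,banach}" and l l\<^sub>1 :: "'h \<Rightarrow>\<^sub>L 'h"
  assumes G: "hilbert_schmidt G" and G1: "hilbert_schmidt G\<^sub>1"
  shows "\<bar>hs_inner G\<^sub>1 (l\<^sub>1 o\<^sub>L G\<^sub>1) - hs_inner G (l o\<^sub>L G)\<bar>
    \<le> norm l\<^sub>1 * hs_norm (G\<^sub>1 - G) * (hs_norm G\<^sub>1 + hs_norm G) + norm (l\<^sub>1 - l) * (hs_norm G)\<^sup>2"
proof -
  note D = hs_diff[OF G1 G]
  note c = hs_compose(1)
  have comp: "l\<^sub>1 o\<^sub>L (G\<^sub>1 - G) = (l\<^sub>1 o\<^sub>L G\<^sub>1) - (l\<^sub>1 o\<^sub>L G)" "(l\<^sub>1 - l) o\<^sub>L G = (l\<^sub>1 o\<^sub>L G) - (l o\<^sub>L G)"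
    by (auto intro!: blinfun_eqI simp: blinfun.bilinear_simps)
  have "hs_inner G\<^sub>1 (l\<^sub>1 o\<^sub>L G\<^sub>1) - hs_inner G (l o\<^sub>L G)
     = hs_inner (G\<^sub>1 - G) (l\<^sub>1 o\<^sub>L G\<^sub>1) + hs_inner G (l\<^sub>1 o\<^sub>L (G\<^sub>1 - G)) + hs_inner G ((l\<^sub>1 - l) o\<^sub>L G)"
    unfolding comp by (simp add: hs_inner_diff_left hs_inner_diff_right G G1 c)
  moreover have "\<bar>hs_inner (G\<^sub>1 - G) (l\<^sub>1 o\<^sub>L G\<^sub>1)\<bar> \<le> hs_norm (G\<^sub>1 - G) * (norm l\<^sub>1 * hs_norm G\<^sub>1)"
    using hs_inner_bound[OF D c[OF G1]]
    by (rule order_trans) (intro mult_left_mono hs_compose(2) G1 hs_norm_nonneg)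
  moreover have "\<bar>hs_inner G (l\<^sub>1 o\<^sub>L (G\<^sub>1 - G))\<bar> \<le> hs_norm G * (norm l\<^sub>1 * hs_norm (G\<^sub>1 - G))"
    using hs_inner_bound[OF G c[OF D]]
    by (rule order_trans) (intro mult_left_mono hs_compose(2) D hs_norm_nonneg)
  moreover have "\<bar>hs_inner G ((l\<^sub>1 - l) o\<^sub>L G)\<bar> \<le> hs_norm G * (norm (l\<^sub>1 - l) * hs_norm G)"
    using hs_inner_bound[OF G c[OF G]]
    by (rule order_trans) (intro mult_left_mono hs_compose(2) G hs_norm_nonneg)
  ultimately show ?thesis by (simp add: algebra_simps power2_eq_square)
qed

section \<open>The path space\<close>

lemma Lam_iff:
  "x \<in> Lam T t \<longleftrightarrow> t \<le> fst x \<and> fst x \<le> T \<and> snd x \<in> extensional {0..fst x} \<and> continuous_on {0..fst x} (snd x)"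
  by (cases x) (auto simp: Lam_def Cpaths_def)

lemma Cpaths_iff:
  "x \<in> Cpaths t \<longleftrightarrow> fst x = t \<and> snd x \<in> extensional {0..t} \<and> continuous_on {0..t} (snd x)"
  by (cases x) (auto simp: Cpaths_def)

lemma Lam_mono: "s \<le> t \<Longrightarrow> x \<in> Lam T t \<Longrightarrow> x \<in> Lam T s"
  by (auto simp: Lam_iff)

lemma continuous_norm_bdd:
  fixes f :: "real \<Rightarrow> 'a::real_normed_vector"
  assumes "continuous_on {0..s} f"
  shows "bdd_above ((\<lambda>\<sigma>. norm (f \<sigma>)) ` {0..s})"
  by (rule bounded_imp_bdd_above[OF compact_imp_bounded
        [OF compact_continuous_image[OF continuous_on_norm[OF assms] compact_Icc]]])

lemma norm_le_pnorm:
  assumes "continuous_on {0..fst x} (snd x)" "\<sigma> \<in> {0..fst x}"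
  shows "norm (snd x \<sigma>) \<le> pnorm x"
  unfolding pnorm_def by (rule cSUP_upper[OF assms(2) continuous_norm_bdd[OF assms(1)]])

text \<open>\<open>\<Upsilon>\<^sup>3\<close> as a function of the sup norm \<open>m\<close> and of the squared norm \<open>r\<close> of the endpoint. The
  truncation at \<open>0\<close> makes the formula valid also for the shifted paths whose norm is attained at the
  endpoint.\<close>

definition kp :: "real \<Rightarrow> real \<Rightarrow> real" where
  "kp m r = max (m ^ 6 - r ^ 3) 0 ^ 3 / m ^ 12 + 3 * r ^ 3"

lemma cube_le_pow6:
  fixes r m :: real
  assumes "0 \<le> r" "r \<le> m\<^sup>2"
  shows "r ^ 3 \<le> m ^ 6"
  using power_mono[OF assms(2,1), of 3] by (simp flip: power_mult)

lemma Ups_eq_kp: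
  assumes "norm (endpt \<gamma>) \<le> pnorm \<gamma>"
  shows "Ups \<gamma> = kp (pnorm \<gamma>) ((norm (endpt \<gamma>))\<^sup>2)"
proof -
  have "norm (endpt \<gamma>) ^ 6 \<le> pnorm \<gamma> ^ 6" by (rule power_mono[OF assms norm_ge_zero])
  thus ?thesis unfolding Ups_def Sfun_def kp_def
    using assms by (auto simp: max_def simp flip: power_mult)
qed

text \<open>With z = r^3 / m^6 in [0, 1], \<open>kp m r\<close> is m^6 times (1 - z)^3 + 3 z = 1 + 3
  z^2 - z^3, which lies between 1 and 3.\<close>

lemma kp_bounds:
  assumes "0 \<le> r" "r \<le> m\<^sup>2" "0 \<le> m"
  shows "m ^ 6 \<le> kp m r" "kp m r \<le> 3 * m ^ 6"
proof -
  have le: "r ^ 3 \<le> m ^ 6" by (rule cube_le_pow6) fact+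
  have "m ^ 6 \<le> kp m r \<and> kp m r \<le> 3 * m ^ 6"
  proof (cases "m = 0")
    case True
    hence "r = 0" using assms by simp
    thus ?thesis using True by (simp add: kp_def)
  next
    case False
    define M where "M = m ^ 6"
    have m: "0 < M" using False assms by (simp add: M_def)
    define z where "z = r ^ 3 / M"
    have z: "0 \<le> z" "z \<le> 1" "r ^ 3 = z * M" using le m assms by (auto simp: z_def M_def)
    have "m ^ 12 = M\<^sup>2" by (simp add: M_def flip: power_mult)
    moreover have "max (M - z * M) 0 = (1 - z) * M"
      using z(2) m by (simp add: max_def left_diff_distrib)
    ultimately have k: "kp m r = M * ((1 - z) ^ 3 + 3 * z)"
      using m unfolding kp_def z(3) M_def[symmetric] power_mult_distrib
      by (simp add: power2_eq_square power3_eq_cube distrib_left mult.commute)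
    have z2: "z ^ 3 \<le> z ^ 2" "z ^ 2 \<le> z"
      using z power_decreasing[of 2 3 z] power_decreasing[of 1 2 z] by simp_all
    have e: "(1 - z) ^ 3 + 3 * z = 1 + 3 * z ^ 2 - z ^ 3"
      by (simp add: power3_eq_cube power2_eq_square algebra_simps)
    have 1: "1 \<le> (1 - z) ^ 3 + 3 * z" unfolding e using z2 zero_le_power2[of z] by linarith
    have "z\<^sup>2 * (1 - z) \<le> 1 * (1 - z)"
      using z2 z by (intro mult_right_mono) auto
    hence "z\<^sup>2 - z ^ 3 \<le> 1 - z" by (simp add: power3_eq_cube power2_eq_square algebra_simps)
    hence 2: "(1 - z) ^ 3 + 3 * z \<le> 3" unfolding e using z2 z by linarith
    show ?thesis
      using mult_left_mono[OF 1, of M] mult_left_mono[OF 2, of M] m unfolding k M_def[symmetric] by simp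
  qed
  thus "m ^ 6 \<le> kp m r" "kp m r \<le> 3 * m ^ 6" by auto
qed

text \<open>The quotient in \<open>kp\<close> is continuous away from m = 0. In the limit m = 0 the
  constraint r \<le> m^2 forces r to 0 as well, and the bound 3 m^6 squeezes; division by 0 gives
  the right value 0 there.\<close>

lemma tendsto_kp:
  assumes m: "(m \<longlongrightarrow> M) Q" and r: "(r \<longlongrightarrow> R) Q" and Q: "Q \<noteq> bot"
    and b: "\<And>n. 0 \<le> m n" "\<And>n. 0 \<le> r n" "\<And>n. r n \<le> (m n)\<^sup>2"
  shows "((\<lambda>n. kp (m n) (r n)) \<longlongrightarrow> kp M R) Q"
proof (cases "M = 0")
  case False
  thus ?thesis unfolding kp_def by (intro tendsto_intros m r) auto
next
  case True
  have "((\<lambda>n. (m n)\<^sup>2) \<longlongrightarrow> 0) Q"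
    using tendsto_power[OF m, of 2] True by simp
  from tendsto_le[OF Q this r] have "R \<le> 0" using b(3) by simp
  moreover have "0 \<le> R" using tendsto_lowerbound[OF r _ Q] b(2) by simp
  ultimately have "kp M R = 0" using True by (simp add: kp_def)
  moreover have "((\<lambda>n. kp (m n) (r n)) \<longlongrightarrow> 0) Q"
  proof (rule tendsto_sandwich)
    show "((\<lambda>n. 0) \<longlongrightarrow> 0) Q" by simp
    show "((\<lambda>n. 3 * m n ^ 6) \<longlongrightarrow> 0) Q"
      using tendsto_mult[OF tendsto_const[of 3] tendsto_power[OF m, of 6]] True by simp
    have "0 \<le> kp (m n) (r n)" for n
      using kp_bounds(1)[OF b(2)[of n] b(3) b(1)] zero_le_power[OF b(1)[of n], of 6] by linarith
    thus "\<forall>\<^sub>F n in Q. 0 \<le> kp (m n) (r n)" by simp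
    show "\<forall>\<^sub>F n in Q. kp (m n) (r n) \<le> 3 * m n ^ 6"
      by (intro always_eventually allI kp_bounds(2) b)
  qed
  ultimately show ?thesis by simp
qed

section \<open>Freely evolved paths and the gauge\<close>

locale path_space =
  fixes S :: "real \<Rightarrow> 'h::{real_inner,banach} \<Rightarrow>\<^sub>L 'h" and T :: real
  assumes S: "contraction_semigroup S" and T: "0 < T"
begin

lemma S_zero [simp]: "blinfun_apply (S 0) x = x"
  using S by (simp add: contraction_semigroup_def c0_semigroup_def)

lemma S_add: "0 \<le> s \<Longrightarrow> 0 \<le> t \<Longrightarrow> blinfun_apply (S (s + t)) x = blinfun_apply (S s) (blinfun_apply (S t) x)"
  using S by (simp add: contraction_semigroup_def c0_semigroup_def)

lemma S_norm: "0 \<le> s \<Longrightarrow> norm (blinfun_apply (S s) x) \<le> norm x"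
  using S norm_blinfun[of "S s" x] mult_right_mono[of "norm (S s)" 1 "norm x"]
  by (simp add: contraction_semigroup_def)

text \<open>Contractivity bounds the increment from a to a + r by the increment from 0 to r. Right
  continuity at 0 thus gives one modulus for all times and for both sides.\<close>

lemma S_continuous: "continuous_on {0..} (\<lambda>s. blinfun_apply (S s) x)"
proof (clarsimp simp: continuous_on_iff)
  fix s e :: real assume s: "0 \<le> s" and e: "0 < e"
  have "((\<lambda>s. blinfun_apply (S s) x) \<longlongrightarrow> x) (at_right 0)"
    using S by (simp add: contraction_semigroup_def c0_semigroup_def)
  then obtain d where d: "0 < d" "\<And>r. 0 < r \<Longrightarrow> r < d \<Longrightarrow> dist (blinfun_apply (S r) x) x < e"
    using e unfolding tendsto_iff eventually_at_right_field by auto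
  have key: "dist (blinfun_apply (S (a + r)) x) (blinfun_apply (S a) x) < e"
    if "0 \<le> a" "0 \<le> r" "r < d" for a r
  proof (cases "r = 0")
    case True thus ?thesis using e by simp
  next
    case False
    have "dist (blinfun_apply (S (a + r)) x) (blinfun_apply (S a) x)
        = norm (blinfun_apply (S a) (blinfun_apply (S r) x - x))"
      using that by (simp add: S_add dist_norm blinfun.diff_right)
    also have "\<dots> \<le> norm (blinfun_apply (S r) x - x)" using that S_norm by blast
    finally show ?thesis using d(2)[of r] that False by (simp add: dist_norm)
  qed
  show "\<exists>d>0. \<forall>t\<in>{0..}. dist t s < d \<longrightarrow> dist (blinfun_apply (S t) x) (blinfun_apply (S s) x) < e"
  proof (intro exI[of _ d] conjI ballI impI d(1))
    fix t assume t: "t \<in> {0..}" "dist t s < d"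
    show "dist (blinfun_apply (S t) x) (blinfun_apply (S s) x) < e"
    proof (cases "s \<le> t")
      case True thus ?thesis using key[of s "t - s"] s t by (simp add: dist_real_def)
    next
      case False thus ?thesis using key[of t "s - t"] s t by (simp add: dist_real_def dist_commute)
    qed
  qed
qed

text \<open>Letting every path evolve freely up to the common time T makes paths with different
  final times comparable pointwise; \<open>D\<close> is then the sup distance on [0, T].\<close>

definition E :: "'h path \<Rightarrow> real \<Rightarrow> 'h" where
  "E x = snd (flow S T x)"

definition D :: "'h path \<Rightarrow> 'h path \<Rightarrow> real" where
  "D x y = pnorm (pdiff (flow S T x) (flow S T y))"

lemma E_eq:
  "\<sigma> \<in> {0..T} \<Longrightarrow> E x \<sigma> = (if \<sigma> \<le> fst x then snd x \<sigma> else blinfun_apply (S (\<sigma> - fst x)) (endpt x))"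
  by (simp add: E_def flow_def)

lemma E_endpt: "x \<in> Lam T 0 \<Longrightarrow> E x (fst x) = endpt x"
  by (auto simp: Lam_iff E_eq endpt_def)

lemma E_ge: "x \<in> Lam T 0 \<Longrightarrow> fst x \<le> \<sigma> \<Longrightarrow> \<sigma> \<le> T \<Longrightarrow> E x \<sigma> = blinfun_apply (S (\<sigma> - fst x)) (endpt x)"
  by (auto simp: Lam_iff E_eq endpt_def)

lemma E_flow:
  assumes "x \<in> Lam T 0" "fst x \<le> s" "s \<le> \<sigma>" "\<sigma> \<le> T"
  shows "E x \<sigma> = blinfun_apply (S (\<sigma> - s)) (E x s)"
  using assms S_add[of "\<sigma> - s" "s - fst x" "endpt x"] by (simp add: E_ge)

lemma E_continuous:
  assumes "x \<in> Lam T 0"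
  shows "continuous_on {0..T} (E x)"
proof -
  have t: "0 \<le> fst x" "fst x \<le> T" "continuous_on {0..fst x} (snd x)" using assms by (auto simp: Lam_iff)
  have "continuous_on ({0..fst x} \<union> {fst x..T}) (E x)"
  proof (rule continuous_on_closed_Un)
    show "continuous_on {0..fst x} (E x)"
      using t by (subst continuous_on_cong[OF refl, where g = "snd x"]) (auto simp: E_eq)
    have "continuous_on {fst x..T} (\<lambda>\<sigma>. blinfun_apply (S (\<sigma> - fst x)) (endpt x))"
      by (rule continuous_on_compose2[OF S_continuous]) (auto intro!: continuous_intros)
    thus "continuous_on {fst x..T} (E x)"
      using assms by (subst continuous_on_cong[OF refl]) (auto simp: E_ge)
  qed auto
  thus ?thesis using t by (simp add: ivl_disj_un_two_touch)
qed

lemma D_eq: "D x y = (SUP \<sigma>\<in>{0..T}. norm (E x \<sigma> - E y \<sigma>))"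
  unfolding D_def pnorm_def pdiff_def E_def flow_def by (intro SUP_cong) auto

lemma norm_E_le_D:
  assumes "x \<in> Lam T 0" "y \<in> Lam T 0" "\<sigma> \<in> {0..T}"
  shows "norm (E x \<sigma> - E y \<sigma>) \<le> D x y"
  unfolding D_eq using assms
  by (intro cSUP_upper continuous_norm_bdd continuous_on_diff E_continuous)

lemma D_least: "(\<And>\<sigma>. \<sigma> \<in> {0..T} \<Longrightarrow> norm (E x \<sigma> - E y \<sigma>) \<le> c) \<Longrightarrow> D x y \<le> c"
  unfolding D_eq using T by (intro cSUP_least) auto

lemma D_nonneg: "x \<in> Lam T 0 \<Longrightarrow> y \<in> Lam T 0 \<Longrightarrow> 0 \<le> D x y"
  using norm_E_le_D[of x y 0] T by (meson atLeastAtMost_iff less_imp_le norm_ge_zero order_refl order_trans)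

lemma D_sym: "D x y = D y x"
  unfolding D_eq by (simp add: norm_minus_commute)

lemma D_self [simp]: "D x x = 0"
  unfolding D_eq using T by simp

lemma D_triangle:
  assumes "x \<in> Lam T 0" "y \<in> Lam T 0" "z \<in> Lam T 0"
  shows "D x z \<le> D x y + D y z"
proof (rule D_least)
  fix \<sigma> assume s: "\<sigma> \<in> {0..T}"
  have "norm (E x \<sigma> - E z \<sigma>) \<le> norm (E x \<sigma> - E y \<sigma>) + norm (E y \<sigma> - E z \<sigma>)"
    by (rule norm_diff_triangle_ineq[of "E x \<sigma>" "E y \<sigma>" "E y \<sigma>" "E z \<sigma>", simplified, THEN order_trans]) simp
  thus "norm (E x \<sigma> - E z \<sigma>) \<le> D x y + D y z"
    using norm_E_le_D[OF assms(1,2) s] norm_E_le_D[OF assms(2,3) s] by linarith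
qed

lemma dinf_eq: "dinf T S x y = \<bar>fst x - fst y\<bar> + D x y"
  by (simp add: dinf_def D_def)

lemma pdiff_flow:
  assumes "x \<in> Lam T 0" "y \<in> Lam T 0" "fst x \<le> fst y"
  shows "pdiff y (flow S (fst y) x) = (fst y, \<lambda>\<sigma>\<in>{0..fst y}. E y \<sigma> - E x \<sigma>)"
  unfolding pdiff_def using assms by (auto simp: E_eq flow_def Lam_iff intro!: restrict_ext)

lemma pdiff_flow_Lam:
  assumes "x \<in> Lam T 0" "y \<in> Lam T 0" "fst x \<le> fst y"
  shows "pdiff y (flow S (fst y) x) \<in> Lam T (fst y)"
proof -
  have "continuous_on {0..fst y} (\<lambda>\<sigma>. E y \<sigma> - E x \<sigma>)"
    using assms by (intro continuous_on_diff continuous_on_subset[OF E_continuous]) (auto simp: Lam_iff)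
  hence "continuous_on {0..fst y} (\<lambda>\<sigma>\<in>{0..fst y}. E y \<sigma> - E x \<sigma>)"
    by (subst continuous_on_cong[OF refl]) auto
  thus ?thesis using assms unfolding pdiff_flow[OF assms] Lam_iff by auto
qed

lemma fst_pdiff [simp]: "fst (pdiff y x) = fst y"
  by (simp add: pdiff_def)

text \<open>Contractivity lets the difference of two freely evolving paths decay after their final times.\<close>

lemma pnorm_pdiff_flow:
  assumes "x \<in> Lam T 0" "y \<in> Lam T 0" "fst x \<le> fst y"
  shows "pnorm (pdiff y (flow S (fst y) x)) = D x y"
proof -
  have y: "0 \<le> fst y" "fst y \<le> T" using assms by (auto simp: Lam_iff)
  have "pnorm (pdiff y (flow S (fst y) x)) = (SUP \<sigma>\<in>{0..fst y}. norm (E y \<sigma> - E x \<sigma>))"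
    unfolding pdiff_flow[OF assms] pnorm_def by simp
  also have "\<dots> = D y x"
  proof (rule antisym)
    show "(SUP \<sigma>\<in>{0..fst y}. norm (E y \<sigma> - E x \<sigma>)) \<le> D y x"
      using assms y by (intro cSUP_least norm_E_le_D) auto
    show "D y x \<le> (SUP \<sigma>\<in>{0..fst y}. norm (E y \<sigma> - E x \<sigma>))"
    proof (rule D_least)
      fix \<sigma> assume s: "\<sigma> \<in> {0..T}"
      have "continuous_on {0..fst y} (\<lambda>\<sigma>. E y \<sigma> - E x \<sigma>)"
        using assms by (intro continuous_on_diff continuous_on_subset[OF E_continuous]) (auto simp: Lam_iff)
      hence up: "norm (E y \<sigma> - E x \<sigma>) \<le> (SUP \<sigma>\<in>{0..fst y}. norm (E y \<sigma> - E x \<sigma>))" if "\<sigma> \<in> {0..fst y}" for \<sigma>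
        using that by (intro cSUP_upper continuous_norm_bdd)
      show "norm (E y \<sigma> - E x \<sigma>) \<le> (SUP \<sigma>\<in>{0..fst y}. norm (E y \<sigma> - E x \<sigma>))"
      proof (cases "\<sigma> \<le> fst y")
        case True thus ?thesis using up s by simp
      next
        case False
        hence "E y \<sigma> - E x \<sigma> = blinfun_apply (S (\<sigma> - fst y)) (E y (fst y) - E x (fst y))"
          using assms s by (simp add: E_flow[of _ "fst y" \<sigma>] blinfun.diff_right)
        hence "norm (E y \<sigma> - E x \<sigma>) \<le> norm (E y (fst y) - E x (fst y))"
          using False S_norm by simp
        thus ?thesis using up[of "fst y"] y by simp
      qed
    qed
  qed
  finally show ?thesis by (simp add: D_sym)
qed

lemma endpt_pdiff_flow:
  assumes "x \<in> Lam T 0" "y \<in> Lam T 0" "fst x \<le> fst y"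
  shows "endpt (pdiff y (flow S (fst y) x)) = E y (fst y) - E x (fst y)"
  using assms by (simp add: pdiff_flow endpt_def Lam_iff)

lemma Ups_pdiff_flow:
  assumes "x \<in> Lam T 0" "y \<in> Lam T 0" "fst x \<le> fst y"
  shows "Ups (pdiff y (flow S (fst y) x)) = kp (D x y) ((norm (E y (fst y) - E x (fst y)))\<^sup>2)"
proof -
  have "norm (E y (fst y) - E x (fst y)) \<le> D y x"
    using assms by (intro norm_E_le_D) (auto simp: Lam_iff)
  thus ?thesis
    using assms by (subst Ups_eq_kp) (simp_all add: endpt_pdiff_flow pnorm_pdiff_flow D_sym)
qed

text \<open>The two branches of \<open>Ups_bar\<close> extend the earlier path to the later final
  time. \<open>E\<close> has extended both paths already, so evaluation at the maximum of the final
  times covers both branches in a symmetric formula.\<close>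

lemma Ups_bar_eq:
  assumes "x \<in> Lam T 0" "y \<in> Lam T 0"
  shows "Ups_bar S x y = kp (D x y) ((norm (E x (max (fst x) (fst y)) - E y (max (fst x) (fst y))))\<^sup>2)
    + (fst x - fst y)\<^sup>2"
proof (cases "fst x \<le> fst y")
  case True
  thus ?thesis using assms
    by (simp add: Ups_bar_def Ups_pdiff_flow max_def norm_minus_commute power2_commute)
next
  case False
  thus ?thesis using assms
    by (simp add: Ups_bar_def Ups_pdiff_flow max_def D_sym norm_minus_commute power2_commute)
qed

lemma max_fst_mem: "x \<in> Lam T 0 \<Longrightarrow> y \<in> Lam T 0 \<Longrightarrow> max (fst x) (fst y) \<in> {0..T}"
  by (auto simp: Lam_iff)

lemma Ups_bar_bounds:
  assumes "x \<in> Lam T 0" "y \<in> Lam T 0"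
  shows "D x y ^ 6 + (fst x - fst y)\<^sup>2 \<le> Ups_bar S x y"
    and "Ups_bar S x y \<le> 3 * D x y ^ 6 + (fst x - fst y)\<^sup>2"
  using kp_bounds[OF zero_le_power2 power_mono[OF norm_E_le_D[OF assms max_fst_mem[OF assms]] norm_ge_zero]
      D_nonneg[OF assms]]
  by (simp_all add: Ups_bar_eq assms)

lemma Ups_bar_nonneg: "x \<in> Lam T 0 \<Longrightarrow> y \<in> Lam T 0 \<Longrightarrow> 0 \<le> Ups_bar S x y"
  using Ups_bar_bounds(1)[of x y] D_nonneg[of x y]
  by (meson add_nonneg_nonneg order_trans zero_le_power zero_le_power2)

lemma Ups_bar_self: "x \<in> Lam T 0 \<Longrightarrow> Ups_bar S x x = 0"
  using Ups_bar_bounds[of x x] by simp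

text \<open>Serves as an origin: it ends before every other path, and the norm of a path is its
  distance \<open>D\<close> to this one, so facts about \<open>D\<close> and \<open>Ups_bar\<close>
  specialize to \<open>pnorm\<close> and \<open>Ups\<close>.\<close>

definition zero_path :: "'h path" where
  "zero_path = (0, \<lambda>\<sigma>\<in>{0..0}. 0)"

lemma zero_path_Lam: "zero_path \<in> Lam T 0" and fst_zero_path [simp]: "fst zero_path = 0"
  using T by (auto simp: zero_path_def Lam_iff)

lemma E_zero_path: "\<sigma> \<in> {0..T} \<Longrightarrow> E zero_path \<sigma> = 0"
  by (auto simp: E_eq zero_path_def endpt_def blinfun.zero_right)

lemma snd_zero_path [simp]: "snd zero_path 0 = 0" and endpt_zero_path [simp]: "endpt zero_path = 0"
  by (simp_all add: zero_path_def endpt_def)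

lemma pdiff_zero_path:
  assumes "x \<in> Lam T 0"
  shows "pdiff x (flow S (fst x) zero_path) = x"
proof -
  have "pdiff x (flow S (fst x) zero_path) = (fst x, \<lambda>\<sigma>\<in>{0..fst x}. E x \<sigma> - E zero_path \<sigma>)"
    using assms by (intro pdiff_flow zero_path_Lam) (auto simp: Lam_iff)
  also have "(\<lambda>\<sigma>\<in>{0..fst x}. E x \<sigma> - E zero_path \<sigma>) = snd x"
    using assms by (intro extensionalityI[where A = "{0..fst x}"]) (auto simp: Lam_iff E_eq blinfun.zero_right)
  finally show ?thesis by simp
qed

lemma pnorm_eq_D: "x \<in> Lam T 0 \<Longrightarrow> pnorm x = D zero_path x"
  using pnorm_pdiff_flow[OF zero_path_Lam, of x] by (simp add: pdiff_zero_path Lam_iff)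

lemma D_le_pnorm: "x \<in> Lam T 0 \<Longrightarrow> y \<in> Lam T 0 \<Longrightarrow> D x y \<le> pnorm x + pnorm y"
  using D_triangle[OF _ zero_path_Lam, of x y] by (simp add: pnorm_eq_D D_sym)

lemma pnorm_nonneg: "0 \<le> pnorm x" if "x \<in> Lam T 0" for x :: "'h path"
  using that D_nonneg[OF zero_path_Lam, of x] by (simp add: pnorm_eq_D)

subsection \<open>Convergence\<close>

text \<open>All limits of path functionals are taken along sequences. Membership in
  \<open>Lam T 0\<close> is built in because continuity of the paths is what makes the supremum
  defining \<open>D\<close> behave as a distance.\<close>

definition conv :: "(nat \<Rightarrow> 'h path) \<Rightarrow> 'h path \<Rightarrow> bool" where
  "conv xs x \<longleftrightarrow> (\<forall>n. xs n \<in> Lam T 0) \<and> x \<in> Lam T 0 \<and> (\<lambda>n. dinf T S x (xs n)) \<longlonglongrightarrow> 0"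

lemma convD:
  assumes "conv xs x"
  shows "\<And>n. xs n \<in> Lam T 0" "x \<in> Lam T 0" "(\<lambda>n. D x (xs n)) \<longlonglongrightarrow> 0" "(\<lambda>n. fst (xs n)) \<longlonglongrightarrow> fst x"
proof -
  show xs: "\<And>n. xs n \<in> Lam T 0" and x: "x \<in> Lam T 0" using assms by (auto simp: conv_def)
  have d: "(\<lambda>n. dinf T S x (xs n)) \<longlonglongrightarrow> 0" using assms by (simp add: conv_def)
  show "(\<lambda>n. D x (xs n)) \<longlonglongrightarrow> 0"
    using d by (rule tendsto_sandwich[OF _ _ tendsto_const, rotated 2])
       (auto simp: D_nonneg xs x dinf_eq)
  have "(\<lambda>n. \<bar>fst x - fst (xs n)\<bar>) \<longlonglongrightarrow> 0"
    using d by (rule tendsto_sandwich[OF _ _ tendsto_const, rotated 2])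
       (auto simp: D_nonneg xs x dinf_eq)
  hence "(\<lambda>n. fst x - fst (xs n)) \<longlonglongrightarrow> 0" by (rule tendsto_rabs_zero_cancel)
  from tendsto_diff[OF tendsto_const[of "fst x"] this] show "(\<lambda>n. fst (xs n)) \<longlonglongrightarrow> fst x" by simp
qed

lemma convI:
  assumes "\<And>n. xs n \<in> Lam T 0" "x \<in> Lam T 0" "(\<lambda>n. D x (xs n)) \<longlonglongrightarrow> 0" "(\<lambda>n. fst (xs n)) \<longlonglongrightarrow> fst x"
  shows "conv xs x"
proof -
  have "(\<lambda>n. \<bar>fst x - fst (xs n)\<bar> + D x (xs n)) \<longlonglongrightarrow> \<bar>fst x - fst x\<bar> + 0"
    by (intro tendsto_intros assms)
  thus ?thesis using assms by (simp add: conv_def dinf_eq)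
qed

text \<open>The evaluation time may move with the path: the uniform distance transfers the
  evaluation to the limit path, whose evolution is continuous. This is needed at the moving final
  times.\<close>

lemma conv_E:
  assumes "conv xs x" "t \<longlonglongrightarrow> t0" "\<And>n. t n \<in> {0..T}" "t0 \<in> {0..T}"
  shows "(\<lambda>n. E (xs n) (t n)) \<longlonglongrightarrow> E x t0"
proof -
  note c = convD[OF assms(1)]
  have "(\<lambda>n. E x (t n)) \<longlonglongrightarrow> E x t0"
    using continuous_on_tendsto_compose[OF E_continuous[OF c(2)] assms(2,4)] assms(3) by simp
  moreover have "(\<lambda>n. E (xs n) (t n) - E x (t n)) \<longlonglongrightarrow> 0"
    using norm_E_le_D[OF c(1) c(2) assms(3)]
    by (intro Lim_null_comparison[OF _ c(3)] always_eventually) (auto simp: D_sym)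
  ultimately show ?thesis using tendsto_add by fastforce
qed

lemma conv_D:
  assumes "conv xs x" "y \<in> Lam T 0"
  shows "(\<lambda>n. D (xs n) y) \<longlonglongrightarrow> D x y"
proof -
  note c = convD[OF assms(1)]
  have "\<bar>D (xs n) y - D x y\<bar> \<le> D x (xs n)" for n
    using D_triangle[OF c(1) c(2) assms(2), of n] D_triangle[OF c(2) c(1) assms(2), of n]
    by (simp add: D_sym)
  hence "(\<lambda>n. D (xs n) y - D x y) \<longlonglongrightarrow> 0"
    by (intro Lim_null_comparison[OF _ c(3)] always_eventually) auto
  thus ?thesis by (simp add: LIM_zero_iff)
qed

lemma conv_pnorm: "conv xs x \<Longrightarrow> (\<lambda>n. pnorm (xs n)) \<longlonglongrightarrow> pnorm x"
  using conv_D[OF _ zero_path_Lam, of xs x] convD[of xs x] by (simp add: pnorm_eq_D D_sym[of zero_path])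

lemma conv_Ups_bar:
  assumes "conv xs x" "y \<in> Lam T 0"
  shows "(\<lambda>n. Ups_bar S (xs n) y) \<longlonglongrightarrow> Ups_bar S x y"
proof -
  note c = convD[OF assms(1)]
  have "(\<lambda>n. kp (D (xs n) y) ((norm (E (xs n) (max (fst (xs n)) (fst y)) - E y (max (fst (xs n)) (fst y))))\<^sup>2)
    + (fst (xs n) - fst y)\<^sup>2)
    \<longlonglongrightarrow> kp (D x y) ((norm (E x (max (fst x) (fst y)) - E y (max (fst x) (fst y))))\<^sup>2)
    + (fst x - fst y)\<^sup>2"
  proof (intro tendsto_add tendsto_kp tendsto_power tendsto_norm tendsto_diff conv_D assms c(4) tendsto_const)
    have m: "(\<lambda>n. max (fst (xs n)) (fst y)) \<longlonglongrightarrow> max (fst x) (fst y)"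
      by (intro tendsto_max c(4) tendsto_const)
    show "(\<lambda>n. E (xs n) (max (fst (xs n)) (fst y))) \<longlonglongrightarrow> E x (max (fst x) (fst y))"
      by (intro conv_E assms m max_fst_mem c)
    show "(\<lambda>n. E y (max (fst (xs n)) (fst y))) \<longlonglongrightarrow> E y (max (fst x) (fst y))"
      by (rule continuous_on_tendsto_compose[OF E_continuous[OF assms(2)] m])
         (auto intro!: max_fst_mem c assms always_eventually simp del: atLeastAtMost_iff)
    show "0 \<le> D (xs n) y" for n by (intro D_nonneg c assms)
    show "(norm (E (xs n) (max (fst (xs n)) (fst y)) - E y (max (fst (xs n)) (fst y))))\<^sup>2 \<le> (D (xs n) y)\<^sup>2" for n
      by (intro power_mono norm_E_le_D c assms max_fst_mem norm_ge_zero)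
  qed simp_all
  thus ?thesis using c assms by (simp add: Ups_bar_eq)
qed

lemma Ups_bar_sym: "x \<in> Lam T 0 \<Longrightarrow> y \<in> Lam T 0 \<Longrightarrow> Ups_bar S x y = Ups_bar S y x"
  by (simp add: Ups_bar_eq D_sym norm_minus_commute power2_commute max.commute)

lemma conv_if_Ups_bar:
  assumes "\<And>n. xs n \<in> Lam T 0" "x \<in> Lam T 0" "(\<lambda>n. Ups_bar S x (xs n)) \<longlonglongrightarrow> 0"
  shows "conv xs x"
proof (rule convI)
  have b: "0 \<le> D x (xs n) ^ 6" "D x (xs n) ^ 6 \<le> Ups_bar S x (xs n)" "(fst x - fst (xs n))\<^sup>2 \<le> Ups_bar S x (xs n)" for n
  proof -
    show 0: "0 \<le> D x (xs n) ^ 6" using D_nonneg assms by simp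
    show "D x (xs n) ^ 6 \<le> Ups_bar S x (xs n)" "(fst x - fst (xs n))\<^sup>2 \<le> Ups_bar S x (xs n)"
      using Ups_bar_bounds(1)[OF assms(2,1), of n] zero_le_power2[of "fst x - fst (xs n)"] 0 by linarith+
  qed
  have "(\<lambda>n. D x (xs n) ^ 6) \<longlonglongrightarrow> 0"
    using assms(3) by (rule tendsto_sandwich[OF _ _ tendsto_const, rotated 2]) (auto simp: b)
  from tendsto_real_root[OF this, of 6] show "(\<lambda>n. D x (xs n)) \<longlonglongrightarrow> 0"
    using assms D_nonneg by (simp add: real_root_power_cancel)
  have "(\<lambda>n. (fst x - fst (xs n))\<^sup>2) \<longlonglongrightarrow> 0"
    using assms(3) by (rule tendsto_sandwich[OF _ _ tendsto_const, rotated 2]) (auto simp: b)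
  from tendsto_real_sqrt[OF this] have "(\<lambda>n. fst x - fst (xs n)) \<longlonglongrightarrow> 0"
    by (simp add: tendsto_rabs_zero_iff)
  from tendsto_diff[OF tendsto_const[of "fst x"] this] show "(\<lambda>n. fst (xs n)) \<longlonglongrightarrow> fst x" by simp
qed fact+

text \<open>The uniform limit of the freely evolved paths is again freely evolving after the limit \<open>t\<close> of
  the final times, and therefore comes from a path with final time \<open>t\<close>.\<close>

lemma path_complete:
  assumes xs: "\<And>n. xs n \<in> Lam T 0" and t: "(\<lambda>n. fst (xs n)) \<longlonglongrightarrow> t"
    and C: "\<And>e. 0 < e \<Longrightarrow> \<exists>N. \<forall>n\<ge>N. \<forall>m\<ge>N. D (xs n) (xs m) < e"
  shows "\<exists>x. conv xs x \<and> fst x = t"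
proof -
  have tT: "0 \<le> t" "t \<le> T"
    using xs by (auto simp: Lam_iff intro!: LIMSEQ_le_const[OF t] LIMSEQ_le_const2[OF t])
  have "uniformly_Cauchy_on {0..T} (\<lambda>n. E (xs n))"
  proof (rule uniformly_Cauchy_onI)
    fix e :: real assume "0 < e"
    from C[OF this] obtain N where N: "\<And>n m. n \<ge> N \<Longrightarrow> m \<ge> N \<Longrightarrow> D (xs n) (xs m) < e" by blast
    show "\<exists>M. \<forall>x\<in>{0..T}. \<forall>m\<ge>M. \<forall>n\<ge>M. dist (E (xs m) x) (E (xs n) x) < e"
      unfolding dist_norm by (intro exI[of _ N] ballI allI impI le_less_trans[OF norm_E_le_D[OF xs xs] N])
  qed
  then obtain e where e: "uniform_limit {0..T} (\<lambda>n. E (xs n)) e sequentially"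
    using Cauchy_uniformly_convergent uniformly_convergent_on_def by blast
  have econt: "continuous_on {0..T} e"
    by (rule uniform_limit_theorem[OF _ e]) (auto intro!: E_continuous xs always_eventually)
  define x where "x = (t, restrict e {0..t})"
  have "continuous_on {0..t} (restrict e {0..t})"
    by (rule continuous_on_eq[OF continuous_on_subset[OF econt]]) (use tT in auto)
  hence x: "x \<in> Lam T 0" unfolding x_def Lam_iff using tT by auto
  have Exl: "E x \<sigma> = e \<sigma>" if s: "\<sigma> \<in> {0..T}" for \<sigma>
  proof (cases "\<sigma> \<le> t")
    case True thus ?thesis using s by (simp add: E_eq x_def)
  next
    case False
    have pt: "(\<lambda>n. E (xs n) \<sigma>) \<longlonglongrightarrow> e \<sigma>" by (rule tendsto_uniform_limitI[OF e s])
    have ends: "(\<lambda>n. E (xs n) (fst (xs n))) \<longlonglongrightarrow> e t"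
    proof -
      have "(\<lambda>n. e (fst (xs n))) \<longlonglongrightarrow> e t"
        using continuous_on_tendsto_compose[OF econt t] tT xs by (auto simp: Lam_iff)
      moreover have "(\<lambda>n. E (xs n) (fst (xs n)) - e (fst (xs n))) \<longlonglongrightarrow> 0"
      proof (rule LIMSEQ_I)
        fix r :: real assume "0 < r"
        then obtain N where "\<forall>n\<ge>N. \<forall>s\<in>{0..T}. dist (E (xs n) s) (e s) < r"
          using e unfolding uniform_limit_sequentially_iff by blast
        moreover have "fst (xs n) \<in> {0..T}" for n using xs by (auto simp: Lam_iff)
        ultimately have "\<forall>n\<ge>N. norm (E (xs n) (fst (xs n)) - e (fst (xs n)) - 0) < r"
          by (auto simp: dist_norm simp del: atLeastAtMost_iff)
        thus "\<exists>N. \<forall>n\<ge>N. norm (E (xs n) (fst (xs n)) - e (fst (xs n)) - 0) < r" by blast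
      qed
      ultimately show ?thesis using tendsto_add by fastforce
    qed
    \<comment> \<open>From here on only terms ending before \<sigma> are used, so that the semigroup
      appears at nonnegative times only.\<close>
    have ev: "\<forall>\<^sub>F n in sequentially. fst (xs n) < \<sigma>"
      using order_tendstoD(2)[OF t] False by simp
    have "(\<lambda>n. blinfun_apply (S (\<sigma> - fst (xs n))) (E (xs n) (fst (xs n)))) \<longlonglongrightarrow> blinfun_apply (S (\<sigma> - t)) (e t)"
    proof -
      have "\<forall>\<^sub>F n in sequentially. norm (blinfun_apply (S (\<sigma> - fst (xs n))) (E (xs n) (fst (xs n)) - e t))
          \<le> norm (E (xs n) (fst (xs n)) - e t)"
        using ev by eventually_elim (rule S_norm, simp)
      hence 1: "(\<lambda>n. blinfun_apply (S (\<sigma> - fst (xs n))) (E (xs n) (fst (xs n)) - e t)) \<longlonglongrightarrow> 0"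
        by (rule Lim_null_comparison) (use ends in \<open>simp add: LIM_zero tendsto_norm_zero\<close>)
      have 2: "(\<lambda>n. blinfun_apply (S (\<sigma> - fst (xs n))) (e t)) \<longlonglongrightarrow> blinfun_apply (S (\<sigma> - t)) (e t)"
      proof (rule continuous_on_tendsto_compose[OF S_continuous])
        show "(\<lambda>n. \<sigma> - fst (xs n)) \<longlonglongrightarrow> \<sigma> - t" by (intro tendsto_intros t)
        show "\<forall>\<^sub>F n in sequentially. \<sigma> - fst (xs n) \<in> {0..}" using ev by eventually_elim simp
      qed (use False in simp)
      from tendsto_add[OF 1 2] show ?thesis by (simp add: blinfun.diff_right)
    qed
    moreover have "\<forall>\<^sub>F n in sequentially. blinfun_apply (S (\<sigma> - fst (xs n))) (E (xs n) (fst (xs n))) = E (xs n) \<sigma>"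
      using ev by eventually_elim (intro E_flow[symmetric] xs; use s in simp)
    ultimately have "(\<lambda>n. E (xs n) \<sigma>) \<longlonglongrightarrow> blinfun_apply (S (\<sigma> - t)) (e t)"
      by (rule Lim_transform_eventually)
    hence "e \<sigma> = blinfun_apply (S (\<sigma> - t)) (e t)" using pt LIMSEQ_unique by blast
    thus ?thesis using False s tT by (simp add: E_eq x_def endpt_def)
  qed
  have "(\<lambda>n. D x (xs n)) \<longlonglongrightarrow> 0"
  proof (rule LIMSEQ_I)
    fix r :: real assume r: "0 < r"
    then obtain N where N: "\<forall>n\<ge>N. \<forall>s\<in>{0..T}. dist (E (xs n) s) (e s) < r / 2"
      using e unfolding uniform_limit_sequentially_iff by (meson half_gt_zero)
    have "norm (D x (xs n) - 0) < r" if n: "n \<ge> N" for n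
    proof -
      have "D x (xs n) \<le> r / 2"
        using N n by (intro D_least) (auto simp: Exl dist_norm norm_minus_commute intro: less_imp_le simp del: atLeastAtMost_iff)
      thus ?thesis using r D_nonneg[OF x xs, of n] by simp
    qed
    thus "\<exists>N. \<forall>n\<ge>N. norm (D x (xs n) - 0) < r" by blast
  qed
  hence "conv xs x" using t by (intro convI xs x) (auto simp: x_def)
  thus ?thesis by (intro exI[of _ x]) (simp add: x_def)
qed

subsection \<open>Continuity of path functionals\<close>

lemma filterlim_path_nhds:
  assumes "\<And>n. xs n \<in> X" "(\<lambda>n. dinf T S x (xs n)) \<longlonglongrightarrow> 0"
  shows "filterlim xs (path_nhds T S X x) sequentially"
  unfolding path_nhds_def filterlim_INF filterlim_principal
  using assms order_tendstoD(2)[OF assms(2)] by auto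

lemma path_continuous_conv:
  assumes "path_continuous T S X f" "conv xs x" "\<And>n. xs n \<in> X" "x \<in> X"
  shows "(\<lambda>n. f (xs n)) \<longlonglongrightarrow> f x"
proof -
  have "(f \<longlongrightarrow> f x) (path_nhds T S X x)"
    using assms by (auto simp: path_continuous_def)
  moreover have "filterlim xs (path_nhds T S X x) sequentially"
    using assms by (intro filterlim_path_nhds) (auto simp: conv_def)
  ultimately show ?thesis by (rule filterlim_compose)
qed

lemma eventually_path_nhds:
  "eventually P (path_nhds T S X x) \<longleftrightarrow> (\<exists>r>0. \<forall>y\<in>X. dinf T S x y < r \<longrightarrow> P y)"
proof -
  have "eventually P (path_nhds T S X x) \<longleftrightarrow> (\<exists>r\<in>{0<..}. eventually P (principal {y \<in> X. dinf T S x y < r}))"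
    unfolding path_nhds_def
  proof (rule eventually_INF_base)
    fix a b :: real assume "a \<in> {0<..}" "b \<in> {0<..}"
    thus "\<exists>c\<in>{0<..}. principal {y \<in> X. dinf T S x y < c} \<le> inf (principal {y \<in> X. dinf T S x y < a}) (principal {y \<in> X. dinf T S x y < b})"
      by (intro bexI[of _ "min a b"]) auto
  qed auto
  thus ?thesis by (auto simp: eventually_principal)
qed

text \<open>The neighbourhood filter has a countable base of balls with radii 1 / (n + 1), so
  sequences detect continuity.\<close>

lemma path_continuousI:
  fixes f :: "'h path \<Rightarrow> 'b::metric_space"
  assumes X: "X \<subseteq> Lam T 0"
    and c: "\<And>xs x. conv xs x \<Longrightarrow> (\<And>n. xs n \<in> X) \<Longrightarrow> x \<in> X \<Longrightarrow> (\<lambda>n. f (xs n)) \<longlonglongrightarrow> f x"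
  shows "path_continuous T S X f"
  unfolding path_continuous_def
proof (rule ballI, rule ccontr)
  fix x assume x: "x \<in> X" and n: "\<not> (f \<longlongrightarrow> f x) (path_nhds T S X x)"
  then obtain e where e: "0 < e" "\<not> (\<forall>\<^sub>F y in path_nhds T S X x. dist (f y) (f x) < e)"
    unfolding tendsto_iff by blast
  hence "\<forall>r>0. \<exists>y\<in>X. dinf T S x y < r \<and> \<not> dist (f y) (f x) < e"
    unfolding eventually_path_nhds by blast
  hence "\<forall>n. \<exists>y\<in>X. dinf T S x y < 1 / real (Suc n) \<and> \<not> dist (f y) (f x) < e" by simp
  then obtain xs where xs: "\<And>n. xs n \<in> X" "\<And>n. dinf T S x (xs n) < 1 / real (Suc n)" "\<And>n. \<not> dist (f (xs n)) (f x) < e"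
    by metis
  have "(\<lambda>n. dinf T S x (xs n)) \<longlonglongrightarrow> 0"
  proof (rule tendsto_sandwich[OF _ _ tendsto_const LIMSEQ_Suc[OF lim_1_over_n]])
    have "0 \<le> dinf T S x (xs n)" for n
      unfolding dinf_eq using X x xs(1)[of n] by (intro add_nonneg_nonneg D_nonneg abs_ge_zero) blast+
    thus "\<forall>\<^sub>F n in sequentially. 0 \<le> dinf T S x (xs n)" by simp
    show "\<forall>\<^sub>F n in sequentially. dinf T S x (xs n) \<le> 1 / real (Suc n)"
      by (intro always_eventually allI less_imp_le xs)
  qed
  hence "conv xs x" using X x xs by (auto simp: conv_def)
  from c[OF this xs(1) x] have "\<forall>\<^sub>F n in sequentially. dist (f (xs n)) (f x) < e"
    using e(1) tendstoD by blast
  thus False using xs(3) by simp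
qed

end

section \<open>The Borwein--Preiss variational principle with increasing times\<close>

text \<open>The next perturbation centre nearly maximizes the perturbed functional \<open>Q\<close> on the current set
  \<open>Y\<close>; the next set consists of the later points whose value, penalized for the distance to the new
  centre, still beats the centre.\<close>

lemma borwein_preiss_sequence:
  fixes F :: "'a \<Rightarrow> real" and \<rho> :: "'a \<Rightarrow> 'a \<Rightarrow> real" and \<tau> :: "'a \<Rightarrow> real" and \<delta> \<epsilon> :: "nat \<Rightarrow> real"
  assumes x0: "x0 \<in> X" and opt: "\<And>x. x \<in> X \<Longrightarrow> F x \<le> F x0 + \<epsilon> 0"
    and \<rho>: "\<And>x y. x \<in> X \<Longrightarrow> y \<in> X \<Longrightarrow> 0 \<le> \<rho> x y" "\<And>x. x \<in> X \<Longrightarrow> \<rho> x x = 0"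
    and pos: "\<And>n. 0 < \<delta> n" "\<And>n. 0 < \<epsilon> n"
  obtains xs :: "nat \<Rightarrow> 'a" and Q :: "nat \<Rightarrow> 'a \<Rightarrow> real" and Y :: "nat \<Rightarrow> 'a set"
  where "xs 0 = x0" "Q 0 = F" "\<And>n. Q (Suc n) = (\<lambda>y. Q n y - \<delta> n * \<rho> y (xs n))"
    "\<And>n. xs n \<in> Y n" "\<And>n y. y \<in> Y n \<Longrightarrow> \<delta> n * \<rho> y (xs n) \<le> \<epsilon> n"
    "Y 0 = {y\<in>X. \<tau> (xs 0) \<le> \<tau> y \<and> Q 0 (xs 0) \<le> Q 1 y}"
    "\<And>n. Y (Suc n) = {y\<in>Y n. \<tau> (xs (Suc n)) \<le> \<tau> y \<and> Q (Suc n) (xs (Suc n)) \<le> Q (Suc (Suc n)) y}"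
proof -
  define cut where "cut Y Q x n = {y\<in>Y. \<tau> x \<le> \<tau> y \<and> Q x \<le> Q y - \<delta> n * \<rho> y x}"
    for Y and Q :: "'a \<Rightarrow> real" and x and n :: nat
  \<comment> \<open>A state consists of the current centre, the functional perturbed so far and the
    admissible set. The clause for n = 0 fixes the initial state, since the choice principle returns
    only some start satisfying the invariant.\<close>
  define Inv where "Inv n s = (case s of (x, Q, Y) \<Rightarrow>
     Y \<subseteq> X \<and> x \<in> Y \<and> (\<forall>y\<in>X. Q y \<le> F x0 + \<epsilon> 0) \<and> (\<forall>y\<in>Y. \<delta> n * \<rho> y x \<le> \<epsilon> n) \<and>
     (n = 0 \<longrightarrow> s = (x0, F, cut X F x0 0)))" for n and s :: "'a \<times> ('a \<Rightarrow> real) \<times> 'a set"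
  define Step where "Step n s s' = (case s of (x, Q, Y) \<Rightarrow> case s' of (x', Q', Y') \<Rightarrow>
     Q' = (\<lambda>y. Q y - \<delta> n * \<rho> y x) \<and> Y' = cut Y Q' x' (Suc n))"
    for n :: nat and s s' :: "'a \<times> ('a \<Rightarrow> real) \<times> 'a set"
  have "\<exists>f. \<forall>n. Inv n (f n) \<and> Step n (f n) (f (Suc n))"
  proof (rule dependent_nat_choice)
    show "\<exists>s. Inv 0 s"
    proof (intro exI)
      show "Inv 0 (x0, F, cut X F x0 0)"
        unfolding Inv_def using x0 \<rho> opt by (auto simp: cut_def) (smt (verit, best) opt)
    qed
  next
    fix s n assume I: "Inv n s"
    obtain x Q Y where s: "s = (x, Q, Y)" by (cases s) auto
    define Q' where "Q' y = Q y - \<delta> n * \<rho> y x" for y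
    have Y: "Y \<subseteq> X" "x \<in> Y" "\<And>y. y \<in> X \<Longrightarrow> Q y \<le> F x0 + \<epsilon> 0" using I by (auto simp: Inv_def s)
    have Q': "Q' y \<le> F x0 + \<epsilon> 0" if "y \<in> X" for y
    proof -
      have "0 \<le> \<delta> n * \<rho> y x" using pos(1)[of n] \<rho>(1)[of y x] that Y by (intro mult_nonneg_nonneg) auto
      thus ?thesis using Y(3)[OF that] by (simp add: Q'_def)
    qed
    have bdd: "bdd_above (Q' ` Y)" using Q' Y by (intro bdd_aboveI2) auto
    have "(SUP y\<in>Y. Q' y) - \<epsilon> (Suc n) < (SUP y\<in>Y. Q' y)" using pos by simp
    then obtain x' where x': "x' \<in> Y" "(SUP y\<in>Y. Q' y) - \<epsilon> (Suc n) < Q' x'"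
      using less_cSUP_iff[OF _ bdd] Y by blast
    \<comment> \<open>A point of the next set beats x' even after paying the penalty. Since x' is
      optimal on Y up to \<open>\<epsilon> (Suc n)\<close>, the penalty cannot exceed this
      gap.\<close>
    have "\<delta> (Suc n) * \<rho> y x' \<le> \<epsilon> (Suc n)" if "y \<in> cut Y Q' x' (Suc n)" for y
      using that cSUP_upper[OF _ bdd, of y] x' unfolding cut_def by auto
    hence "Inv (Suc n) (x', Q', cut Y Q' x' (Suc n))"
      unfolding Inv_def using Y x' \<rho>(2)[of x'] Q' by (auto simp: cut_def)
    moreover have "Step n s (x', Q', cut Y Q' x' (Suc n))"
      unfolding Step_def s using Q'_def by auto
    ultimately show "\<exists>s'. Inv (Suc n) s' \<and> Step n s s'" by blast
  qed
  then obtain f where f: "\<And>n. Inv n (f n)" "\<And>n. Step n (f n) (f (Suc n))" by blast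
  define xs where "xs n = fst (f n)" for n
  define Q where "Q n = fst (snd (f n))" for n
  define Y where "Y n = snd (snd (f n))" for n
  have fe: "f n = (xs n, Q n, Y n)" for n by (simp add: xs_def Q_def Y_def)
  have QS: "Q (Suc n) = (\<lambda>y. Q n y - \<delta> n * \<rho> y (xs n))" for n
    using f(2)[of n] by (simp add: Step_def fe)
  show thesis
  proof (rule that[of xs Q Y])
    show 0: "xs 0 = x0" "Q 0 = F" using f(1)[of 0] by (simp_all add: Inv_def fe)
    show "\<And>n. Q (Suc n) = (\<lambda>y. Q n y - \<delta> n * \<rho> y (xs n))" by (rule QS)
    show "\<And>n. xs n \<in> Y n" "\<And>n y. y \<in> Y n \<Longrightarrow> \<delta> n * \<rho> y (xs n) \<le> \<epsilon> n"
      using f(1) by (simp_all add: Inv_def fe)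
    show "Y 0 = {y\<in>X. \<tau> (xs 0) \<le> \<tau> y \<and> Q 0 (xs 0) \<le> Q 1 y}"
      using f(1)[of 0] by (simp add: Inv_def fe cut_def QS)
    show "\<And>n. Y (Suc n) = {y\<in>Y n. \<tau> (xs (Suc n)) \<le> \<tau> y \<and> Q (Suc n) (xs (Suc n)) \<le> Q (Suc (Suc n)) y}"
    proof -
      fix n
      have "Y (Suc n) = cut (Y n) (Q (Suc n)) (xs (Suc n)) (Suc n)"
        using f(2)[of n] by (simp add: Step_def fe)
      thus "Y (Suc n) = {y\<in>Y n. \<tau> (xs (Suc n)) \<le> \<tau> y \<and> Q (Suc n) (xs (Suc n)) \<le> Q (Suc (Suc n)) y}"
        by (simp add: cut_def QS[of "Suc n"])
    qed
  qed
qed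

text \<open>Maximality is stated through partial sums for all large n, so that no summability of the
  gauges enters at this level; the infinite sum is formed later, for paths. Completeness is asked
  only of sequences with nondecreasing clock and geometrically small gauges, the only ones that the
  construction produces.\<close>

lemma borwein_preiss:
  fixes F :: "'a \<Rightarrow> real" and \<rho> :: "'a \<Rightarrow> 'a \<Rightarrow> real" and \<tau> :: "'a \<Rightarrow> real"
  assumes x0: "x0 \<in> X" and \<epsilon>: "0 < \<epsilon>" and opt: "\<And>x. x \<in> X \<Longrightarrow> F x \<le> F x0 + \<epsilon>"
    and \<rho>: "\<And>x y. x \<in> X \<Longrightarrow> y \<in> X \<Longrightarrow> 0 \<le> \<rho> x y" "\<And>x. x \<in> X \<Longrightarrow> \<rho> x x = 0"
    and complete: "\<And>xs. \<lbrakk>\<And>n. xs n \<in> X; \<And>n m. n \<le> m \<Longrightarrow> \<tau> (xs n) \<le> \<tau> (xs m);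
       \<And>n m. n \<le> m \<Longrightarrow> \<rho> (xs m) (xs n) \<le> \<epsilon> / 2 ^ n\<rbrakk> \<Longrightarrow>
       \<exists>x\<in>X. (\<forall>y\<in>X. (\<lambda>n. \<rho> (xs n) y) \<longlonglongrightarrow> \<rho> x y) \<and> (\<lambda>n. F (xs n)) \<longlonglongrightarrow> F x \<and> (\<lambda>n. \<tau> (xs n)) \<longlonglongrightarrow> \<tau> x"
    and separated: "\<And>xs x y. \<lbrakk>\<And>n. xs n \<in> X; x \<in> X; y \<in> X; (\<lambda>n. \<rho> x (xs n)) \<longlonglongrightarrow> 0; (\<lambda>n. \<rho> y (xs n)) \<longlonglongrightarrow> 0\<rbrakk>
       \<Longrightarrow> x = y"
  obtains x xs where "x \<in> X" "\<And>n. xs n \<in> X" "\<And>n. \<tau> (xs n) \<le> \<tau> x" "\<And>n. \<rho> x (xs n) \<le> \<epsilon>" "xs 0 = x0"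
    "\<And>y. y \<in> X \<Longrightarrow> \<tau> x \<le> \<tau> y \<Longrightarrow> \<forall>\<^sub>F n in sequentially.
       F y - (\<Sum>i<n. (1 / 2) ^ i * \<rho> y (xs i)) \<le> F x - (\<Sum>i<n. (1 / 2) ^ i * \<rho> x (xs i))"
proof -
  \<comment> \<open>The tolerance carries the weight (1/2)^n as a factor; cancelling it against the
    weight of the penalty leaves the gauge bound \<epsilon> / 2^n.\<close>
  obtain xs :: "nat \<Rightarrow> 'a" and Q :: "nat \<Rightarrow> 'a \<Rightarrow> real" and Y :: "nat \<Rightarrow> 'a set" where
    0: "xs 0 = x0" "Q 0 = F" and QS: "\<And>n. Q (Suc n) = (\<lambda>y. Q n y - (1 / 2) ^ n * \<rho> y (xs n))"
    and xsY: "\<And>n. xs n \<in> Y n"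
    and small: "\<And>n y. y \<in> Y n \<Longrightarrow> (1 / 2) ^ n * \<rho> y (xs n) \<le> (1 / 2) ^ n * (\<epsilon> / 2 ^ n)"
    and Y0: "Y 0 = {y\<in>X. \<tau> (xs 0) \<le> \<tau> y \<and> Q 0 (xs 0) \<le> Q 1 y}"
    and YS: "\<And>n. Y (Suc n) = {y\<in>Y n. \<tau> (xs (Suc n)) \<le> \<tau> y \<and> Q (Suc n) (xs (Suc n)) \<le> Q (Suc (Suc n)) y}"
    by (rule borwein_preiss_sequence[of x0 X F "\<lambda>n. (1 / 2) ^ n * (\<epsilon> / 2 ^ n)" \<rho> "\<lambda>n. (1 / 2) ^ n" \<tau>])
       (use x0 \<epsilon> opt \<rho> in auto)
  have Qsum: "Q n y = F y - (\<Sum>i<n. (1 / 2) ^ i * \<rho> y (xs i))" for n y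
    by (induction n) (simp_all add: 0 QS)
  have Y: "Y n = {y\<in>X. \<forall>k\<le>n. \<tau> (xs k) \<le> \<tau> y \<and> Q k (xs k) \<le> Q (Suc k) y}" for n
    by (induction n) (auto simp: Y0 YS le_Suc_eq)
  have xsX: "xs n \<in> X" for n using xsY Y by auto
  have small: "\<rho> y (xs n) \<le> \<epsilon> / 2 ^ n" if "y \<in> Y n" for y n
    using mult_left_le_imp_le[OF small[OF that]] by simp
  have xsmn: "\<tau> (xs n) \<le> \<tau> (xs m)" "Q n (xs n) \<le> Q (Suc n) (xs m)" "xs m \<in> Y n" if "n \<le> m" for n m
    using xsY[of m] that unfolding Y by auto
  obtain x where x: "x \<in> X" "\<And>y. y \<in> X \<Longrightarrow> (\<lambda>n. \<rho> (xs n) y) \<longlonglongrightarrow> \<rho> x y"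
    "(\<lambda>n. F (xs n)) \<longlonglongrightarrow> F x" "(\<lambda>n. \<tau> (xs n)) \<longlonglongrightarrow> \<tau> x"
    using complete[of xs] xsX xsmn small by blast
  \<comment> \<open>Each condition defining the sets contains only finitely many gauge terms, so it
    passes to the limit and x belongs to every set.\<close>
  have xn: "\<tau> (xs n) \<le> \<tau> x" "Q n (xs n) \<le> Q (Suc n) x" for n
  proof -
    show "\<tau> (xs n) \<le> \<tau> x" by (rule LIMSEQ_le_const[OF x(4)]) (use xsmn in blast)
    have "(\<lambda>m. Q (Suc n) (xs m)) \<longlonglongrightarrow> Q (Suc n) x"
      unfolding Qsum by (intro tendsto_intros x xsX)
    thus "Q n (xs n) \<le> Q (Suc n) x" by (rule LIMSEQ_le_const) (use xsmn in blast)
  qed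
  hence xY: "x \<in> Y n" for n using x(1) by (auto simp: Y)
  have lim0: "(\<lambda>n. \<epsilon> / 2 ^ n) \<longlonglongrightarrow> 0"
    using LIMSEQ_divide_realpow_zero[of 2 \<epsilon>] by simp
  have to0: "(\<lambda>n. \<rho> y (xs n)) \<longlonglongrightarrow> 0" if "\<And>n. y \<in> Y n" for y
    by (rule tendsto_sandwich[OF _ _ tendsto_const lim0])
       (use that small \<rho>(1) xsX in \<open>auto simp: Y intro!: always_eventually\<close>)
  show thesis
  proof (rule that[of x xs])
    show "x \<in> X" "\<And>n. xs n \<in> X" "\<And>n. \<tau> (xs n) \<le> \<tau> x" "xs 0 = x0" by (fact x xsX xn 0)+
    show "\<rho> x (xs n) \<le> \<epsilon>" for n
    proof -
      have "\<epsilon> / 2 ^ n \<le> \<epsilon> / 1" using \<epsilon> by (intro divide_left_mono) auto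
      thus ?thesis using small[OF xY, of n] by simp
    qed
    fix y assume y: "y \<in> X" "\<tau> x \<le> \<tau> y"
    show "\<forall>\<^sub>F n in sequentially. F y - (\<Sum>i<n. (1 / 2) ^ i * \<rho> y (xs i)) \<le> F x - (\<Sum>i<n. (1 / 2) ^ i * \<rho> x (xs i))"
    \<comment> \<open>A point lying in every set has gauges to the centres tending to 0, hence
      equals x. Any other later point was rejected at some step k, and the rejection persists:
      \<open>Q n y\<close> decreases in n, while \<open>Q n (xs n)\<close> increases.\<close>
    proof (cases "\<forall>n. y \<in> Y n")
      case True
      hence "y = x" by (intro separated[of xs] xsX x y to0 xY) auto
      thus ?thesis by simp
    next
      case False
      then obtain k where "\<not> (\<tau> (xs k) \<le> \<tau> y \<and> Q k (xs k) \<le> Q (Suc k) y)" using y by (auto simp: Y)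
      moreover have "\<tau> (xs k) \<le> \<tau> y" using xn(1)[of k] y by simp
      ultimately have k: "Q (Suc k) y < Q k (xs k)" by simp
      have dec: "Q m y \<le> Q n y" if "n \<le> m" for n m
        using that
      proof (induction rule: dec_induct)
        case (step m)
        have "0 \<le> (1 / 2) ^ m * \<rho> y (xs m)" using \<rho>(1)[OF y(1) xsX] by simp
        thus ?case using step by (simp add: QS)
      qed simp
      have inc: "Q n (xs n) \<le> Q m (xs m)" if "n \<le> m" for n m
        using that
      proof (induction rule: dec_induct)
        case (step m)
        thus ?case using xsmn(2)[of m "Suc m"] by simp
      qed simp
      have "Q n y \<le> Q n x" if "n \<ge> Suc k" for n
      proof -
        define m where "m = n - 1"
        have m: "n = Suc m" "k \<le> m" using that by (auto simp: m_def)
        show ?thesis using dec[OF that] k inc[OF m(2)] xn(2)[of m] unfolding m(1) by linarith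
      qed
      thus ?thesis unfolding Qsum eventually_sequentially by blast
    qed
  qed
qed

context path_space
begin

lemma conv_unique:
  assumes "conv xs x" "conv xs y"
  shows "x = y"
proof -
  note cx = convD[OF assms(1)] and cy = convD[OF assms(2)]
  have f: "fst x = fst y" using LIMSEQ_unique[OF cx(4) cy(4)] .
  have "(\<lambda>n. D (xs n) y) \<longlonglongrightarrow> D x y" by (rule conv_D[OF assms(1) cy(2)])
  hence "D x y = 0" using LIMSEQ_unique cy(3) by (simp add: D_sym)
  hence "E x \<sigma> = E y \<sigma>" if "\<sigma> \<in> {0..T}" for \<sigma>
    using norm_E_le_D[OF cx(2) cy(2) that] by simp
  moreover have "fst y \<le> T" using cy(2) by (simp add: Lam_iff)
  ultimately have "snd x \<sigma> = snd y \<sigma>" if "\<sigma> \<in> {0..fst y}" for \<sigma>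
    using that f by (force simp: E_eq)
  hence "snd x = snd y"
    using cx(2) cy(2) f by (intro extensionalityI[where A = "{0..fst y}"]) (auto simp: Lam_iff)
  thus ?thesis using f by (simp add: prod_eq_iff)
qed

text \<open>The clock is the final time. Monotone bounded final times converge, the gauge dominates
  the sixth power of \<open>D\<close> and so makes the sequence Cauchy, and
  \<open>path_complete\<close> supplies a limit ending at the limit time.\<close>

lemma path_variational_principle:
  assumes x0: "x0 \<in> Lam T t" and t: "0 \<le> t" and \<epsilon>: "0 < \<epsilon>"
    and opt: "\<And>x. x \<in> Lam T t \<Longrightarrow> F x \<le> F x0 + \<epsilon>"
    and F: "path_continuous T S (Lam T t) F"
  obtains x xs where "x \<in> Lam T t" "\<And>n. xs n \<in> Lam T t" "\<And>n. fst (xs n) \<le> fst x" "\<And>n. Ups_bar S x (xs n) \<le> \<epsilon>" "xs 0 = x0"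
    "\<And>y. y \<in> Lam T t \<Longrightarrow> fst x \<le> fst y \<Longrightarrow> \<forall>\<^sub>F n in sequentially.
       F y - (\<Sum>i<n. (1 / 2) ^ i * Ups_bar S y (xs i)) \<le> F x - (\<Sum>i<n. (1 / 2) ^ i * Ups_bar S x (xs i))"
proof (rule borwein_preiss[of x0 "Lam T t" \<epsilon> F "Ups_bar S" fst])
  note sub = Lam_mono[OF t]
  show "0 \<le> Ups_bar S x y" if "x \<in> Lam T t" "y \<in> Lam T t" for x y
    using that by (intro Ups_bar_nonneg sub)
  show "Ups_bar S x x = 0" if "x \<in> Lam T t" for x
    using that by (intro Ups_bar_self sub)
  show "x = y" if "\<And>n. xs n \<in> Lam T t" "x \<in> Lam T t" "y \<in> Lam T t" "(\<lambda>n. Ups_bar S x (xs n)) \<longlonglongrightarrow> 0"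
    "(\<lambda>n. Ups_bar S y (xs n)) \<longlonglongrightarrow> 0" for xs x y
    by (rule conv_unique[of xs]; rule conv_if_Ups_bar[OF sub sub]) (fact that)+
  fix xs
  assume xs: "\<And>n. xs n \<in> Lam T t" "\<And>n m. n \<le> m \<Longrightarrow> fst (xs n) \<le> fst (xs m)"
    "\<And>n m. n \<le> m \<Longrightarrow> Ups_bar S (xs m) (xs n) \<le> \<epsilon> / 2 ^ n"
  have xs0: "xs n \<in> Lam T 0" for n using xs(1) sub by blast
  have "incseq (\<lambda>n. fst (xs n))" using xs(2) by (simp add: incseq_def)
  moreover have "fst (xs n) \<le> T" for n using xs(1) by (simp add: Lam_iff)
  ultimately obtain r where r: "(\<lambda>n. fst (xs n)) \<longlonglongrightarrow> r" using incseq_convergent by blast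
  have "\<exists>N. \<forall>n\<ge>N. \<forall>m\<ge>N. D (xs n) (xs m) < e" if e: "0 < e" for e
  proof -
    have "(\<lambda>n. \<epsilon> / 2 ^ n) \<longlonglongrightarrow> 0" using LIMSEQ_divide_realpow_zero[of 2 \<epsilon>] by simp
    hence "\<forall>\<^sub>F n in sequentially. \<epsilon> / 2 ^ n < (e / 2) ^ 6"
      by (rule order_tendstoD) (use e in simp)
    then obtain N where N: "\<epsilon> / 2 ^ N < (e / 2) ^ 6" by (auto simp: eventually_sequentially)
    have "D (xs n) (xs N) < e / 2" if "n \<ge> N" for n
    proof -
      have "D (xs n) (xs N) ^ 6 \<le> Ups_bar S (xs n) (xs N)"
        using Ups_bar_bounds(1)[OF xs0 xs0, of n N] zero_le_power2[of "fst (xs n) - fst (xs N)"] by linarith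
      hence "D (xs n) (xs N) ^ 6 < (e / 2) ^ 6" using xs(3)[OF that] N by linarith
      thus ?thesis by (rule power_less_imp_less_base) (use e in simp)
    qed
    note close = this
    have "D (xs n) (xs m) < e" if "n \<ge> N" "m \<ge> N" for n m
      using D_triangle[OF xs0 xs0 xs0, of n m N] D_sym[of "xs N" "xs m"]
        close[OF that(1)] close[OF that(2)] by linarith
    thus ?thesis by blast
  qed
  from path_complete[OF xs0 r this] obtain x where x: "conv xs x" "fst x = r" by blast
  have "t \<le> r" using xs(1) by (intro LIMSEQ_le_const[OF r]) (auto simp: Lam_iff)
  hence xt: "x \<in> Lam T t" using convD(2)[OF x(1)] x(2) by (simp add: Lam_iff)
  show "\<exists>x\<in>Lam T t. (\<forall>y\<in>Lam T t. (\<lambda>n. Ups_bar S (xs n) y) \<longlonglongrightarrow> Ups_bar S x y)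
      \<and> (\<lambda>n. F (xs n)) \<longlonglongrightarrow> F x \<and> (\<lambda>n. fst (xs n)) \<longlonglongrightarrow> fst x"
    using conv_Ups_bar[OF x(1)] sub path_continuous_conv[OF F x(1) xs(1) xt] r x(2) xt by blast
qed (use x0 \<epsilon> opt that in blast)+

end

section \<open>Derivatives of the test functionals\<close>

lemma endpt_vshift: "endpt (vshift h \<gamma>) = endpt \<gamma> + h"
  by (simp add: vshift_def endpt_def)

lemma vshift_vshift: "vshift k (vshift h \<gamma>) = vshift (h + k) \<gamma>"
  by (simp add: vshift_def endpt_def add.assoc)

lemma vshift_zero: "vshift 0 \<gamma> = \<gamma>"
  by (simp add: vshift_def endpt_def)

lemma fst_vshift [simp]: "fst (vshift h \<gamma>) = fst \<gamma>"
  by (simp add: vshift_def)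

lemma has_pd_x_unique:
  assumes "has_pd_x f p \<gamma>" "has_pd_x f p' \<gamma>"
  shows "p = p'"
proof -
  have "(\<lambda>h. h \<bullet> p) = (\<lambda>h. h \<bullet> p')"
    using assms unfolding has_pd_x_def gderiv_def by (rule has_derivative_unique)
  hence "(p - p') \<bullet> (p - p') = 0" by (metis inner_diff_right right_minus_eq)
  thus ?thesis by simp
qed

lemma pd_x_eqI: "has_pd_x f p \<gamma> \<Longrightarrow> pd_x f \<gamma> = p"
  unfolding pd_x_def using has_pd_x_unique by blast

lemma has_pd_xx_unique: "has_pd_xx f l \<gamma> \<Longrightarrow> has_pd_xx f l' \<gamma> \<Longrightarrow> l = l'"
  unfolding has_pd_xx_def using has_derivative_unique blinfun_apply_inject by blast

lemma pd_xx_eqI: "has_pd_xx f l \<gamma> \<Longrightarrow> pd_xx f \<gamma> = l"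
  unfolding pd_xx_def using has_pd_xx_unique by blast

definition outer :: "'h::real_inner \<Rightarrow> 'h \<Rightarrow>\<^sub>L 'h" where
  "outer y = blinfun_scaleR_left y o\<^sub>L blinfun_inner_right y"

lemma outer_apply [simp]: "blinfun_apply (outer y) v = (y \<bullet> v) *\<^sub>R y"
  by (simp add: outer_def)

lemma norm_outer: "norm (outer y) \<le> (norm y)\<^sup>2"
proof (rule norm_blinfun_bound)
  fix v
  have "\<bar>y \<bullet> v\<bar> * norm y \<le> (norm y * norm v) * norm y"
    by (intro mult_right_mono Cauchy_Schwarz_ineq2 norm_ge_zero)
  thus "norm (blinfun_apply (outer y) v) \<le> (norm y)\<^sup>2 * norm v"
    by (simp add: power2_eq_square mult_ac)
qed simp

lemma tendsto_outer:
  fixes y :: "'a \<Rightarrow> 'h::real_inner"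
  assumes "(y \<longlongrightarrow> z) Q"
  shows "((\<lambda>n. outer (y n)) \<longlongrightarrow> outer z) Q"
  unfolding outer_def
  by (intro bounded_bilinear.tendsto[OF bounded_bilinear_blinfun_compose] assms
      bounded_linear.tendsto[OF bounded_linear_blinfun_scaleR_left]
      bounded_linear.tendsto[OF bounded_linear_blinfun_inner_right])

text \<open>The Hessian of \<open>y \<mapsto> K(|y|\<^sup>2)\<close> for \<open>a = K'(|y|\<^sup>2)\<close> and \<open>b = K''(|y|\<^sup>2)\<close>.\<close>

definition radial_hess :: "real \<Rightarrow> real \<Rightarrow> 'h::real_inner \<Rightarrow> 'h \<Rightarrow>\<^sub>L 'h" where
  "radial_hess a b y = (2 * a) *\<^sub>R id_blinfun + (4 * b) *\<^sub>R outer y"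

lemma GDERIV_radial:
  fixes z :: "'h::real_inner"
  assumes "DERIV K ((norm z)\<^sup>2) :> a"
  shows "GDERIV (\<lambda>k. K ((norm (z + k))\<^sup>2)) 0 :> (2 * a) *\<^sub>R z"
proof -
  have "((\<lambda>k. (z + k) \<bullet> (z + k)) has_derivative (\<lambda>h. h \<bullet> (2 *\<^sub>R z))) (at 0)"
    by (auto intro!: derivative_eq_intros simp: inner_commute)
  hence "GDERIV (\<lambda>k. (norm (z + k))\<^sup>2) 0 :> 2 *\<^sub>R z"
    unfolding gderiv_def power2_norm_eq_inner .
  moreover have "DERIV K ((norm (z + 0))\<^sup>2) :> a" using assms by simp
  ultimately have "GDERIV (\<lambda>k. K ((norm (z + k))\<^sup>2)) 0 :> a *\<^sub>R (2 *\<^sub>R z)"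
    by (rule GDERIV_DERIV_compose)
  thus ?thesis by (simp add: mult.commute)
qed

text \<open>\<open>K\<close> is differentiated at every r because the Hessian is the derivative of
  the gradient along all shifts; the derivative of \<open>K1\<close> is needed only at the unshifted
  endpoint.\<close>

lemma radial_pd:
  fixes \<gamma> :: "'h::real_inner path"
  assumes f: "\<And>h. f (vshift h \<gamma>) = K ((norm (y + h))\<^sup>2)"
    and K: "\<And>r. DERIV K r :> K1 r" and K1: "DERIV K1 ((norm y)\<^sup>2) :> b"
  shows "pd_x f \<gamma> = (2 * K1 ((norm y)\<^sup>2)) *\<^sub>R y"
    and "pd_xx f \<gamma> = radial_hess (K1 ((norm y)\<^sup>2)) b y"
proof -
  have px: "has_pd_x f ((2 * K1 ((norm (y + h))\<^sup>2)) *\<^sub>R (y + h)) (vshift h \<gamma>)" for h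
    unfolding has_pd_x_def vshift_vshift f using GDERIV_radial[OF K, of "y + h"] by (simp add: add.assoc)
  note pd = pd_x_eqI[OF px]
  show "pd_x f \<gamma> = (2 * K1 ((norm y)\<^sup>2)) *\<^sub>R y" using pd[of 0] by (simp add: vshift_zero)
  have "((\<lambda>h. (norm (y + h))\<^sup>2) has_derivative (\<lambda>v. 2 * (y \<bullet> v))) (at 0)"
    unfolding power2_norm_eq_inner by (auto intro!: derivative_eq_intros simp: inner_commute)
  moreover have "(K1 has_derivative (\<lambda>x. x * b)) (at ((norm (y + 0))\<^sup>2))"
    using K1 by (simp add: has_field_derivative_def mult_commute_abs)
  ultimately have "((\<lambda>h. K1 ((norm (y + h))\<^sup>2)) has_derivative (\<lambda>v. (2 * (y \<bullet> v)) * b)) (at 0)"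
    using has_derivative_compose by blast
  hence "((\<lambda>h. (2 * K1 ((norm (y + h))\<^sup>2)) *\<^sub>R (y + h)) has_derivative
      blinfun_apply (radial_hess (K1 ((norm y)\<^sup>2)) b y)) (at 0)"
    by (auto intro!: derivative_eq_intros ext
        simp: radial_hess_def blinfun.bilinear_simps mult_ac)
  hence "has_pd_xx f (radial_hess (K1 ((norm y)\<^sup>2)) b y) \<gamma>"
    unfolding has_pd_xx_def pd using px by (blast intro: always_eventually)
  thus "pd_xx f \<gamma> = radial_hess (K1 ((norm y)\<^sup>2)) b y" by (rule pd_xx_eqI)
qed

lemma self_adjoint_radial_hess: "self_adjoint (radial_hess a b y)"
  unfolding self_adjoint_def radial_hess_def
  by (simp add: blinfun.bilinear_simps inner_add_left inner_add_right inner_commute)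

lemma norm_radial_hess: "norm (radial_hess a b y) \<le> 2 * \<bar>a\<bar> + 4 * \<bar>b\<bar> * (norm y)\<^sup>2"
proof -
  have "norm (radial_hess a b y) \<le> norm ((2 * a) *\<^sub>R (id_blinfun :: 'a \<Rightarrow>\<^sub>L 'a)) + norm ((4 * b) *\<^sub>R outer y)"
    unfolding radial_hess_def by (rule norm_triangle_ineq)
  also have "norm ((2 * a) *\<^sub>R (id_blinfun :: 'a \<Rightarrow>\<^sub>L 'a)) \<le> 2 * \<bar>a\<bar> * 1"
    unfolding norm_scaleR by (intro mult_mono norm_blinfun_id_le) (auto simp: abs_mult)
  also have "norm ((4 * b) *\<^sub>R outer y) \<le> 4 * \<bar>b\<bar> * (norm y)\<^sup>2"
    unfolding norm_scaleR by (intro mult_mono norm_outer) (auto simp: abs_mult)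
  finally show ?thesis by simp
qed

lemma tendsto_radial_hess:
  fixes y :: "'a \<Rightarrow> 'h::real_inner"
  assumes "(a \<longlongrightarrow> a') Q" "(b \<longlongrightarrow> b') Q" "(y \<longlongrightarrow> y') Q"
  shows "((\<lambda>n. radial_hess (a n) (b n) (y n)) \<longlongrightarrow> radial_hess a' b' y') Q"
  unfolding radial_hess_def by (intro tendsto_intros assms tendsto_outer)

text \<open>\<open>kp1 m\<close> and \<open>kp2 m\<close> are the first and second derivatives of
  \<open>kp m\<close> in r, including m = 0, where the quotients drop out.\<close>

definition kp1 :: "real \<Rightarrow> real \<Rightarrow> real" where
  "kp1 m r = 9 * r\<^sup>2 - 9 * max (m ^ 6 - r ^ 3) 0 ^ 2 * r\<^sup>2 / m ^ 12"

definition kp2 :: "real \<Rightarrow> real \<Rightarrow> real" where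
  "kp2 m r = 18 * r + (54 * max (m ^ 6 - r ^ 3) 0 * r ^ 4 - 18 * max (m ^ 6 - r ^ 3) 0 ^ 2 * r) / m ^ 12"

text \<open>With exponent at least 2 the kink of the truncation disappears: at 0 the difference
  quotient is at most |h|^(n + 1). The truncated cube in \<open>kp\<close> can therefore be
  differentiated twice.\<close>

lemma DERIV_max_power:
  fixes x :: real
  shows "DERIV (\<lambda>x. max x 0 ^ Suc (Suc n)) x :> real (Suc (Suc n)) * max x 0 ^ Suc n"
proof -
  consider "x > 0" | "x < 0" | "x = 0" by linarith
  thus ?thesis
  proof cases
    case 1
    have "DERIV (\<lambda>x. x ^ Suc (Suc n)) x :> real (Suc (Suc n)) * x ^ Suc n"
      by (rule DERIV_cong[OF DERIV_pow]) simp
    moreover have "\<forall>\<^sub>F y in nhds x. y ^ Suc (Suc n) = max y 0 ^ Suc (Suc n)"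
      using eventually_nhds_in_open[of "{0<..}" x] 1 by (auto elim!: eventually_mono)
    ultimately show ?thesis using 1 by (simp add: DERIV_cong_ev max_def del: power_Suc)
  next
    case 2
    have "\<forall>\<^sub>F y in nhds x. max y 0 ^ Suc (Suc n) = 0"
      using eventually_nhds_in_open[of "{..<0}" x] 2 by (auto elim!: eventually_mono)
    from DERIV_cong_ev[OF refl this refl] have "DERIV (\<lambda>y. max y 0 ^ Suc (Suc n)) x :> 0" by simp
    thus ?thesis using 2 by simp
  next
    case 3
    have "((\<lambda>h::real. max h 0 ^ Suc (Suc n) / h) \<longlongrightarrow> 0) (at 0)"
    proof (rule Lim_null_comparison)
      have "norm (max h 0 ^ Suc (Suc n) / h) \<le> norm (h ^ Suc n)" for h :: real
        by (cases "h > 0") (auto simp: max_def)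
      thus "\<forall>\<^sub>F h::real in at 0. norm (max h 0 ^ Suc (Suc n) / h) \<le> norm (h ^ Suc n)" by simp
      show "((\<lambda>h::real. norm (h ^ Suc n)) \<longlongrightarrow> 0) (at 0)"
        by (auto intro!: tendsto_eq_intros)
    qed
    thus ?thesis using 3 by (simp add: DERIV_def)
  qed
qed

lemma DERIV_max_cube: "DERIV (\<lambda>r. max (c - r ^ 3) 0 ^ 3) r :> - 9 * max (c - r ^ 3) 0 ^ 2 * (r::real)\<^sup>2"
proof -
  have 1: "DERIV (\<lambda>r. c - r ^ 3) r :> - 3 * r\<^sup>2" by (auto intro!: derivative_eq_intros)
  from DERIV_chain2[OF DERIV_max_power[of 1 "c - r ^ 3"] 1] show ?thesis
    by (simp add: numeral_3_eq_3 numeral_2_eq_2 mult_ac)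
qed

lemma DERIV_max_square: "DERIV (\<lambda>r. max (c - r ^ 3) 0 ^ 2) r :> - 6 * max (c - r ^ 3) 0 * (r::real)\<^sup>2"
proof -
  have 1: "DERIV (\<lambda>r. c - r ^ 3) r :> - 3 * r\<^sup>2" by (auto intro!: derivative_eq_intros)
  from DERIV_chain2[OF DERIV_max_power[of 0 "c - r ^ 3"] 1] show ?thesis
    by (simp add: numeral_2_eq_2 mult_ac)
qed

lemma DERIV_kp: "DERIV (kp m) r :> kp1 m r"
proof -
  have "DERIV (\<lambda>r. max (m ^ 6 - r ^ 3) 0 ^ 3 / m ^ 12 + 3 * r ^ 3) r :>
      - 9 * max (m ^ 6 - r ^ 3) 0 ^ 2 * r\<^sup>2 / m ^ 12 + 3 * (3 * r\<^sup>2)"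
    by (intro DERIV_add DERIV_cdivide DERIV_max_cube DERIV_cmult) (auto intro!: derivative_eq_intros)
  moreover have "kp m = (\<lambda>r. max (m ^ 6 - r ^ 3) 0 ^ 3 / m ^ 12 + 3 * r ^ 3)" by (auto simp: kp_def)
  ultimately show ?thesis by (simp add: kp1_def)
qed

lemma DERIV_kp1: "DERIV (kp1 m) r :> kp2 m r"
proof -
  have "DERIV (\<lambda>r. 9 * r\<^sup>2 - 9 * (max (m ^ 6 - r ^ 3) 0 ^ 2 * r\<^sup>2) / m ^ 12) r :>
      9 * (2 * r) - 9 * ((- 6 * max (m ^ 6 - r ^ 3) 0 * r\<^sup>2) * r\<^sup>2 + (2 * r) * max (m ^ 6 - r ^ 3) 0 ^ 2) / m ^ 12"
    by (intro DERIV_diff DERIV_cdivide DERIV_mult DERIV_max_square DERIV_cmult) (auto intro!: derivative_eq_intros)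
  moreover have "kp1 m = (\<lambda>r. 9 * r\<^sup>2 - 9 * (max (m ^ 6 - r ^ 3) 0 ^ 2 * r\<^sup>2) / m ^ 12)"
    by (auto simp: kp1_def mult.assoc)
  moreover have "9 * (2 * r) - 9 * ((- 6 * P * r\<^sup>2) * r\<^sup>2 + (2 * r) * P ^ 2) / C
      = 18 * r + (54 * P * r ^ 4 - 18 * P ^ 2 * r) / C" for P C :: real
  proof -
    have "r ^ 4 = r\<^sup>2 * r\<^sup>2" by (simp flip: power_add)
    hence eq: "54 * P * r ^ 4 - 18 * P ^ 2 * r = - (9 * ((- 6 * P * r\<^sup>2) * r\<^sup>2 + (2 * r) * P ^ 2))"
      by (simp add: algebra_simps)
    moreover have "9 * (2 * r) - Z / C = 18 * r + (- Z) / C" for Z by simp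
    ultimately show ?thesis by metis
  qed
  ultimately show ?thesis unfolding kp2_def by metis
qed

text \<open>With M = m^6 and P = M - r^3, the ratios P^2 / M^2 and P r^3 / M^2 lie in [0, 1], so the
  derivatives are multiples of r^2 and r with bounded coefficients; 72 = 18 + 54 adds the positive
  ones. The bounds do not involve m.\<close>

lemma kp12_bounds:
  assumes r: "0 \<le> r" "r \<le> m\<^sup>2"
  shows "\<bar>kp1 m r\<bar> \<le> 9 * r\<^sup>2" "\<bar>kp2 m r\<bar> \<le> 72 * r"
proof -
  define M where "M = m ^ 6"
  define P where "P = max (M - r ^ 3) 0"
  have le: "r ^ 3 \<le> M" unfolding M_def by (rule cube_le_pow6) fact+
  have P: "0 \<le> P" "P \<le> M" using r le by (auto simp: P_def)
  have m12: "m ^ 12 = M\<^sup>2" by (simp add: M_def flip: power_mult)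
  have q: "0 \<le> P\<^sup>2 / M\<^sup>2" "P\<^sup>2 / M\<^sup>2 \<le> 1"
  proof -
    show "0 \<le> P\<^sup>2 / M\<^sup>2" by simp
    have "P\<^sup>2 \<le> M\<^sup>2" using P by (intro power_mono)
    thus "P\<^sup>2 / M\<^sup>2 \<le> 1" by (cases "M = 0") auto
  qed
  have k1: "kp1 m r = 9 * r\<^sup>2 * (1 - P\<^sup>2 / M\<^sup>2)"
    by (simp add: kp1_def P_def M_def[symmetric] m12 algebra_simps)
  show "\<bar>kp1 m r\<bar> \<le> 9 * r\<^sup>2"
    unfolding k1 using q by (simp add: abs_mult mult_left_le)
  have s: "0 \<le> P * r ^ 3 / M\<^sup>2" "P * r ^ 3 / M\<^sup>2 \<le> 1"
  proof -
    show "0 \<le> P * r ^ 3 / M\<^sup>2" using P r by simp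
    have "P * r ^ 3 \<le> M * M" using P r le by (intro mult_mono) auto
    moreover have "0 \<le> M" using P by linarith
    ultimately show "P * r ^ 3 / M\<^sup>2 \<le> 1" by (cases "M = 0") (simp_all add: power2_eq_square divide_le_eq_1)
  qed
  have r4: "r ^ 4 = r * r ^ 3" using power_Suc[of r 3] by simp
  have "kp2 m r = 18 * r + 54 * (r * (P * r ^ 3 / M\<^sup>2)) - 18 * (r * (P\<^sup>2 / M\<^sup>2))"
    by (simp add: kp2_def P_def M_def[symmetric] m12 r4 diff_divide_distrib mult_ac)
  moreover have "r * (P * r ^ 3 / M\<^sup>2) \<le> r * 1" "r * (P\<^sup>2 / M\<^sup>2) \<le> r * 1"
    using s q r by (intro mult_left_mono; simp)+
  moreover have "0 \<le> r * (P * r ^ 3 / M\<^sup>2)" "0 \<le> r * (P\<^sup>2 / M\<^sup>2)" using s q r by (intro mult_nonneg_nonneg; simp)+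
  ultimately show "\<bar>kp2 m r\<bar> \<le> 72 * r" using r by linarith
qed

text \<open>As for \<open>kp\<close>, only m = 0 is critical; there r tends to 0 and the bounds in r
  alone force both derivatives to 0.\<close>

lemma tendsto_kp12:
  assumes m: "(m \<longlongrightarrow> M) Q" and r: "(r \<longlongrightarrow> R) Q" and Q: "Q \<noteq> bot"
    and b: "\<And>n. 0 \<le> r n" "\<And>n. r n \<le> (m n)\<^sup>2"
  shows "((\<lambda>n. kp1 (m n) (r n)) \<longlongrightarrow> kp1 M R) Q" "((\<lambda>n. kp2 (m n) (r n)) \<longlongrightarrow> kp2 M R) Q"
proof -
  have "((\<lambda>n. kp1 (m n) (r n)) \<longlongrightarrow> kp1 M R) Q \<and> ((\<lambda>n. kp2 (m n) (r n)) \<longlongrightarrow> kp2 M R) Q"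
  proof (cases "M = 0")
    case False
    thus ?thesis unfolding kp1_def kp2_def by (intro conjI tendsto_intros m r) auto
  next
    case True
    have "((\<lambda>n. (m n)\<^sup>2) \<longlongrightarrow> 0) Q" using tendsto_power[OF m, of 2] True by simp
    from tendsto_le[OF Q this r] have "R \<le> 0" using b(2) by simp
    moreover have "0 \<le> R" using tendsto_lowerbound[OF r _ Q] b(1) by simp
    ultimately have R: "R = 0" by simp
    have "((\<lambda>n. kp1 (m n) (r n)) \<longlongrightarrow> 0) Q"
    proof (rule Lim_null_comparison)
      show "\<forall>\<^sub>F n in Q. norm (kp1 (m n) (r n)) \<le> 9 * (r n)\<^sup>2" using kp12_bounds(1)[OF b] by simp
      show "((\<lambda>n. 9 * (r n)\<^sup>2) \<longlongrightarrow> 0) Q" using tendsto_mult[OF tendsto_const[of 9] tendsto_power[OF r, of 2]] R by simp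
    qed
    moreover have "((\<lambda>n. kp2 (m n) (r n)) \<longlongrightarrow> 0) Q"
    proof (rule Lim_null_comparison)
      show "\<forall>\<^sub>F n in Q. norm (kp2 (m n) (r n)) \<le> 72 * r n" using kp12_bounds(2)[OF b] by simp
      show "((\<lambda>n. 72 * r n) \<longlongrightarrow> 0) Q" using tendsto_mult[OF tendsto_const[of 72] r] R by simp
    qed
    ultimately show ?thesis using True R by (simp add: kp1_def kp2_def)
  qed
  thus "((\<lambda>n. kp1 (m n) (r n)) \<longlongrightarrow> kp1 M R) Q" "((\<lambda>n. kp2 (m n) (r n)) \<longlongrightarrow> kp2 M R) Q" by auto
qed

text \<open>Shifting the endpoint does not change the supremum over the half-open interval, which for
  \<open>t > 0\<close> is the full norm by continuity but for \<open>t = 0\<close> is a supremum over the empty set.\<close>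

definition open_norm :: "'h::real_normed_vector path \<Rightarrow> real" where
  "open_norm \<gamma> = (if fst \<gamma> = 0 then 0 else pnorm \<gamma>)"

lemma pnorm_vshift:
  assumes t: "0 \<le> fst \<gamma>" and c: "continuous_on {0..fst \<gamma>} (snd \<gamma>)"
  shows "pnorm (vshift h \<gamma>) = max (open_norm \<gamma>) (norm (endpt \<gamma> + h))"
proof (cases "fst \<gamma> = 0")
  case True
  thus ?thesis by (simp add: pnorm_def open_norm_def vshift_def)
next
  case False
  let ?g = "snd (vshift h \<gamma>)"
  have g: "?g \<sigma> = (if \<sigma> = fst \<gamma> then endpt \<gamma> + h else snd \<gamma> \<sigma>)" for \<sigma> by (simp add: vshift_def)
  have ub: "norm (?g \<sigma>) \<le> max (pnorm \<gamma>) (norm (endpt \<gamma> + h))" if "\<sigma> \<in> {0..fst \<gamma>}" for \<sigma>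
    using norm_le_pnorm[OF c that] by (auto simp: g le_max_iff_disj)
  hence bdd: "bdd_above ((\<lambda>\<sigma>. norm (?g \<sigma>)) ` {0..fst \<gamma>})" by (intro bdd_aboveI2)
  have le: "norm (?g \<sigma>) \<le> pnorm (vshift h \<gamma>)" if "\<sigma> \<in> {0..fst \<gamma>}" for \<sigma>
    unfolding pnorm_def using that bdd by (intro cSUP_upper) auto
  \<comment> \<open>The old endpoint value is a limit of earlier values, which the shift leaves
    alone, so it still bounds the norm of the shifted path from below.\<close>
  have cl: "closure {0..<fst \<gamma>} = {0..fst \<gamma>}" using t False by simp
  have "norm (snd \<gamma> \<sigma>) \<le> pnorm (vshift h \<gamma>)" if "\<sigma> \<in> {0..fst \<gamma>}" for \<sigma>
  proof (rule continuous_le_on_closure[where S = "{0..<fst \<gamma>}" and f = "\<lambda>\<sigma>. norm (snd \<gamma> \<sigma>)"])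
    show "continuous_on (closure {0..<fst \<gamma>}) (\<lambda>\<sigma>. norm (snd \<gamma> \<sigma>))"
      unfolding cl by (intro continuous_intros c)
    show "norm (snd \<gamma> \<sigma>) \<le> pnorm (vshift h \<gamma>)" if "\<sigma> \<in> {0..<fst \<gamma>}" for \<sigma>
      using le[of \<sigma>] that by (auto simp: g)
  qed (use that cl in simp)
  hence "pnorm \<gamma> \<le> pnorm (vshift h \<gamma>)"
    unfolding pnorm_def[of \<gamma>] using t by (intro cSUP_least) auto
  moreover have "norm (endpt \<gamma> + h) \<le> pnorm (vshift h \<gamma>)" using le[of "fst \<gamma>"] t by (simp add: g)
  moreover have "pnorm (vshift h \<gamma>) \<le> max (pnorm \<gamma>) (norm (endpt \<gamma> + h))"
    unfolding pnorm_def[of "vshift h \<gamma>"] using t ub by (intro cSUP_least) auto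
  ultimately show ?thesis using False by (simp add: open_norm_def)
qed

text \<open>If the shifted endpoint exceeds \<open>open_norm\<close>, the truncated term vanishes
  for either choice of the norm and both sides equal 3 |y|^6. Hence the first argument of
  \<open>kp\<close> stays fixed while the endpoint moves, as differentiation in h requires.\<close>

lemma Ups_vshift:
  assumes t: "0 \<le> fst \<gamma>" and c: "continuous_on {0..fst \<gamma>} (snd \<gamma>)"
  shows "Ups (vshift h \<gamma>) = kp (open_norm \<gamma>) ((norm (endpt \<gamma> + h))\<^sup>2)"
proof -
  let ?y = "norm (endpt \<gamma> + h)"
  have p: "pnorm (vshift h \<gamma>) = max (open_norm \<gamma>) ?y" by (rule pnorm_vshift[OF t c])
  have n: "0 \<le> open_norm \<gamma>"
    using norm_le_pnorm[OF c, of 0] t order_trans[OF norm_ge_zero] by (auto simp: open_norm_def)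
  have U: "Ups (vshift h \<gamma>) = kp (max (open_norm \<gamma>) ?y) (?y\<^sup>2)"
    using Ups_eq_kp[of "vshift h \<gamma>"] p by (simp add: endpt_vshift)
  show ?thesis
  proof (cases "?y \<le> open_norm \<gamma>")
    case True thus ?thesis using U by (simp add: max_def)
  next
    case False
    hence "open_norm \<gamma> ^ 6 \<le> ?y ^ 6" using n by (intro power_mono) auto
    hence "kp (open_norm \<gamma>) (?y\<^sup>2) = 3 * (?y\<^sup>2) ^ 3" "kp ?y (?y\<^sup>2) = 3 * (?y\<^sup>2) ^ 3"
      by (auto simp: kp_def max_def simp flip: power_mult)
    thus ?thesis using U False by (simp add: max_def)
  qed
qed

text \<open>At \<open>m\<^sup>2 = r\<close> the derivatives do not depend on \<open>m\<close>, so the degenerate value of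
  \<^const>\<open>open_norm\<close> at time \<open>0\<close> may be replaced by the norm.\<close>

lemma kp12_open_norm:
  assumes t: "0 \<le> fst \<gamma>" and c: "continuous_on {0..fst \<gamma>} (snd \<gamma>)"
  shows "kp1 (open_norm \<gamma>) ((norm (endpt \<gamma>))\<^sup>2) = kp1 (pnorm \<gamma>) ((norm (endpt \<gamma>))\<^sup>2)"
    "kp2 (open_norm \<gamma>) ((norm (endpt \<gamma>))\<^sup>2) = kp2 (pnorm \<gamma>) ((norm (endpt \<gamma>))\<^sup>2)"
proof -
  have "pnorm \<gamma> = norm (endpt \<gamma>)" if "fst \<gamma> = 0"
    using that by (simp add: pnorm_def endpt_def)
  thus "kp1 (open_norm \<gamma>) ((norm (endpt \<gamma>))\<^sup>2) = kp1 (pnorm \<gamma>) ((norm (endpt \<gamma>))\<^sup>2)"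
    "kp2 (open_norm \<gamma>) ((norm (endpt \<gamma>))\<^sup>2) = kp2 (pnorm \<gamma>) ((norm (endpt \<gamma>))\<^sup>2)"
    by (auto simp: open_norm_def kp1_def kp2_def max_def simp flip: power_mult)
qed

text \<open>Gradient and Hessian in \<open>y\<close> of \<open>a \<Upsilon>\<^sup>3 + b |y|\<^sup>6\<close> for a path with norm \<open>m\<close> and endpoint \<open>y\<close>.\<close>

definition grad6 :: "real \<Rightarrow> real \<Rightarrow> real \<Rightarrow> 'h::real_inner \<Rightarrow> 'h" where
  "grad6 a b m y = (2 * (a * kp1 m ((norm y)\<^sup>2) + b * (3 * ((norm y)\<^sup>2)\<^sup>2))) *\<^sub>R y"

definition hess6 :: "real \<Rightarrow> real \<Rightarrow> real \<Rightarrow> 'h::real_inner \<Rightarrow> 'h \<Rightarrow>\<^sub>L 'h" where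
  "hess6 a b m y = radial_hess (a * kp1 m ((norm y)\<^sup>2) + b * (3 * ((norm y)\<^sup>2)\<^sup>2))
     (a * kp2 m ((norm y)\<^sup>2) + b * (6 * (norm y)\<^sup>2)) y"

text \<open>Two paths occur because shifting \<gamma> shifts its difference \<eta> to a freely
  evolved centre by the same vector, and \<open>Ups\<close> is evaluated at that difference.\<close>

lemma pd_Ups_plus:
  assumes f: "\<And>h. f (vshift h \<gamma>) = a * Ups (vshift h \<eta>) + b * norm (endpt \<eta> + h) ^ 6"
    and t: "0 \<le> fst \<eta>" and c: "continuous_on {0..fst \<eta>} (snd \<eta>)"
  shows "pd_x f \<gamma> = grad6 a b (pnorm \<eta>) (endpt \<eta>)" "pd_xx f \<gamma> = hess6 a b (pnorm \<eta>) (endpt \<eta>)"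
proof -
  let ?m = "open_norm \<eta>" and ?y = "endpt \<eta>"
  let ?K1 = "\<lambda>r. a * kp1 ?m r + b * (3 * r\<^sup>2)"
  have f': "f (vshift h \<gamma>) = (\<lambda>r. a * kp ?m r + b * r ^ 3) ((norm (?y + h))\<^sup>2)" for h
    unfolding f Ups_vshift[OF t c] by (simp flip: power_mult)
  have D1: "DERIV (\<lambda>r. a * kp ?m r + b * r ^ 3) r :> ?K1 r" for r
    by (intro DERIV_add DERIV_cmult DERIV_kp) (auto intro!: derivative_eq_intros)
  have D2: "DERIV ?K1 ((norm ?y)\<^sup>2) :> a * kp2 ?m ((norm ?y)\<^sup>2) + b * (6 * (norm ?y)\<^sup>2)"
    by (intro DERIV_add DERIV_cmult DERIV_kp1) (auto intro!: derivative_eq_intros)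
  note R = radial_pd[of f \<gamma> "\<lambda>r. a * kp ?m r + b * r ^ 3" ?y, OF f' D1 D2]
  show "pd_x f \<gamma> = grad6 a b (pnorm \<eta>) (endpt \<eta>)" "pd_xx f \<gamma> = hess6 a b (pnorm \<eta>) (endpt \<eta>)"
    using R unfolding grad6_def hess6_def kp12_open_norm[OF t c] by auto
qed

lemma norm_grad6:
  assumes "norm y \<le> m" "0 \<le> a" "0 \<le> b"
  shows "norm (grad6 a b m y) \<le> 18 * (a + b) * m ^ 5"
proof -
  let ?r = "(norm y)\<^sup>2"
  have m: "0 \<le> m" "?r \<le> m\<^sup>2" using assms(1) norm_ge_zero[of y] by (auto intro: power_mono order_trans simp del: norm_ge_zero)
  have "?r\<^sup>2 \<le> (m\<^sup>2)\<^sup>2" using m by (intro power_mono) auto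
  hence r2: "?r\<^sup>2 \<le> m ^ 4" by (simp flip: power_mult)
  have "\<bar>a * kp1 m ?r + b * (3 * ?r\<^sup>2)\<bar> \<le> a * (9 * ?r\<^sup>2) + b * (3 * ?r\<^sup>2)"
    using mult_left_mono[OF kp12_bounds(1)[OF zero_le_power2 m(2)] assms(2)] assms
      abs_triangle_ineq[of "a * kp1 m ?r" "b * (3 * ?r\<^sup>2)"] by (simp add: abs_mult)
  also have "\<dots> \<le> 9 * (a + b) * ?r\<^sup>2"
    using assms by (simp add: algebra_simps)
  also have "\<dots> \<le> 9 * (a + b) * m ^ 4" using assms r2 by (intro mult_left_mono) auto
  finally have "norm (grad6 a b m y) \<le> 2 * (9 * (a + b) * m ^ 4) * m"
    unfolding grad6_def norm_scaleR using assms m by (intro mult_mono) (auto simp: abs_mult)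
  thus ?thesis by (simp add: eval_nat_numeral mult_ac)
qed

lemma norm_hess6:
  assumes "norm y \<le> m" "0 \<le> a" "0 \<le> b"
  shows "norm (hess6 a b m y) \<le> 400 * (a + b) * m ^ 4"
proof -
  let ?r = "(norm y)\<^sup>2"
  have m: "0 \<le> m" "?r \<le> m\<^sup>2" using assms(1) norm_ge_zero[of y] by (auto intro: power_mono order_trans simp del: norm_ge_zero)
  have "?r\<^sup>2 \<le> (m\<^sup>2)\<^sup>2" using m by (intro power_mono) auto
  hence r2: "?r\<^sup>2 \<le> m ^ 4" by (simp flip: power_mult)
  have 1: "\<bar>a * kp1 m ?r + b * (3 * ?r\<^sup>2)\<bar> \<le> a * (9 * ?r\<^sup>2) + b * (3 * ?r\<^sup>2)"
    using mult_left_mono[OF kp12_bounds(1)[OF zero_le_power2 m(2)] assms(2)] assms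
      abs_triangle_ineq[of "a * kp1 m ?r" "b * (3 * ?r\<^sup>2)"] by (simp add: abs_mult)
  have 2: "\<bar>a * kp2 m ?r + b * (6 * ?r)\<bar> \<le> a * (72 * ?r) + b * (6 * ?r)"
    using mult_left_mono[OF kp12_bounds(2)[OF zero_le_power2 m(2)] assms(2)] assms
      abs_triangle_ineq[of "a * kp2 m ?r" "b * (6 * ?r)"] by (simp add: abs_mult)
  have "norm (hess6 a b m y) \<le> 2 * (a * (9 * ?r\<^sup>2) + b * (3 * ?r\<^sup>2)) + 4 * (a * (72 * ?r) + b * (6 * ?r)) * ?r"
    unfolding hess6_def using 1 2
    by (intro order_trans[OF norm_radial_hess] add_mono mult_mono mult_right_mono) auto
  \<comment> \<open>306 = 2 * 9 + 4 * 72 and 30 = 2 * 3 + 4 * 6, from the bounds on the two radial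
    derivatives; 400 is a round majorant.\<close>
  also have "\<dots> = (306 * a + 30 * b) * ?r\<^sup>2"
    by (simp add: algebra_simps power2_eq_square[of ?r])
  also have "\<dots> \<le> (400 * (a + b)) * m ^ 4" using assms r2 by (intro mult_mono) auto
  finally show ?thesis .
qed

lemma tendsto_grad_hess6:
  fixes y :: "'a \<Rightarrow> 'h::real_inner"
  assumes m: "(m \<longlongrightarrow> M) Q" and y: "(y \<longlongrightarrow> Y) Q" and Q: "Q \<noteq> bot" and b: "\<And>n. norm (y n) \<le> m n"
  shows "((\<lambda>n. grad6 c d (m n) (y n)) \<longlongrightarrow> grad6 c d M Y) Q" "((\<lambda>n. hess6 c d (m n) (y n)) \<longlongrightarrow> hess6 c d M Y) Q"
proof -
  have r: "((\<lambda>n. (norm (y n))\<^sup>2) \<longlongrightarrow> (norm Y)\<^sup>2) Q" by (intro tendsto_intros y)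
  have b': "\<And>n. 0 \<le> (norm (y n))\<^sup>2" "\<And>n. (norm (y n))\<^sup>2 \<le> (m n)\<^sup>2" using b by (auto intro: power_mono)
  show "((\<lambda>n. grad6 c d (m n) (y n)) \<longlongrightarrow> grad6 c d M Y) Q" "((\<lambda>n. hess6 c d (m n) (y n)) \<longlongrightarrow> hess6 c d M Y) Q"
    unfolding grad6_def hess6_def
    by (intro tendsto_intros tendsto_radial_hess tendsto_kp12[OF m r Q b'] y r)+
qed

lemma self_adjoint_hess6: "self_adjoint (hess6 a b m y)"
  by (simp add: hess6_def self_adjoint_radial_hess)

section \<open>Derivatives of the gauge terms centred at a path\<close>

context path_space
begin

lemma norm_E_diff_le:
  assumes "x \<in> Lam T 0" "y \<in> Lam T 0"
  shows "norm (E x (fst x) - E y (fst x)) \<le> D y x"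
  using norm_E_le_D[OF assms, of "fst x"] assms by (simp add: Lam_iff D_sym)

text \<open>The pathwise gradient at x of the test term centred at \<zeta>, provided that \<zeta>
  ends no later than x. Written with \<open>D\<close> and \<open>E\<close>, its continuity in x and
  its decay as x approaches \<zeta> are directly accessible.\<close>

definition diff_grad :: "real \<Rightarrow> real \<Rightarrow> 'h path \<Rightarrow> 'h path \<Rightarrow> 'h" where
  "diff_grad a b \<zeta> x = grad6 a b (D \<zeta> x) (E x (fst x) - E \<zeta> (fst x))"

definition diff_hess :: "real \<Rightarrow> real \<Rightarrow> 'h path \<Rightarrow> 'h path \<Rightarrow> 'h \<Rightarrow>\<^sub>L 'h" where
  "diff_hess a b \<zeta> x = hess6 a b (D \<zeta> x) (E x (fst x) - E \<zeta> (fst x))"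

lemma pd_G_term:
  assumes \<zeta>: "\<zeta> \<in> Lam T 0" and \<gamma>: "\<gamma> \<in> Lam T 0" and le: "fst \<zeta> \<le> fst \<gamma>"
  shows "pd_x (G_term S a b \<zeta>) \<gamma> = diff_grad a b \<zeta> \<gamma>" "pd_xx (G_term S a b \<zeta>) \<gamma> = diff_hess a b \<zeta> \<gamma>"
proof -
  let ?\<eta> = "pdiff \<gamma> (flow S (fst \<gamma>) \<zeta>)"
  have \<eta>: "?\<eta> \<in> Lam T (fst \<gamma>)" by (rule pdiff_flow_Lam[OF assms])
  have t: "0 \<le> fst ?\<eta>" "continuous_on {0..fst ?\<eta>} (snd ?\<eta>)" using \<eta> \<gamma> by (auto simp: Lam_iff)
  have e: "endpt ?\<eta> = endpt \<gamma> - blinfun_apply (S (fst \<gamma> - fst \<zeta>)) (endpt \<zeta>)"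
    using assms by (simp add: endpt_pdiff_flow E_endpt E_ge Lam_iff[of \<gamma>])
  have "pdiff (vshift h \<gamma>) (flow S (fst \<gamma>) \<zeta>) = vshift h ?\<eta>" for h
    using \<gamma> by (auto simp: pdiff_def vshift_def endpt_def Lam_iff restrict_def)
  hence f: "G_term S a b \<zeta> (vshift h \<gamma>) = a * Ups (vshift h ?\<eta>) + b * norm (endpt ?\<eta> + h) ^ 6" for h
    unfolding G_term_def e endpt_vshift by (simp add: algebra_simps)
  show "pd_x (G_term S a b \<zeta>) \<gamma> = diff_grad a b \<zeta> \<gamma>" "pd_xx (G_term S a b \<zeta>) \<gamma> = diff_hess a b \<zeta> \<gamma>"
    unfolding diff_grad_def diff_hess_def
    using pd_Ups_plus[OF f t] by (simp_all add: pnorm_pdiff_flow endpt_pdiff_flow assms)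
qed

text \<open>\<open>Ups\<close> is the term with weights 1 and 0 centred at the zero path, so the
  part of a test functional multiplied by h needs no separate estimates.\<close>

lemma pd_Ups:
  assumes "\<gamma> \<in> Lam T 0"
  shows "pd_x Ups \<gamma> = diff_grad 1 0 zero_path \<gamma>" "pd_xx Ups \<gamma> = diff_hess 1 0 zero_path \<gamma>"
proof -
  have "E zero_path (fst \<gamma>) = 0" using assms by (simp add: Lam_iff E_zero_path)
  thus "pd_x Ups \<gamma> = diff_grad 1 0 zero_path \<gamma>" "pd_xx Ups \<gamma> = diff_hess 1 0 zero_path \<gamma>"
    using pd_Ups_plus[of Ups \<gamma> 1 \<gamma> 0] assms
    by (auto simp: Lam_iff diff_grad_def diff_hess_def pnorm_eq_D E_endpt)
qed

lemma norm_diff_grad: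
  assumes "\<zeta> \<in> Lam T 0" "x \<in> Lam T 0" "0 \<le> a" "0 \<le> b" "D \<zeta> x \<le> B"
  shows "norm (diff_grad a b \<zeta> x) \<le> 18 * (a + b) * B ^ 5"
proof -
  have "18 * (a + b) * D \<zeta> x ^ 5 \<le> 18 * (a + b) * B ^ 5"
    using assms by (intro mult_left_mono power_mono D_nonneg) auto
  thus ?thesis unfolding diff_grad_def
    using norm_grad6[OF norm_E_diff_le[OF assms(2,1)] assms(3,4)] by linarith
qed

lemma norm_diff_hess:
  assumes "\<zeta> \<in> Lam T 0" "x \<in> Lam T 0" "0 \<le> a" "0 \<le> b" "D \<zeta> x \<le> B"
  shows "norm (diff_hess a b \<zeta> x) \<le> 400 * (a + b) * B ^ 4"
proof -
  have "400 * (a + b) * D \<zeta> x ^ 4 \<le> 400 * (a + b) * B ^ 4"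
    using assms by (intro mult_left_mono power_mono D_nonneg) auto
  thus ?thesis unfolding diff_hess_def
    using norm_hess6[OF norm_E_diff_le[OF assms(2,1)] assms(3,4)] by linarith
qed

lemma conv_diff_grad_hess:
  assumes xs: "conv xs x" and \<eta>: "\<eta> \<in> Lam T 0"
  shows "(\<lambda>n. diff_grad a b \<eta> (xs n)) \<longlonglongrightarrow> diff_grad a b \<eta> x" "(\<lambda>n. diff_hess a b \<eta> (xs n)) \<longlonglongrightarrow> diff_hess a b \<eta> x"
proof -
  note c = convD[OF xs]
  have xsT: "fst (xs n) \<in> {0..T}" "fst x \<in> {0..T}" for n using c(1)[of n] c(2) by (auto simp: Lam_iff)
  have m: "(\<lambda>n. D \<eta> (xs n)) \<longlonglongrightarrow> D \<eta> x" using conv_D[OF xs(1) \<eta>] by (simp add: D_sym)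
  have e: "(\<lambda>n. E (xs n) (fst (xs n)) - E \<eta> (fst (xs n))) \<longlonglongrightarrow> E x (fst x) - E \<eta> (fst x)"
    using xsT by (intro tendsto_diff conv_E xs c continuous_on_tendsto_compose[OF E_continuous[OF \<eta>] c(4)]) auto
  show "(\<lambda>n. diff_grad a b \<eta> (xs n)) \<longlonglongrightarrow> diff_grad a b \<eta> x" "(\<lambda>n. diff_hess a b \<eta> (xs n)) \<longlonglongrightarrow> diff_hess a b \<eta> x"
    unfolding diff_grad_def diff_hess_def
    by (rule tendsto_grad_hess6[OF m e _ norm_E_diff_le[OF c(1) \<eta>]]; simp)+
qed

end

section \<open>Woven series\<close>

text \<open>The Weierstrass test makes the partial sums converge uniformly in n, so the limit and
  the series may be exchanged.\<close>

lemma dominated_suminf: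
  fixes a :: "nat \<Rightarrow> nat \<Rightarrow> 'a::banach"
  assumes lim: "\<And>k. (\<lambda>n. a n k) \<longlonglongrightarrow> b k" and bound: "\<And>n k. norm (a n k) \<le> M k" and M: "summable M"
  shows "(\<lambda>n. \<Sum>k. a n k) \<longlonglongrightarrow> (\<Sum>k. b k)"
proof (rule swap_uniform_limit'[where S = UNIV])
  have "norm (b k) \<le> M k" for k
    by (rule tendsto_upperbound[OF tendsto_norm[OF lim[of k]]]) (use bound in auto)
  hence "summable b" by (intro summable_comparison_test'[OF M]) auto
  thus "(\<lambda>K. \<Sum>k<K. b k) \<longlonglongrightarrow> (\<Sum>k. b k)" by (rule summable_LIMSEQ)
  show "\<forall>\<^sub>F K in sequentially. (\<lambda>n. \<Sum>k<K. a n k) \<longlonglongrightarrow> (\<Sum>k<K. b k)"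
    by (intro always_eventually allI tendsto_sum lim)
  show "uniform_limit UNIV (\<lambda>K n. \<Sum>k<K. a n k) (\<lambda>n. \<Sum>k. a n k) sequentially"
    by (rule Weierstrass_m_test[OF _ M]) (use bound in auto)
qed auto

text \<open>A representation in \<open>G_rep\<close> is a single sequence of weights and centres.
  The old ones go to the even indices and the perturbation to the odd ones.\<close>

definition weave :: "(nat \<Rightarrow> 'a) \<Rightarrow> (nat \<Rightarrow> 'a) \<Rightarrow> nat \<Rightarrow> 'a" where
  "weave a b n = (if even n then a (n div 2) else b ((n - 1) div 2))"

lemma weave_sums:
  fixes a b :: "nat \<Rightarrow> real"
  assumes "summable a" "summable b"
  shows "weave a b sums (suminf a + suminf b)"
  using sums_if[OF summable_sums[OF assms(2)] summable_sums[OF assms(1)]]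
  unfolding weave_def by (simp add: add.commute)

text \<open>No summability is assumed: both series have the same \<open>sums\<close> relation and
  hence the same \<open>suminf\<close>, even if they diverge.\<close>

lemma suminf_weave_zero:
  fixes a :: "nat \<Rightarrow> 'a::real_normed_vector"
  shows "(\<Sum>n. weave a (\<lambda>_. 0) n) = (\<Sum>i. a i)"
proof -
  have "weave a (\<lambda>_. 0) n = 0" if "n \<notin> range (\<lambda>i. 2 * i)" for n
    using that by (auto simp: weave_def elim!: evenE)
  hence "(\<lambda>i. weave a (\<lambda>_. 0) (2 * i)) sums c \<longleftrightarrow> weave a (\<lambda>_. 0) sums c" for c
    by (intro sums_mono_reindex) (auto simp: strict_mono_def)
  hence "(sums) (weave a (\<lambda>_. 0)) = (sums) a" by (simp add: weave_def fun_eq_iff)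
  thus ?thesis unfolding suminf_def by simp
qed

lemma tendsto_suminf_weave:
  fixes a b :: "nat \<Rightarrow> nat \<Rightarrow> 'a::banach"
  assumes "\<And>i. (\<lambda>n. a n i) \<longlonglongrightarrow> a' i" "\<And>i. (\<lambda>n. b n i) \<longlonglongrightarrow> 0"
    and "\<And>n i. norm (a n i) \<le> M i" "\<And>n i. norm (b n i) \<le> N i" "summable M" "summable N"
  shows "(\<lambda>n. \<Sum>k. weave (a n) (b n) k) \<longlonglongrightarrow> (\<Sum>i. a' i)"
  unfolding suminf_weave_zero[symmetric, of a']
proof (rule dominated_suminf)
  show "(\<lambda>n. weave (a n) (b n) k) \<longlonglongrightarrow> weave a' (\<lambda>_. 0) k" for k
    using assms(1,2) by (simp add: weave_def)
  show "norm (weave (a n) (b n) k) \<le> weave M N k" for n k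
    using assms(3,4) by (simp add: weave_def)
  show "summable (weave M N)" using weave_sums[OF assms(5,6)] by (rule sums_summable)
qed

section \<open>Adding a constant to a test functional\<close>

lemma has_pd_t0_add_const: "has_pd_t0 (\<lambda>\<gamma>. f \<gamma> + c) D \<gamma> \<longleftrightarrow> has_pd_t0 f D \<gamma>"
  by (simp add: has_pd_t0_def)

lemma has_pd_t_add_const: "has_pd_t T (\<lambda>\<gamma>. f \<gamma> + c) D \<gamma> \<longleftrightarrow> has_pd_t T f D \<gamma>"
  by (simp add: has_pd_t_def has_pd_t0_add_const pd_t0_def)

lemma has_pd_x_add_const: "has_pd_x (\<lambda>\<gamma>. f \<gamma> + c) p \<gamma> \<longleftrightarrow> has_pd_x f p \<gamma>"
proof
  assume "has_pd_x (\<lambda>\<gamma>. f \<gamma> + c) p \<gamma>"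
  from GDERIV_diff[OF this[unfolded has_pd_x_def] GDERIV_const[of c]] show "has_pd_x f p \<gamma>"
    by (simp add: has_pd_x_def)
next
  assume "has_pd_x f p \<gamma>"
  from GDERIV_add[OF this[unfolded has_pd_x_def] GDERIV_const[of c]] show "has_pd_x (\<lambda>\<gamma>. f \<gamma> + c) p \<gamma>"
    by (simp add: has_pd_x_def)
qed

lemma pd_add_const:
  "pd_t T (\<lambda>\<gamma>. f \<gamma> + c) = pd_t T f" "pd_x (\<lambda>\<gamma>. f \<gamma> + c) = pd_x f"
  "has_pd_xx (\<lambda>\<gamma>. f \<gamma> + c) l \<gamma> \<longleftrightarrow> has_pd_xx f l \<gamma>" "pd_xx (\<lambda>\<gamma>. f \<gamma> + c) = pd_xx f"
proof -
  show t: "pd_t T (\<lambda>\<gamma>. f \<gamma> + c) = pd_t T f" by (simp add: fun_eq_iff pd_t_def has_pd_t_add_const)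
  show x: "pd_x (\<lambda>\<gamma>. f \<gamma> + c) = pd_x f" by (simp add: fun_eq_iff pd_x_def has_pd_x_add_const)
  show "has_pd_xx (\<lambda>\<gamma>. f \<gamma> + c) l \<gamma> \<longleftrightarrow> has_pd_xx f l \<gamma>" for l \<gamma>
    by (simp add: has_pd_xx_def has_pd_x_add_const x)
  thus "pd_xx (\<lambda>\<gamma>. f \<gamma> + c) = pd_xx f" by (simp add: fun_eq_iff pd_xx_def)
qed

text \<open>The exponent is doubled because \<^const>\<open>pnorm\<close> is not known to be nonnegative on the given set
  of paths (for an unbounded path it is an unspecified real).\<close>

lemma poly_growth_add_const:
  fixes f :: "'h::real_normed_vector path \<Rightarrow> real"
  assumes "poly_growth X f"
  shows "poly_growth X (\<lambda>\<gamma>. f \<gamma> + c)"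
proof -
  obtain C k where C: "\<And>\<gamma>. \<gamma> \<in> X \<Longrightarrow> norm (f \<gamma>) \<le> C * (1 + pnorm \<gamma> ^ k)"
    using assms by (auto simp: poly_growth_def)
  have "norm (f \<gamma> + c) \<le> (2 * \<bar>C\<bar> + \<bar>c\<bar>) * (1 + pnorm \<gamma> ^ (2 * k))" if "\<gamma> \<in> X" for \<gamma>
  proof -
    define z where "z = pnorm \<gamma> ^ k"
    have z: "z \<le> 1 + z\<^sup>2" "- z \<le> 1 + z\<^sup>2"
      using zero_le_power2[of "z - 1/2"] zero_le_power2[of "z + 1/2"] by (auto simp: power2_eq_square algebra_simps)
    have "C * (1 + z) \<le> \<bar>C\<bar> * \<bar>1 + z\<bar>" by (metis abs_ge_self abs_mult)
    also have "\<dots> \<le> \<bar>C\<bar> * (2 * (1 + z\<^sup>2))"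
    proof (rule mult_left_mono)
      show "\<bar>1 + z\<bar> \<le> 2 * (1 + z\<^sup>2)" using z zero_le_power2[of z] unfolding abs_le_iff distrib_left by linarith
    qed simp
    also have "\<dots> = 2 * \<bar>C\<bar> * (1 + z\<^sup>2)" by simp
    finally have "norm (f \<gamma> + c) \<le> 2 * \<bar>C\<bar> * (1 + z\<^sup>2) + \<bar>c\<bar>"
      using C[OF that] norm_triangle_ineq[of "f \<gamma>" c] unfolding z_def by simp
    also have "\<dots> \<le> (2 * \<bar>C\<bar> + \<bar>c\<bar>) * (1 + z\<^sup>2)" by (simp add: distrib_left distrib_right)
    finally show ?thesis by (simp add: z_def mult.commute flip: power_mult)
  qed
  thus ?thesis unfolding poly_growth_def by blast
qed

lemma path_continuous_add_const:
  fixes f :: "'h::real_normed_vector path \<Rightarrow> real"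
  shows "path_continuous T S X f \<Longrightarrow> path_continuous T S X (\<lambda>\<gamma>. f \<gamma> + c)"
  unfolding path_continuous_def by (auto intro!: tendsto_intros)

text \<open>Allows the touching value at a perturbed maximum to be moved to 0 without changing any
  term of the viscosity inequality other than the value of the test functional.\<close>

lemma Phi_ext_add_const:
  assumes "Phi_ext T S A f f'"
  shows "Phi_ext T S A (\<lambda>\<gamma>. f \<gamma> + c) (\<lambda>\<gamma>. f' \<gamma> + c)"
  using assms unfolding Phi_ext_def C12p_ext_def C12p_hat_def pd_add_const has_pd_t_add_const has_pd_x_add_const
  by (auto simp: C0p_def poly_growth_add_const path_continuous_add_const)

lemma Lam_subset_Lam_hat: "Lam T t \<subseteq> Lam_hat T t" if "0 \<le> t" for t
proof -
  have "cadlag_on s f" if f: "continuous_on {0..s} f" for s and f :: "real \<Rightarrow> 'a::topological_space"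
    unfolding cadlag_on_def
  proof (intro conjI allI impI)
    fix r assume r: "0 \<le> r \<and> r < s"
    have "(f \<longlongrightarrow> f r) (at r within {r..s})"
      using continuous_on_subset[OF f, of "{r..s}"] r by (auto simp: continuous_on_def)
    thus "(f \<longlongrightarrow> f r) (at_right r)" using r by (simp add: at_within_Icc_at_right)
  next
    fix r assume r: "0 < r \<and> r \<le> s"
    have "(f \<longlongrightarrow> f r) (at r within {0..r})"
      using continuous_on_subset[OF f, of "{0..r}"] r by (auto simp: continuous_on_def)
    thus "\<exists>l. (f \<longlongrightarrow> l) (at_left r)" using r by (auto simp: at_within_Icc_at_left)
  qed
  thus ?thesis by (auto simp: Lam_def Lam_hat_def Cpaths_def Dpaths_def)
qed

section \<open>Perturbing the singular test functionals\<close>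

context path_space
begin

lemma G_rep_path:
  assumes "G_rep T S t g h h' \<delta> \<delta>' \<zeta>" "t \<le> T"
  shows "\<zeta> i \<in> Lam T 0" "fst (\<zeta> i) \<le> t" "0 \<le> \<delta> i" "0 \<le> \<delta>' i"
proof -
  have *: "0 \<le> \<delta> i" "0 \<le> \<delta>' i" "\<zeta> i \<in> (\<Union>r\<in>{0..t}. Cpaths r)" using assms(1) by (simp_all add: G_rep_def)
  show "\<zeta> i \<in> Lam T 0" "fst (\<zeta> i) \<le> t" using *(3) assms(2) by (auto simp: Lam_iff Cpaths_iff)
  show "0 \<le> \<delta> i" "0 \<le> \<delta>' i" by fact+
qed

lemma G_rep_bounds:
  assumes "G_rep T S t g h h' \<delta> \<delta>' \<zeta>"
  obtains N where "0 < N" "\<And>i. pnorm (\<zeta> i) \<le> N" "summable (\<lambda>i. \<delta> i + \<delta>' i)"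
proof -
  have "\<exists>N>0. (\<forall>i. pnorm (\<zeta> i) \<le> N) \<and> summable (\<lambda>i. \<delta> i + \<delta>' i) \<and> (\<Sum>i. \<delta> i + \<delta>' i) \<le> N"
    using assms by (simp add: G_rep_def)
  thus thesis using that by blast
qed

lemma Ups_bar_le:
  assumes "x \<in> Lam T 0" "y \<in> Lam T 0" "pnorm y \<le> N"
  shows "Ups_bar S x y \<le> 3 * (pnorm x + N) ^ 6 + T\<^sup>2"
proof -
  have "D x y \<le> pnorm x + N" using D_le_pnorm[OF assms(1,2)] assms(3) by simp
  hence "D x y ^ 6 \<le> (pnorm x + N) ^ 6" by (intro power_mono D_nonneg assms)
  moreover have "(fst x - fst y)\<^sup>2 \<le> T\<^sup>2"
    using assms T by (intro power2_le_iff_abs_le[THEN iffD2]) (auto simp: Lam_iff)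
  ultimately show ?thesis using Ups_bar_bounds(2)[OF assms(1,2)] by linarith
qed

lemma summable_G_terms:
  assumes x: "x \<in> Lam T 0" and \<zeta>: "\<And>i. \<zeta> i \<in> Lam T 0" "\<And>i. fst (\<zeta> i) \<le> fst x" "\<And>i. pnorm (\<zeta> i) \<le> N"
    and \<delta>: "\<And>i. 0 \<le> \<delta> i" "\<And>i. 0 \<le> \<delta>' i" "summable (\<lambda>i. \<delta> i + \<delta>' i)"
  shows "summable (\<lambda>i. \<delta> i * Ups_bar S x (\<zeta> i)
    + \<delta>' i * norm (endpt x - blinfun_apply (S (fst x - fst (\<zeta> i))) (endpt (\<zeta> i))) ^ 6)"
proof (rule summable_comparison_test'[of "\<lambda>i. (\<delta> i + \<delta>' i) * (3 * (pnorm x + N) ^ 6 + T\<^sup>2)"])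
  show "summable (\<lambda>i. (\<delta> i + \<delta>' i) * (3 * (pnorm x + N) ^ 6 + T\<^sup>2))"
    by (intro summable_mult2 \<delta>)
  fix i
  let ?n = "norm (endpt x - blinfun_apply (S (fst x - fst (\<zeta> i))) (endpt (\<zeta> i)))"
  have "?n = norm (E x (fst x) - E (\<zeta> i) (fst x))"
    using x \<zeta>(1,2) by (simp add: E_endpt E_ge Lam_iff[of x])
  also have "\<dots> \<le> D x (\<zeta> i)" using x by (intro norm_E_le_D \<zeta>) (auto simp: Lam_iff)
  also have "\<dots> \<le> pnorm x + N" using D_le_pnorm[OF x \<zeta>(1), of i] \<zeta>(3)[of i] by simp
  finally have "?n ^ 6 \<le> (pnorm x + N) ^ 6" by (rule power_mono) simp
  moreover have "0 \<le> (pnorm x + N) ^ 6" by simp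
  ultimately have "?n ^ 6 \<le> 3 * (pnorm x + N) ^ 6 + T\<^sup>2" using zero_le_power2[of T] by linarith
  hence "\<delta> i * Ups_bar S x (\<zeta> i) + \<delta>' i * ?n ^ 6 \<le> (\<delta> i + \<delta>' i) * (3 * (pnorm x + N) ^ 6 + T\<^sup>2)"
    unfolding distrib_right by (intro add_mono mult_left_mono Ups_bar_le x \<zeta> \<delta>)
  moreover have "0 \<le> \<delta> i * Ups_bar S x (\<zeta> i) + \<delta>' i * ?n ^ 6"
    by (intro add_nonneg_nonneg mult_nonneg_nonneg \<delta> Ups_bar_nonneg x \<zeta>) simp
  ultimately show "norm (\<delta> i * Ups_bar S x (\<zeta> i) + \<delta>' i * ?n ^ 6) \<le> (\<delta> i + \<delta>' i) * (3 * (pnorm x + N) ^ 6 + T\<^sup>2)"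
    by simp
qed

lemma summable_half_Ups_bar:
  assumes "x \<in> Lam T 0" "\<And>i. y i \<in> Lam T 0" "\<And>i. pnorm (y i) \<le> N"
  shows "summable (\<lambda>i. (1 / 2) ^ i * Ups_bar S x (y i))"
proof (rule summable_comparison_test'[of "\<lambda>i. (1 / 2) ^ i * (3 * (pnorm x + N) ^ 6 + T\<^sup>2)"])
  show "summable (\<lambda>i. (1 / 2) ^ i * (3 * (pnorm x + N) ^ 6 + T\<^sup>2))"
    by (intro summable_mult2 summable_geometric) simp
  show "norm ((1 / 2) ^ i * Ups_bar S x (y i)) \<le> (1 / 2) ^ i * (3 * (pnorm x + N) ^ 6 + T\<^sup>2)" for i
    using Ups_bar_le[OF assms(1,2,3)] Ups_bar_nonneg[OF assms(1,2)] by (simp add: abs_mult mult_left_mono)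
qed

lemma conv_pnorm_bounded:
  assumes "conv xs x"
  obtains B where "0 \<le> B" "\<And>n. pnorm (xs n) \<le> B"
proof -
  have "Bseq (\<lambda>n. pnorm (xs n))" using conv_pnorm[OF assms] by (intro convergent_imp_Bseq convergentI)
  then obtain B where "0 < B" "\<And>n. norm (pnorm (xs n)) \<le> B" unfolding Bseq_def by blast
  thus thesis using that[of B] by (metis abs_le_iff less_imp_le real_norm_def)
qed

lemma C0p_half_Ups_bar:
  assumes t: "0 \<le> t" and y: "\<And>i. y i \<in> Lam T 0" "\<And>i. pnorm (y i) \<le> N"
  shows "C0p T S (Lam T t) (\<lambda>x. \<Sum>i. (1 / 2) ^ i * Ups_bar S x (y i))"
proof -
  have geo: "summable (\<lambda>i. (1 / 2) ^ i * (C::real))" for C by (intro summable_mult2 summable_geometric) simp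
  have N: "0 \<le> N" using pnorm_nonneg[OF y(1)] y(2) by (meson order_trans)
  have bound: "norm ((1 / 2) ^ i * Ups_bar S x (y i)) \<le> (1 / 2) ^ i * (3 * (B + N) ^ 6 + T\<^sup>2)"
    if "x \<in> Lam T 0" "pnorm x \<le> B" for i x B
  proof -
    have "(pnorm x + N) ^ 6 \<le> (B + N) ^ 6" using that N pnorm_nonneg by (intro power_mono) auto
    hence "Ups_bar S x (y i) \<le> 3 * (B + N) ^ 6 + T\<^sup>2" using Ups_bar_le[OF that(1) y, of i] by linarith
    thus ?thesis using Ups_bar_nonneg[OF that(1) y(1)] by (simp add: abs_mult mult_left_mono)
  qed
  have "path_continuous T S (Lam T t) (\<lambda>x. \<Sum>i. (1 / 2) ^ i * Ups_bar S x (y i))"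
  proof (rule path_continuousI)
    show "Lam T t \<subseteq> Lam T 0" using Lam_mono[OF t] by blast
    fix xs x assume xs: "conv xs x"
    obtain B where B: "\<And>n. pnorm (xs n) \<le> B" using conv_pnorm_bounded[OF xs] by blast
    show "(\<lambda>n. \<Sum>i. (1 / 2) ^ i * Ups_bar S (xs n) (y i)) \<longlonglongrightarrow> (\<Sum>i. (1 / 2) ^ i * Ups_bar S x (y i))"
      by (rule dominated_suminf[OF _ bound[where B = B] geo])
         (intro tendsto_intros conv_Ups_bar xs y convD(1)[OF xs] B)+
  qed
  moreover have "poly_growth (Lam T t) (\<lambda>x. \<Sum>i. (1 / 2) ^ i * Ups_bar S x (y i))"
    unfolding poly_growth_def
  proof (intro exI ballI)
    fix x :: "'h path" assume "x \<in> Lam T t"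
    hence x: "x \<in> Lam T 0" using Lam_mono[OF t] by blast
    let ?p = "pnorm x"
    have p: "0 \<le> ?p" by (rule pnorm_nonneg[OF x])
    have "norm (\<Sum>i. (1 / 2) ^ i * Ups_bar S x (y i)) \<le> (\<Sum>i. (1 / 2) ^ i * (3 * (?p + N) ^ 6 + T\<^sup>2))"
      by (rule norm_suminf_le[OF bound[OF x order_refl] geo])
    also have "\<dots> = 2 * (3 * (?p + N) ^ 6 + T\<^sup>2)"
      by (subst suminf_mult2[symmetric]) (simp_all add: summable_geometric suminf_geometric)
    also have "(?p + N) ^ 6 \<le> (2 * max ?p N) ^ 6" using p N by (intro power_mono) auto
    also have "(2 * max ?p N) ^ 6 \<le> 64 * (?p ^ 6 + N ^ 6)"
      using p N by (auto simp: max_def power_mult_distrib)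
    \<comment> \<open>384 = 2 * 3 * 64: the sum of the geometric weights, the constant of the gauge
      bound, and 2^6.\<close>
    finally have "norm (\<Sum>i. (1 / 2) ^ i * Ups_bar S x (y i)) \<le> 384 * ?p ^ 6 + (384 * N ^ 6 + 2 * T\<^sup>2)"
      by simp
    also have "\<dots> \<le> (384 + 384 * N ^ 6 + 2 * T\<^sup>2) * (1 + ?p ^ 6)"
      using p N by (simp add: distrib_left distrib_right)
    finally show "norm (\<Sum>i. (1 / 2) ^ i * Ups_bar S x (y i)) \<le> (384 + 384 * N ^ 6 + 2 * T\<^sup>2) * (1 + ?p ^ 6)" .
  qed
  ultimately show ?thesis by (simp add: C0p_def)
qed

lemma C0p_add:
  fixes f g :: "'h path \<Rightarrow> real"
  assumes t: "0 \<le> t" and f: "C0p T S (Lam T t) f" and g: "C0p T S (Lam T t) g"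
  shows "C0p T S (Lam T t) (\<lambda>x. f x + g x)"
proof -
  obtain C k where C: "\<And>x. x \<in> Lam T t \<Longrightarrow> norm (f x) \<le> C * (1 + pnorm x ^ k)"
    using f by (auto simp: C0p_def poly_growth_def)
  obtain C' k' where C': "\<And>x. x \<in> Lam T t \<Longrightarrow> norm (g x) \<le> C' * (1 + pnorm x ^ k')"
    using g by (auto simp: C0p_def poly_growth_def)
  have "norm (f x + g x) \<le> (2 * \<bar>C\<bar> + 2 * \<bar>C'\<bar>) * (1 + pnorm x ^ (k + k'))" if "x \<in> Lam T t" for x
  proof -
    let ?p = "pnorm x"
    have p: "0 \<le> ?p" using that Lam_mono[OF t] pnorm_nonneg by blast
    \<comment> \<open>The exponent k + k' dominates both growth exponents for norms above 1; the
      summand 1 covers smaller norms.\<close>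
    have pw: "?p ^ k \<le> 1 + ?p ^ (k + k')" "?p ^ k' \<le> 1 + ?p ^ (k + k')"
    proof -
      have "?p ^ k \<le> 1 + ?p ^ (k + k') \<and> ?p ^ k' \<le> 1 + ?p ^ (k + k')"
      proof (cases "?p \<le> 1")
        case True
        thus ?thesis using p power_le_one[of ?p] by (simp add: add_increasing2)
      next
        case False
        hence "?p ^ k \<le> ?p ^ (k + k')" "?p ^ k' \<le> ?p ^ (k + k')"
          by (auto intro: power_increasing)
        thus ?thesis by simp
      qed
      thus "?p ^ k \<le> 1 + ?p ^ (k + k')" "?p ^ k' \<le> 1 + ?p ^ (k + k')" by auto
    qed
    have pk: "0 \<le> ?p ^ (k + k')" "0 \<le> ?p ^ k" "0 \<le> ?p ^ k'" using p by simp_all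
    have "1 + ?p ^ k \<le> 2 * (1 + ?p ^ (k + k'))" "1 + ?p ^ k' \<le> 2 * (1 + ?p ^ (k + k'))"
      using pw pk unfolding distrib_left by linarith+
    hence "C * (1 + ?p ^ k) \<le> \<bar>C\<bar> * (2 * (1 + ?p ^ (k + k')))" "C' * (1 + ?p ^ k') \<le> \<bar>C'\<bar> * (2 * (1 + ?p ^ (k + k')))"
      using pk by (intro mult_mono; simp)+
    moreover have "norm (f x + g x) \<le> norm (f x) + norm (g x)" by (rule norm_triangle_ineq)
    ultimately show ?thesis using C[OF that] C'[OF that] by (simp add: algebra_simps)
  qed
  hence "poly_growth (Lam T t) (\<lambda>x. f x + g x)" unfolding poly_growth_def by blast
  moreover have "path_continuous T S (Lam T t) (\<lambda>x. f x + g x)"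
    using f g unfolding C0p_def path_continuous_def by (auto intro!: tendsto_add)
  ultimately show ?thesis by (simp add: C0p_def)
qed

lemma path_continuous_subset:
  assumes "path_continuous T S X f" "Y \<subseteq> X"
  shows "path_continuous T S Y f"
proof -
  have "path_nhds T S Y x \<le> path_nhds T S X x" for x
    unfolding le_filter_def eventually_path_nhds using assms(2) by blast
  thus ?thesis using assms unfolding path_continuous_def by (meson subsetD tendsto_mono)
qed

lemma C0p_subset: "C0p T S X f \<Longrightarrow> Y \<subseteq> X \<Longrightarrow> C0p T S Y f"
  using path_continuous_subset unfolding C0p_def poly_growth_def by blast

text \<open>The time order enters here: the old centres stay admissible because t \<le> s, and the
  new ones because they end by s. The perturbation consists of gauge terms only, hence the weights 0
  woven into \<open>\<delta>'\<close>.\<close>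

lemma G_rep_perturb:
  assumes G: "G_rep T S t g h h' \<delta> \<delta>' \<zeta>" and t: "0 \<le> t" "t \<le> s" "s \<le> T"
    and y: "\<And>i. y i \<in> Lam T 0" "\<And>i. fst (y i) \<le> s" "\<And>i. pnorm (y i) \<le> N"
  shows "G_rep T S s (\<lambda>x. g x + (\<Sum>i. (1 / 2) ^ i * Ups_bar S x (y i))) h h'
    (weave \<delta> (\<lambda>i. (1 / 2) ^ i)) (weave \<delta>' (\<lambda>_. 0)) (weave \<zeta> y)"
proof -
  have tT: "t \<le> T" using t by simp
  note \<zeta> = G_rep_path[OF G tT]
  obtain N' where N': "0 < N'" "\<And>i. pnorm (\<zeta> i) \<le> N'" "summable (\<lambda>i. \<delta> i + \<delta>' i)"
    using G_rep_bounds[OF G] by blast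
  have half: "summable (\<lambda>i. (1 / 2) ^ i :: real)" by (rule summable_geometric) simp
  have s0: "0 \<le> s" using t by simp
  have sub: "Lam T s \<subseteq> Lam T t" using Lam_mono[OF t(2)] by blast
  show ?thesis unfolding G_rep_def
  proof (intro conjI allI)
    show "C0p T S (Lam T s) (\<lambda>x. g x + (\<Sum>i. (1 / 2) ^ i * Ups_bar S x (y i)))"
      using G by (intro C0p_add[OF s0] C0p_half_Ups_bar[OF s0 y(1,3)] C0p_subset[OF _ sub]) (simp add: G_rep_def)
    show "\<forall>s\<in>{0..T}. 0 \<le> h s \<and> (h has_real_derivative h' s) (at s within {0..T})" "continuous_on {0..T} h'"
      using G by (simp_all add: G_rep_def)
    show "0 \<le> weave \<delta> (\<lambda>i. (1 / 2) ^ i) i" "0 \<le> weave \<delta>' (\<lambda>_. 0) i" for i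
      using \<zeta> by (simp_all add: weave_def)
    show "weave \<zeta> y i \<in> (\<Union>r\<in>{0..s}. Cpaths r)" for i
      using \<zeta>(1)[of "i div 2"] \<zeta>(2)[of "i div 2"] y(1)[of "(i - 1) div 2"] y(2)[of "(i - 1) div 2"] t
      by (auto simp: weave_def Lam_def Cpaths_def)
    show "\<exists>N>0. (\<forall>i. pnorm (weave \<zeta> y i) \<le> N) \<and>
            summable (\<lambda>i. weave \<delta> (\<lambda>i. (1 / 2) ^ i) i + weave \<delta>' (\<lambda>_. 0) i) \<and>
            (\<Sum>i. weave \<delta> (\<lambda>i. (1 / 2) ^ i) i + weave \<delta>' (\<lambda>_. 0) i) \<le> N"
    proof -
      have e: "(\<lambda>i. weave \<delta> (\<lambda>i. (1 / 2) ^ i) i + weave \<delta>' (\<lambda>_. 0) i) = weave (\<lambda>i. \<delta> i + \<delta>' i) (\<lambda>i. (1 / 2) ^ i)"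
        by (auto simp: weave_def)
      have "summable (weave (\<lambda>i. \<delta> i + \<delta>' i) (\<lambda>i. (1 / 2) ^ i))"
        using weave_sums[OF N'(3) half] by (rule sums_summable)
      moreover have "pnorm (weave \<zeta> y i) \<le> max N N'" for i
        using y(3) N'(2) by (auto simp: weave_def le_max_iff_disj)
      ultimately show ?thesis unfolding e
        by (intro exI[of _ "max (max N N') (suminf (weave (\<lambda>i. \<delta> i + \<delta>' i) (\<lambda>i. (1 / 2) ^ i)))"])
           (use N'(1) in \<open>auto simp: le_max_iff_disj less_max_iff_disj\<close>)
    qed
    show "\<forall>x\<in>Lam T s. g x + (\<Sum>i. (1 / 2) ^ i * Ups_bar S x (y i)) = h (fst x) * Ups x +
        (\<Sum>i. weave \<delta> (\<lambda>i. (1 / 2) ^ i) i * Ups_bar S x (weave \<zeta> y i)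
           + weave \<delta>' (\<lambda>_. 0) i * norm (endpt x - blinfun_apply (S (fst x - fst (weave \<zeta> y i))) (endpt (weave \<zeta> y i))) ^ 6)"
    proof
      fix x :: "'h path" assume "x \<in> Lam T s"
      hence x: "x \<in> Lam T 0" "x \<in> Lam T t" using Lam_mono[OF s0] Lam_mono[OF t(2)] by blast+
      let ?a = "\<lambda>i. \<delta> i * Ups_bar S x (\<zeta> i)
           + \<delta>' i * norm (endpt x - blinfun_apply (S (fst x - fst (\<zeta> i))) (endpt (\<zeta> i))) ^ 6"
      let ?b = "\<lambda>i. (1 / 2) ^ i * Ups_bar S x (y i)"
      have "fst (\<zeta> i) \<le> fst x" for i using \<zeta>(2)[of i] x(2) by (simp add: Lam_iff)
      hence a: "summable ?a" by (intro summable_G_terms[where N = N'] x \<zeta> N')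
      have b: "summable ?b" by (intro summable_half_Ups_bar[where N = N] x y)
      have "(\<lambda>i. weave \<delta> (\<lambda>i. (1 / 2) ^ i) i * Ups_bar S x (weave \<zeta> y i)
           + weave \<delta>' (\<lambda>_. 0) i * norm (endpt x - blinfun_apply (S (fst x - fst (weave \<zeta> y i))) (endpt (weave \<zeta> y i))) ^ 6)
           = weave ?a ?b"
        by (auto simp: weave_def)
      moreover have "g x = h (fst x) * Ups x + suminf ?a"
        using G x(2) by (simp add: G_rep_def)
      ultimately show "g x + suminf ?b = h (fst x) * Ups x +
        (\<Sum>i. weave \<delta> (\<lambda>i. (1 / 2) ^ i) i * Ups_bar S x (weave \<zeta> y i)
           + weave \<delta>' (\<lambda>_. 0) i * norm (endpt x - blinfun_apply (S (fst x - fst (weave \<zeta> y i))) (endpt (weave \<zeta> y i))) ^ 6)"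
        using sums_unique[OF weave_sums[OF a b]] by simp
    qed
  qed
qed

end

section \<open>Approximating a touching point\<close>

lemma self_adjoint_add: "self_adjoint k \<Longrightarrow> self_adjoint l \<Longrightarrow> self_adjoint (k + l)"
  by (simp add: self_adjoint_def blinfun.add_left inner_add_left inner_add_right)

lemma self_adjoint_scaleR: "self_adjoint l \<Longrightarrow> self_adjoint (c *\<^sub>R l)"
  by (simp add: self_adjoint_def blinfun.scaleR_left)

lemma self_adjoint_suminf:
  fixes l :: "nat \<Rightarrow> 'h::{real_inner,banach} \<Rightarrow>\<^sub>L 'h"
  assumes "summable l" "\<And>i. self_adjoint (l i)"
  shows "self_adjoint (\<Sum>i. l i)"
proof -
  have 1: "blinfun_apply (\<Sum>i. l i) x \<bullet> y = (\<Sum>i. blinfun_apply (l i) x \<bullet> y)" for x y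
    using bounded_linear.suminf[OF _ assms(1), of "\<lambda>l. blinfun_apply l x \<bullet> y"]
    by (simp add: bounded_linear_compose[OF bounded_linear_inner_left blinfun.bounded_linear_left])
  show ?thesis unfolding self_adjoint_def
  proof (intro allI)
    fix x y
    have "blinfun_apply (\<Sum>i. l i) x \<bullet> y = (\<Sum>i. blinfun_apply (l i) y \<bullet> x)"
      unfolding 1 using assms(2) by (simp add: self_adjoint_def inner_commute)
    also have "\<dots> = blinfun_apply (\<Sum>i. l i) y \<bullet> x" by (rule 1[symmetric])
    finally show "blinfun_apply (\<Sum>i. l i) x \<bullet> y = x \<bullet> blinfun_apply (\<Sum>i. l i) y"
      by (simp only: inner_commute)
  qed
qed

context path_space
begin

text \<open>Continuity of the Hamiltonian is supplied only for self-adjoint l, so the Hessian at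
  which it is used must be shown to be self-adjoint.\<close>

lemma self_adjoint_G_dxx:
  assumes G: "G_rep T S t g h h' \<delta> \<delta>' \<zeta>" and x: "x \<in> Lam T t" and t: "0 \<le> t"
  shows "self_adjoint (G_dxx S h \<delta> \<delta>' \<zeta> x)"
proof -
  have tT: "t \<le> T" and tx: "t \<le> fst x" using x by (auto simp: Lam_iff)
  note \<zeta> = G_rep_path[OF G tT]
  obtain N where N: "0 < N" "\<And>i. pnorm (\<zeta> i) \<le> N" "summable (\<lambda>i. \<delta> i + \<delta>' i)"
    using G_rep_bounds[OF G] by blast
  have x0: "x \<in> Lam T 0" using x Lam_mono[OF t] by blast
  have le: "fst (\<zeta> i) \<le> fst x" for i using \<zeta>(2)[of i] tx by simp
  have DN: "D (\<zeta> i) x \<le> N + pnorm x" for i using D_le_pnorm[OF \<zeta>(1) x0, of i] N(2)[of i] by simp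
  have "summable (\<lambda>i. diff_hess (\<delta> i) (\<delta>' i) (\<zeta> i) x)"
    by (rule summable_comparison_test'[OF _ norm_diff_hess[OF \<zeta>(1) x0 \<zeta>(3,4) DN]])
       (intro summable_mult2 summable_mult N)
  thus ?thesis unfolding G_dxx_def pd_G_term(2)[OF \<zeta>(1) x0 le] pd_Ups(2)[OF x0] diff_hess_def
    by (intro self_adjoint_add self_adjoint_scaleR self_adjoint_suminf self_adjoint_hess6)
qed

lemma conv_Ups:
  assumes "conv xs x"
  shows "(\<lambda>n. Ups (xs n)) \<longlonglongrightarrow> Ups x"
proof -
  note c = convD[OF assms]
  \<comment> \<open>\<open>Ups\<close> is the gauge to the zero path without its time term, so its
    continuity is inherited from the gauge.\<close>
  have e: "Ups y = Ups_bar S y zero_path - (fst y)\<^sup>2" if "y \<in> Lam T 0" for y :: "'h path"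
  proof -
    have "0 \<le> fst y" using that by (simp add: Lam_iff)
    thus ?thesis
      using Ups_pdiff_flow[OF zero_path_Lam that] Ups_bar_eq[OF that zero_path_Lam]
      by (simp add: pdiff_zero_path that max_def D_sym)
  qed
  have "(\<lambda>n. Ups_bar S (xs n) zero_path - (fst (xs n))\<^sup>2) \<longlonglongrightarrow> Ups_bar S x zero_path - (fst x)\<^sup>2"
    by (intro tendsto_intros conv_Ups_bar assms zero_path_Lam c)
  thus ?thesis using c by (simp add: e)
qed

lemma conv_endpt:
  assumes "conv xs x"
  shows "(\<lambda>n. endpt (xs n)) \<longlonglongrightarrow> endpt x"
proof -
  note c = convD[OF assms]
  have "(\<lambda>n. E (xs n) (fst (xs n))) \<longlonglongrightarrow> E x (fst x)"
    using c by (intro conv_E assms) (auto simp: Lam_iff)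
  thus ?thesis using c by (simp add: E_endpt)
qed

text \<open>The perturbation centred at \<open>y n i\<close> contributes at most a constant times \<open>D (y n i) (xs n)\<^sup>m\<close>
  to the derivatives at \<open>xs n\<close>, so it disappears in the limit.\<close>

lemma tendsto_woven_terms:
  fixes \<Phi> :: "real \<Rightarrow> real \<Rightarrow> 'h path \<Rightarrow> 'h path \<Rightarrow> 'b::banach"
  assumes xs: "conv xs x"
    and cont: "\<And>a b \<eta>. \<eta> \<in> Lam T 0 \<Longrightarrow> (\<lambda>n. \<Phi> a b \<eta> (xs n)) \<longlonglongrightarrow> \<Phi> a b \<eta> x"
    and bound: "\<And>a b \<eta> x B. \<eta> \<in> Lam T 0 \<Longrightarrow> x \<in> Lam T 0 \<Longrightarrow> 0 \<le> a \<Longrightarrow> 0 \<le> b \<Longrightarrow> D \<eta> x \<le> B \<Longrightarrow>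
      norm (\<Phi> a b \<eta> x) \<le> C * (a + b) * B ^ m" and m: "0 < m"
    and \<zeta>: "\<And>i. \<zeta> i \<in> Lam T 0" "\<And>i. pnorm (\<zeta> i) \<le> N"
    and \<delta>: "\<And>i. 0 \<le> \<delta> i" "\<And>i. 0 \<le> \<delta>' i" "summable (\<lambda>i. \<delta> i + \<delta>' i)"
    and y: "\<And>n i. y n i \<in> Lam T 0" "\<And>n i. D (y n i) (xs n) \<le> \<rho> n" "\<rho> \<longlonglongrightarrow> 0"
  shows "(\<lambda>n. \<Sum>k. weave (\<lambda>i. \<Phi> (\<delta> i) (\<delta>' i) (\<zeta> i) (xs n)) (\<lambda>i. \<Phi> ((1 / 2) ^ i) 0 (y n i) (xs n)) k)
    \<longlonglongrightarrow> (\<Sum>i. \<Phi> (\<delta> i) (\<delta>' i) (\<zeta> i) x)"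
proof -
  note c = convD[OF xs]
  obtain P where P: "\<And>n. pnorm (xs n) \<le> P" using conv_pnorm_bounded[OF xs] by blast
  have DB: "D (\<zeta> i) (xs n) \<le> N + P" for i n
    using D_le_pnorm[OF \<zeta>(1) c(1), of i n] \<zeta>(2)[of i] P[of n] by simp
  obtain R where "\<And>n. norm (\<rho> n) \<le> R"
    using convergent_imp_Bseq[OF convergentI[OF y(3)]] unfolding Bseq_def by blast
  hence R: "D (y n i) (xs n) \<le> R" for n i
    using y(2)[of n i] abs_ge_self[of "\<rho> n"] order_trans by (metis real_norm_def)
  have bndy: "norm (\<Phi> ((1 / 2) ^ i) 0 (y n i) (xs n)) \<le> C * ((1 / 2) ^ i + 0) * B ^ m" if "D (y n i) (xs n) \<le> B" for n i B
    using that by (intro bound y c) auto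
  show ?thesis
  proof (rule tendsto_suminf_weave[OF cont[OF \<zeta>(1)] _ bound[OF \<zeta>(1) c(1) \<delta>(1,2) DB] bndy[OF R]])
    have "(\<lambda>n. C * ((1 / 2) ^ i + 0) * \<rho> n ^ m) \<longlonglongrightarrow> C * ((1 / 2) ^ i + 0) * 0 ^ m" for i
      by (intro tendsto_intros y)
    hence z: "(\<lambda>n. C * ((1 / 2) ^ i + 0) * \<rho> n ^ m) \<longlonglongrightarrow> 0" for i using m by (simp add: power_0_left)
    show "(\<lambda>n. \<Phi> ((1 / 2) ^ i) 0 (y n i) (xs n)) \<longlonglongrightarrow> 0" for i
      by (rule Lim_null_comparison[OF always_eventually z[of i]]) (use bndy[OF y(2)] in blast)
    show "summable (\<lambda>i. C * (\<delta> i + \<delta>' i) * (N + P) ^ m)" by (intro summable_mult2 summable_mult \<delta>)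
    show "summable (\<lambda>i. C * ((1 / 2) ^ i + 0) * R ^ m)"
      unfolding add_0_right by (intro summable_mult2 summable_mult summable_geometric) simp
  qed
qed

lemma perturbed_derivatives:
  assumes G: "G_rep T S t g h h' \<delta> \<delta>' \<zeta>" and t: "0 \<le> t" and x: "fst x = t"
    and xs: "conv xs x" "\<And>n. t \<le> fst (xs n)"
    and y: "\<And>n i. y n i \<in> Lam T t" "\<And>n i. fst (y n i) \<le> fst (xs n)" "\<And>n i. D (y n i) (xs n) \<le> \<rho> n" "\<rho> \<longlonglongrightarrow> 0"
  shows "(\<lambda>n. G_dt h' (weave \<delta> (\<lambda>i. (1 / 2) ^ i)) (weave \<zeta> (y n)) (xs n)) \<longlonglongrightarrow> G_dt h' \<delta> \<zeta> x"
    and "(\<lambda>n. G_dx S h (weave \<delta> (\<lambda>i. (1 / 2) ^ i)) (weave \<delta>' (\<lambda>_. 0)) (weave \<zeta> (y n)) (xs n)) \<longlonglongrightarrow> G_dx S h \<delta> \<delta>' \<zeta> x"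
    and "(\<lambda>n. G_dxx S h (weave \<delta> (\<lambda>i. (1 / 2) ^ i)) (weave \<delta>' (\<lambda>_. 0)) (weave \<zeta> (y n)) (xs n)) \<longlonglongrightarrow> G_dxx S h \<delta> \<delta>' \<zeta> x"
proof -
  note c = convD[OF xs(1)]
  have tT: "t \<le> T" using c(2) x by (simp add: Lam_iff)
  note \<zeta> = G_rep_path[OF G tT]
  obtain N where N: "0 < N" "\<And>i. pnorm (\<zeta> i) \<le> N" "summable (\<lambda>i. \<delta> i + \<delta>' i)"
    using G_rep_bounds[OF G] by blast
  have y0: "y n i \<in> Lam T 0" for n i using y(1) Lam_mono[OF t] by blast
  have xsT: "fst (xs n) \<in> {0..T}" "fst x \<in> {0..T}" for n using c(1)[of n] c(2) by (auto simp: Lam_iff)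
  have h: "continuous_on {0..T} h" "continuous_on {0..T} h'"
    using G by (auto simp: G_rep_def intro!: DERIV_continuous_on)
  have lim_h: "(\<lambda>n. h (fst (xs n))) \<longlonglongrightarrow> h (fst x)" "(\<lambda>n. h' (fst (xs n))) \<longlonglongrightarrow> h' (fst x)"
    using xsT by (intro continuous_on_tendsto_compose[OF h(1) c(4)] continuous_on_tendsto_compose[OF h(2) c(4)]; simp)+
  have le: "fst (\<zeta> i) \<le> fst (xs n)" "fst (\<zeta> i) \<le> fst x" for i n
    using \<zeta>(2)[of i] xs(2)[of n] x by auto
  have sum_\<delta>: "summable \<delta>"
    using \<zeta>(3,4) by (intro summable_comparison_test'[OF N(3)]) (auto simp: add_increasing2)

  show "(\<lambda>n. G_dt h' (weave \<delta> (\<lambda>i. (1 / 2) ^ i)) (weave \<zeta> (y n)) (xs n)) \<longlonglongrightarrow> G_dt h' \<delta> \<zeta> x"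
    unfolding G_dt_def
  proof (intro tendsto_add tendsto_mult tendsto_const lim_h conv_Ups xs)
    have "(\<lambda>n. \<Sum>k. weave (\<lambda>i. \<delta> i * (fst (xs n) - fst (\<zeta> i))) (\<lambda>i. (1 / 2) ^ i * (fst (xs n) - fst (y n i))) k)
        \<longlonglongrightarrow> (\<Sum>i. \<delta> i * (fst x - fst (\<zeta> i)))"
    proof (rule tendsto_suminf_weave)
      show "(\<lambda>n. \<delta> i * (fst (xs n) - fst (\<zeta> i))) \<longlonglongrightarrow> \<delta> i * (fst x - fst (\<zeta> i))" for i
        by (intro tendsto_intros c)
      \<comment> \<open>The final times of the centres lie between t, the final time of x, and that
        of \<open>xs n\<close>; the time derivatives of the perturbation are thereby squeezed to
        0.\<close>
      have b: "0 \<le> fst (xs n) - fst (y n i)" "fst (xs n) - fst (y n i) \<le> fst (xs n) - fst x" "fst (xs n) - fst (y n i) \<le> T" for n i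
        using y(1)[of n i] y(2)[of n i] x t c(1)[of n] by (auto simp: Lam_iff)
      have "(\<lambda>n. fst (xs n) - fst x) \<longlonglongrightarrow> 0" using c(4) by (simp add: LIM_zero)
      hence "(\<lambda>n. fst (xs n) - fst (y n i)) \<longlonglongrightarrow> 0" for i
        by (rule tendsto_sandwich[OF _ _ tendsto_const, rotated 2]) (use b in auto)
      from tendsto_mult[OF tendsto_const this] show "(\<lambda>n. (1 / 2) ^ i * (fst (xs n) - fst (y n i))) \<longlonglongrightarrow> 0" for i
        by simp
      show "norm ((1 / 2) ^ i * (fst (xs n) - fst (y n i))) \<le> T * (1 / 2) ^ i" for n i
        using mult_right_mono[of "fst (xs n) - fst (y n i)" T "(1 / 2) ^ i"] b(1,3)[of n i] by (simp add: abs_mult mult.commute)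
      show "norm (\<delta> i * (fst (xs n) - fst (\<zeta> i))) \<le> \<delta> i * T" for n i
      proof -
        have "\<bar>fst (xs n) - fst (\<zeta> i)\<bar> \<le> T" using le(1)[of i n] c(1)[of n] \<zeta>(1)[of i] by (auto simp: Lam_iff)
        thus ?thesis using \<zeta>(3)[of i] by (simp add: abs_mult mult_left_mono)
      qed
      show "summable (\<lambda>i. \<delta> i * T)" by (intro summable_mult2 sum_\<delta>)
      show "summable (\<lambda>i. T * (1 / 2) ^ i)" by (intro summable_mult summable_geometric) simp
    qed
    moreover have "weave \<delta> (\<lambda>i. (1 / 2) ^ i) k * (fst (xs n) - fst (weave \<zeta> (y n) k))
        = weave (\<lambda>i. \<delta> i * (fst (xs n) - fst (\<zeta> i))) (\<lambda>i. (1 / 2) ^ i * (fst (xs n) - fst (y n i))) k" for n k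
      by (simp add: weave_def)
    ultimately show "(\<lambda>n. \<Sum>i. weave \<delta> (\<lambda>i. (1 / 2) ^ i) i * (fst (xs n) - fst (weave \<zeta> (y n) i)))
        \<longlonglongrightarrow> (\<Sum>i. \<delta> i * (fst x - fst (\<zeta> i)))"
      by (simp only:)
  qed

  have pd: "pd_x (G_term S (weave \<delta> (\<lambda>i. (1 / 2) ^ i) k) (weave \<delta>' (\<lambda>_. 0) k) (weave \<zeta> (y n) k)) (xs n)
      = weave (\<lambda>i. diff_grad (\<delta> i) (\<delta>' i) (\<zeta> i) (xs n)) (\<lambda>i. diff_grad ((1 / 2) ^ i) 0 (y n i) (xs n)) k"
    "pd_xx (G_term S (weave \<delta> (\<lambda>i. (1 / 2) ^ i) k) (weave \<delta>' (\<lambda>_. 0) k) (weave \<zeta> (y n) k)) (xs n)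
      = weave (\<lambda>i. diff_hess (\<delta> i) (\<delta>' i) (\<zeta> i) (xs n)) (\<lambda>i. diff_hess ((1 / 2) ^ i) 0 (y n i) (xs n)) k" for n k
    by (simp_all add: weave_def pd_G_term \<zeta>(1) c(1) le y0 y(2))
  note lim = conv_diff_grad_hess[OF xs(1)]
  show "(\<lambda>n. G_dx S h (weave \<delta> (\<lambda>i. (1 / 2) ^ i)) (weave \<delta>' (\<lambda>_. 0)) (weave \<zeta> (y n)) (xs n)) \<longlonglongrightarrow> G_dx S h \<delta> \<delta>' \<zeta> x"
    unfolding G_dx_def pd pd_Ups(1)[OF c(1)] pd_Ups(1)[OF c(2)] pd_G_term(1)[OF \<zeta>(1) c(2) le(2)]
    by (intro tendsto_add tendsto_scaleR lim_h lim zero_path_Lam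
        tendsto_woven_terms[OF xs(1) lim(1) norm_diff_grad _ \<zeta>(1) N(2) \<zeta>(3,4) N(3) y0 y(3,4)]) auto
  show "(\<lambda>n. G_dxx S h (weave \<delta> (\<lambda>i. (1 / 2) ^ i)) (weave \<delta>' (\<lambda>_. 0)) (weave \<zeta> (y n)) (xs n)) \<longlonglongrightarrow> G_dxx S h \<delta> \<delta>' \<zeta> x"
    unfolding G_dxx_def pd pd_Ups(2)[OF c(1)] pd_Ups(2)[OF c(2)] pd_G_term(2)[OF \<zeta>(1) c(2) le(2)]
    by (intro tendsto_add tendsto_scaleR lim_h lim zero_path_Lam
        tendsto_woven_terms[OF xs(1) lim(2) norm_diff_hess _ \<zeta>(1) N(2) \<zeta>(3,4) N(3) y0 y(3,4)]) auto
qed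

lemma Phi_ext_continuous:
  assumes "Phi_ext T S A f f'" "0 \<le> t"
  shows "path_continuous T S (Lam T t) f"
proof (rule path_continuousI)
  show sub: "Lam T t \<subseteq> Lam T 0" using Lam_mono[OF assms(2)] by blast
  fix xs x assume xs: "conv xs x" "\<And>n. xs n \<in> Lam T t" and x: "x \<in> Lam T t"
  have hat: "Lam T 0 \<subseteq> (Lam_hat T 0 :: 'h path set)" by (rule Lam_subset_Lam_hat) simp
  have "path_continuous T S (Lam_hat T 0) f'"
    using assms(1) by (simp add: Phi_ext_def C12p_ext_def C12p_hat_def C0p_def)
  hence "(\<lambda>n. f' (xs n)) \<longlonglongrightarrow> f' x"
    by (rule path_continuous_conv[OF _ xs(1)]) (use xs(2) x sub hat in blast)+
  moreover have "f' y = f y" if "y \<in> Lam T 0" for y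
    using assms(1) that by (simp add: Phi_ext_def C12p_ext_def)
  ultimately show "(\<lambda>n. f (xs n)) \<longlonglongrightarrow> f x" using convD[OF xs(1)] by simp
qed

lemma touching_approximation:
  assumes f: "path_continuous T S (Lam T t) f" and t: "0 \<le> t" "t < T"
    and G: "G_rep T S t g h h' \<delta> \<delta>' \<zeta>" and \<gamma>: "\<gamma> \<in> Cpaths t"
    and Vn: "\<And>n. path_continuous T S (Lam T 0) (Vn n)"
    and \<kappa>: "\<And>n \<eta>. \<eta> \<in> Lam T 0 \<Longrightarrow> \<bar>Vn n \<eta> - V \<eta>\<bar> \<le> \<kappa> n" "\<kappa> \<longlonglongrightarrow> 0"
    and touch: "V \<gamma> - f \<gamma> - g \<gamma> = 0" "\<And>\<eta>. \<eta> \<in> Lam T t \<Longrightarrow> V \<eta> - f \<eta> - g \<eta> \<le> 0"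
  obtains xs c gs ys where "conv xs \<gamma>" "\<And>n. t \<le> fst (xs n)"
    "\<And>n. G_rep T S (fst (xs n)) (gs n) h h' (weave \<delta> (\<lambda>i. (1 / 2) ^ i)) (weave \<delta>' (\<lambda>_. 0)) (weave \<zeta> (ys n))"
    "\<And>n. Vn n (xs n) - (f (xs n) + c n) - gs n (xs n) = 0"
    "\<And>n \<eta>. \<eta> \<in> Lam T (fst (xs n)) \<Longrightarrow> Vn n \<eta> - (f \<eta> + c n) - gs n \<eta> \<le> 0"
    "(\<lambda>n. G_dt h' (weave \<delta> (\<lambda>i. (1 / 2) ^ i)) (weave \<zeta> (ys n)) (xs n)) \<longlonglongrightarrow> G_dt h' \<delta> \<zeta> \<gamma>"
    "(\<lambda>n. G_dx S h (weave \<delta> (\<lambda>i. (1 / 2) ^ i)) (weave \<delta>' (\<lambda>_. 0)) (weave \<zeta> (ys n)) (xs n)) \<longlonglongrightarrow> G_dx S h \<delta> \<delta>' \<zeta> \<gamma>"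
    "(\<lambda>n. G_dxx S h (weave \<delta> (\<lambda>i. (1 / 2) ^ i)) (weave \<delta>' (\<lambda>_. 0)) (weave \<zeta> (ys n)) (xs n)) \<longlonglongrightarrow> G_dxx S h \<delta> \<delta>' \<zeta> \<gamma>"
proof -
  have sub: "x \<in> Lam T 0" if "x \<in> Lam T t" for x :: "'h path" using Lam_mono[OF t(1) that] .
  have \<gamma>t: "\<gamma> \<in> Lam T t" "fst \<gamma> = t" using \<gamma> t by (auto simp: Lam_iff Cpaths_iff)
  have \<gamma>0: "\<gamma> \<in> Lam T 0" using \<gamma>t sub by blast
  have \<kappa>0: "0 \<le> \<kappa> n" for n using \<kappa>(1)[OF \<gamma>0, of n] by linarith
  \<comment> \<open>One \<kappa> is lost at the competing point and one at \<gamma>; the last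
    summand makes the tolerance strictly positive, as the variational principle demands.\<close>
  define \<epsilon> where "\<epsilon> n = 2 * \<kappa> n + 1 / real (Suc n)" for n
  have \<epsilon>: "0 < \<epsilon> n" for n using \<kappa>0[of n] unfolding \<epsilon>_def by (intro add_nonneg_pos) auto
  have "\<epsilon> \<longlonglongrightarrow> 2 * 0 + 0"
    unfolding \<epsilon>_def by (intro tendsto_intros \<kappa>(2) LIMSEQ_Suc[OF lim_1_over_n])
  hence \<epsilon>lim: "\<epsilon> \<longlonglongrightarrow> 0" by simp
  define F where "F n \<eta> = Vn n \<eta> - f \<eta> - g \<eta>" for n \<eta>
  have Fc: "path_continuous T S (Lam T t) (F n)" for n
  proof -
    have "path_continuous T S (Lam T t) g" using G by (simp add: G_rep_def C0p_def)
    moreover have "path_continuous T S (Lam T t) (Vn n)"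
      by (rule path_continuous_subset[OF Vn]) (use sub in blast)
    ultimately show ?thesis
      using f unfolding F_def path_continuous_def by (intro ballI tendsto_diff) blast+
  qed
  have opt: "F n x \<le> F n \<gamma> + \<epsilon> n" if "x \<in> Lam T t" for n x
  proof -
    have "\<bar>Vn n x - V x\<bar> \<le> \<kappa> n" "\<bar>Vn n \<gamma> - V \<gamma>\<bar> \<le> \<kappa> n" by (intro \<kappa>(1) sub that \<gamma>0)+
    moreover have "V x - f x - g x \<le> 0" "0 \<le> 1 / real (Suc n)" using touch(2)[OF that] by auto
    ultimately show ?thesis using touch(1) unfolding F_def \<epsilon>_def by linarith
  qed
  define opt_pt where "opt_pt n x ys \<longleftrightarrow> x \<in> Lam T t \<and> (\<forall>i. ys i \<in> Lam T t) \<and> (\<forall>i. fst (ys i) \<le> fst x) \<and>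
    (\<forall>i. Ups_bar S x (ys i) \<le> \<epsilon> n) \<and> ys 0 = \<gamma> \<and>
    (\<forall>y. y \<in> Lam T t \<longrightarrow> fst x \<le> fst y \<longrightarrow> (\<forall>\<^sub>F k in sequentially.
       F n y - (\<Sum>i<k. (1 / 2) ^ i * Ups_bar S y (ys i)) \<le> F n x - (\<Sum>i<k. (1 / 2) ^ i * Ups_bar S x (ys i))))"
    for n x ys
  have "\<exists>x ys. opt_pt n x ys" for n
    unfolding opt_pt_def by (rule path_variational_principle[OF \<gamma>t(1) t(1) \<epsilon> opt Fc]) blast+
  then obtain xs ys where "\<And>n. opt_pt n (xs n) (ys n)" by metis
  hence x: "\<And>n. xs n \<in> Lam T t" and ys: "\<And>n i. ys n i \<in> Lam T t" "\<And>n i. fst (ys n i) \<le> fst (xs n)"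
      "\<And>n i. Ups_bar S (xs n) (ys n i) \<le> \<epsilon> n" "\<And>n. ys n 0 = \<gamma>"
    and max: "\<And>n y. y \<in> Lam T t \<Longrightarrow> fst (xs n) \<le> fst y \<Longrightarrow> \<forall>\<^sub>F k in sequentially.
       F n y - (\<Sum>i<k. (1 / 2) ^ i * Ups_bar S y (ys n i)) \<le> F n (xs n) - (\<Sum>i<k. (1 / 2) ^ i * Ups_bar S (xs n) (ys n i))"
    unfolding opt_pt_def by blast+
  have x0: "xs n \<in> Lam T 0" and y0: "ys n i \<in> Lam T 0" for n i using x ys sub by blast+
  have tx: "t \<le> fst (xs n)" "fst (xs n) \<le> T" for n using x[of n] by (auto simp: Lam_iff)
  \<comment> \<open>The first centre is \<gamma> itself, so the gauge bounds for the centres include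
    the distance from \<open>xs n\<close> to \<gamma>.\<close>
  have xs: "conv xs \<gamma>"
  proof (rule conv_if_Ups_bar[OF x0 \<gamma>0])
    have "Ups_bar S \<gamma> (xs n) \<le> \<epsilon> n" for n using ys(3)[of n 0] Ups_bar_sym[OF x0 \<gamma>0] by (simp add: ys(4))
    thus "(\<lambda>n. Ups_bar S \<gamma> (xs n)) \<longlonglongrightarrow> 0"
      by (intro tendsto_sandwich[OF _ _ tendsto_const \<epsilon>lim]) (auto intro!: always_eventually Ups_bar_nonneg \<gamma>0 x0)
  qed
  \<comment> \<open>The gauge dominates the sixth power of \<open>D\<close>, so the sixth root of
    the tolerance bounds the distance to all centres at once.\<close>
  define \<rho> where "\<rho> n = root 6 (\<epsilon> n)" for n
  have \<rho>: "\<rho> \<longlonglongrightarrow> 0" unfolding \<rho>_def using tendsto_real_root[OF \<epsilon>lim, of 6] by simp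
  have D\<rho>: "D (ys n i) (xs n) \<le> \<rho> n" for n i
  proof -
    have d: "0 \<le> D (xs n) (ys n i)" by (intro D_nonneg x0 y0)
    have "D (xs n) (ys n i) ^ 6 \<le> \<epsilon> n"
      using Ups_bar_bounds(1)[OF x0 y0, of n n i] ys(3)[of n i] zero_le_power2[of "fst (xs n) - fst (ys n i)"] by linarith
    hence "root 6 (D (xs n) (ys n i) ^ 6) \<le> \<rho> n" unfolding \<rho>_def by simp
    thus ?thesis using d by (simp add: real_root_power_cancel D_sym)
  qed
  have N: "pnorm (ys n i) \<le> pnorm (xs n) + \<rho> n" for n i
    using D_triangle[OF zero_path_Lam x0 y0, of n i n] D\<rho>[of n i]
    by (simp add: pnorm_eq_D x0 y0 D_sym[of "ys n i"])
  define gs where "gs n \<eta> = g \<eta> + (\<Sum>i. (1 / 2) ^ i * Ups_bar S \<eta> (ys n i))" for n \<eta>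
  \<comment> \<open>The value of the perturbed difference at its maximum point; added to f, it
    brings the touching value to 0.\<close>
  define c where "c n = Vn n (xs n) - f (xs n) - gs n (xs n)" for n
  show thesis
  proof (rule that[of xs gs ys c])
    show "conv xs \<gamma>" by fact
    show "t \<le> fst (xs n)" for n by (rule tx)
    show "G_rep T S (fst (xs n)) (gs n) h h' (weave \<delta> (\<lambda>i. (1 / 2) ^ i)) (weave \<delta>' (\<lambda>_. 0)) (weave \<zeta> (ys n))" for n
      unfolding gs_def by (rule G_rep_perturb[OF G t(1) tx y0 ys(2) N])
    show "Vn n (xs n) - (f (xs n) + c n) - gs n (xs n) = 0" for n by (simp add: c_def)
    show "Vn n \<eta> - (f \<eta> + c n) - gs n \<eta> \<le> 0" if "\<eta> \<in> Lam T (fst (xs n))" for n \<eta>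
    proof -
      have \<eta>: "\<eta> \<in> Lam T t" "fst (xs n) \<le> fst \<eta>" using that tx(1)[of n] by (auto simp: Lam_iff)
      have s: "(\<lambda>k. \<Sum>i<k. (1 / 2) ^ i * Ups_bar S y (ys n i)) \<longlonglongrightarrow> (\<Sum>i. (1 / 2) ^ i * Ups_bar S y (ys n i))" if "y \<in> Lam T 0" for y
        by (rule summable_LIMSEQ[OF summable_half_Ups_bar[OF that y0 N]])
      have "F n \<eta> - (\<Sum>i. (1 / 2) ^ i * Ups_bar S \<eta> (ys n i)) \<le> F n (xs n) - (\<Sum>i. (1 / 2) ^ i * Ups_bar S (xs n) (ys n i))"
        by (rule tendsto_le[OF _ tendsto_diff[OF tendsto_const s[OF x0]] tendsto_diff[OF tendsto_const s[OF sub[OF \<eta>(1)]]] max[OF \<eta>]]) simp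
      thus ?thesis by (simp add: c_def gs_def F_def)
    qed
  qed (rule perturbed_derivatives[OF G t(1) \<gamma>t(2) xs tx(1) ys(1,2) D\<rho> \<rho>])+
qed

end

section \<open>The Hamiltonian\<close>

text \<open>The expression under the supremum for a single control, with the trace in its bilinear
  form.\<close>

definition Ham_term ::
  "('h path \<Rightarrow> 'u \<Rightarrow> 'h::real_inner) \<Rightarrow> ('h path \<Rightarrow> 'u \<Rightarrow> 'x::real_inner \<Rightarrow>\<^sub>L 'h) \<Rightarrow>
   ('h path \<Rightarrow> real \<Rightarrow> 'x \<Rightarrow> 'u \<Rightarrow> real) \<Rightarrow> 'h path \<Rightarrow> real \<Rightarrow> 'h \<Rightarrow> ('h \<Rightarrow>\<^sub>L 'h) \<Rightarrow> 'u \<Rightarrow> real" where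
  "Ham_term F G q \<gamma> r p l u = p \<bullet> F \<gamma> u + 1 / 2 * hs_inner (G \<gamma> u) (l o\<^sub>L G \<gamma> u)
     + q \<gamma> r (adjoint (blinfun_apply (G \<gamma> u)) p) u"

lemma Ham_eq_SUP:
  fixes G :: "'h::{real_inner,banach} path \<Rightarrow> 'u \<Rightarrow> 'x::{real_inner,banach} \<Rightarrow>\<^sub>L 'h"
  shows "Ham F G q \<gamma> r p l = (SUP u. Ham_term F G q \<gamma> r p l u)"
  unfolding Ham_def Ham_term_def trace_op_eq_hs_inner ..

lemma le_linear_of_square_le:
  fixes a L P :: real
  assumes "a\<^sup>2 \<le> L\<^sup>2 * (1 + P\<^sup>2)" "0 \<le> L" "0 \<le> P"
  shows "a \<le> L * (1 + P)"
proof -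
  have "1 + P\<^sup>2 \<le> (1 + P)\<^sup>2" using assms by (simp add: power2_sum)
  hence "L\<^sup>2 * (1 + P\<^sup>2) \<le> (L * (1 + P))\<^sup>2"
    unfolding power_mult_distrib by (intro mult_left_mono) auto
  hence "a\<^sup>2 \<le> (L * (1 + P))\<^sup>2" using assms(1) by linarith
  thus ?thesis using assms by (intro power2_le_imp_le[of a]) auto
qed

lemma hs_norm_le_diff:
  assumes "hilbert_schmidt M" "hilbert_schmidt N"
  shows "hs_norm M \<le> 2 * hs_norm (M - N) + 2 * hs_norm N"
proof (rule power2_le_imp_le)
  have "(hs_norm M)\<^sup>2 \<le> 2 * (hs_norm (M - N))\<^sup>2 + 2 * (hs_norm N)\<^sup>2"
    using hs_add(2)[OF hs_diff[OF assms] assms(2)] by simp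
  moreover have "0 \<le> hs_norm (M - N) * hs_norm N" by (simp add: hs_norm_nonneg)
  moreover have "(2 * hs_norm (M - N) + 2 * hs_norm N)\<^sup>2
      = 4 * (hs_norm (M - N))\<^sup>2 + 4 * (hs_norm N)\<^sup>2 + 8 * (hs_norm (M - N) * hs_norm N)"
    by (simp add: power2_sum power_mult_distrib)
  ultimately show "(hs_norm M)\<^sup>2 \<le> (2 * hs_norm (M - N) + 2 * hs_norm N)\<^sup>2"
    using zero_le_power2[of "hs_norm (M - N)"] zero_le_power2[of "hs_norm N"] by linarith
qed (simp add: hs_norm_nonneg)

context path_space
begin

lemma hyp_FG_hs: "hyp_FG T S F G \<Longrightarrow> x \<in> Lam T 0 \<Longrightarrow> hilbert_schmidt (G x u)"
  by (simp add: hyp_FG_def)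

lemma hyp_FG_growth:
  fixes F :: "'h path \<Rightarrow> 'u::metric_space \<Rightarrow> 'h"
  assumes "hyp_FG T S F G"
  obtains K where "0 \<le> K" "\<And>x u. x \<in> Lam T 0 \<Longrightarrow> norm (F x u) \<le> K * (1 + pnorm x)"
    "\<And>x u. x \<in> Lam T 0 \<Longrightarrow> hs_norm (G x u) \<le> K * (1 + pnorm x)"
proof -
  obtain L where L: "0 < L" "\<And>t x u. t \<in> {0..T} \<Longrightarrow> x \<in> Cpaths t \<Longrightarrow>
      max ((norm (F x u))\<^sup>2) ((hs_norm (G x u))\<^sup>2) \<le> L\<^sup>2 * (1 + (pnorm x)\<^sup>2)"
    using assms unfolding hyp_FG_def by blast
  have "norm (F x u) \<le> L * (1 + pnorm x) \<and> hs_norm (G x u) \<le> L * (1 + pnorm x)" if x: "x \<in> Lam T 0" for x u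
  proof -
    have "max ((norm (F x u))\<^sup>2) ((hs_norm (G x u))\<^sup>2) \<le> L\<^sup>2 * (1 + (pnorm x)\<^sup>2)"
      by (rule L(2)[of "fst x"]) (use x in \<open>auto simp: Lam_iff Cpaths_iff\<close>)
    thus ?thesis using L(1) pnorm_nonneg[OF x] by (auto intro!: le_linear_of_square_le)
  qed
  thus thesis using that[of L] L(1) by auto
qed

text \<open>The bounds in \<open>hyp_Q_const\<close> and the inner supremum of the convergence
  assumption also range over terminal paths; some such path is needed to extract what they say about
  the other variables.\<close>

lemma const_path: "\<exists>\<eta>. \<eta> \<in> (Cpaths T :: 'h path set)"
  by (intro exI[of _ "(T, \<lambda>\<sigma>\<in>{0..T}. 0)"]) (auto simp: Cpaths_def intro!: continuous_on_eq[OF continuous_on_const])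

lemma hyp_Q_const_bounds:
  fixes q :: "'h path \<Rightarrow> real \<Rightarrow> 'x::real_inner \<Rightarrow> 'u::metric_space \<Rightarrow> real"
  assumes "hyp_Q_const T S L q \<phi>" "x \<in> Lam T 0"
  shows "\<bar>q x y z u\<bar> \<le> L * (1 + pnorm x + \<bar>y\<bar> + norm z)"
    and "\<bar>q x y z u - q x y' z' u\<bar> \<le> L * (\<bar>y - y'\<bar> + norm (z - z'))"
proof -
  obtain \<eta> where \<eta>: "\<eta> \<in> (Cpaths T :: 'h path set)" using const_path by blast
  have x: "fst x \<in> {0..T}" "x \<in> Cpaths (fst x)" using assms(2) by (auto simp: Lam_iff Cpaths_iff)
  have all: "\<forall>t\<in>{0..T}. \<forall>\<gamma>\<in>Cpaths t. \<forall>\<gamma>'\<in>Cpaths t. \<forall>\<eta>\<in>Cpaths T. \<forall>\<eta>'\<in>Cpaths T. \<forall>y y' z z' u.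
        \<bar>q \<gamma> y z u\<bar> \<le> L * (1 + pnorm \<gamma> + \<bar>y\<bar> + norm z) \<and>
        \<bar>q \<gamma> y z u - q \<gamma>' y' z' u\<bar> \<le> L * (pnorm (pdiff \<gamma> \<gamma>') + \<bar>y - y'\<bar> + norm (z - z')) \<and>
        \<bar>\<phi> \<eta> - \<phi> \<eta>'\<bar> \<le> L * pnorm (pdiff \<eta> \<eta>')"
    using assms(1) unfolding hyp_Q_const_def by blast
  have b: "\<bar>q x y z u\<bar> \<le> L * (1 + pnorm x + \<bar>y\<bar> + norm z) \<and>
        \<bar>q x y z u - q x y' z' u\<bar> \<le> L * (pnorm (pdiff x x) + \<bar>y - y'\<bar> + norm (z - z'))"
    using all[rule_format, OF x x(2) \<eta> \<eta>] by blast
  have "pnorm (pdiff x x) = 0" using x(1) by (simp add: pnorm_def pdiff_def)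
  thus "\<bar>q x y z u\<bar> \<le> L * (1 + pnorm x + \<bar>y\<bar> + norm z)"
    "\<bar>q x y z u - q x y' z' u\<bar> \<le> L * (\<bar>y - y'\<bar> + norm (z - z'))" using b by auto
qed

text \<open>\<open>Ham\<close> is a real supremum, which exceeds its terms only when these are
  bounded above; linear growth of the coefficients gives a bound uniform in the control.\<close>

lemma bdd_above_Ham_term:
  fixes F :: "'h path \<Rightarrow> 'u::metric_space \<Rightarrow> 'h" and G :: "'h path \<Rightarrow> 'u \<Rightarrow> 'x::{real_inner,banach} \<Rightarrow>\<^sub>L 'h"
  assumes FG: "hyp_FG T S F G" and Q: "hyp_Q_const T S L q \<phi>" "0 \<le> L" and x: "x \<in> Lam T 0"
  shows "bdd_above (range (Ham_term F G q x r p l))"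
proof -
  obtain K where K: "0 \<le> K" "\<And>u. norm (F x u) \<le> K * (1 + pnorm x)" "\<And>u. hs_norm (G x u) \<le> K * (1 + pnorm x)"
    using hyp_FG_growth[OF FG] x by metis
  define B where "B = K * (1 + pnorm x)"
  have B: "0 \<le> B" using K(1) pnorm_nonneg[OF x] by (simp add: B_def)
  have "Ham_term F G q x r p l u \<le> norm p * B + 1 / 2 * (B * (norm l * B)) + L * (1 + pnorm x + \<bar>r\<bar> + B * norm p)" for u
  proof -
    note hs = hyp_FG_hs[OF FG x, of u]
    have "p \<bullet> F x u \<le> norm p * norm (F x u)" by (rule norm_cauchy_schwarz)
    also have "\<dots> \<le> norm p * B" using K by (intro mult_left_mono) (auto simp: B_def)
    finally have 1: "p \<bullet> F x u \<le> norm p * B" .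
    have "hs_inner (G x u) (l o\<^sub>L G x u) \<le> hs_norm (G x u) * hs_norm (l o\<^sub>L G x u)"
      using hs_inner_bound[OF hs hs_compose(1)[OF hs, of l]] by linarith
    also have "\<dots> \<le> B * (norm l * B)"
      using K(3)[of u] B by (intro mult_mono order_trans[OF hs_compose(2)[OF hs]] mult_left_mono hs_norm_nonneg) (auto simp: B_def)
    finally have 2: "hs_inner (G x u) (l o\<^sub>L G x u) \<le> B * (norm l * B)" .
    have "norm (adjoint (blinfun_apply (G x u)) p) \<le> B * norm p"
      using norm_adjoint_le[OF hs, of p] mult_right_mono[OF K(3)[of u] norm_ge_zero[of p]] unfolding B_def by linarith
    hence "L * (1 + pnorm x + \<bar>r\<bar> + norm (adjoint (blinfun_apply (G x u)) p)) \<le> L * (1 + pnorm x + \<bar>r\<bar> + B * norm p)"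
      using Q(2) by (intro mult_left_mono) auto
    hence 3: "q x r (adjoint (blinfun_apply (G x u)) p) u \<le> L * (1 + pnorm x + \<bar>r\<bar> + B * norm p)"
      using hyp_Q_const_bounds(1)[OF Q(1) x, of r "adjoint (blinfun_apply (G x u)) p" u] by linarith
    show ?thesis unfolding Ham_term_def using 1 2 3 by linarith
  qed
  thus ?thesis by (intro bdd_aboveI2)
qed

text \<open>For the last term, the arguments of q' are first moved from (r', G'^* p') to (r, G^* p)
  at the cost of L, and only then is q' replaced by q, at a point where their closeness is known.
  The factor 3 B collects 2 B from \<open>hs_norm (G' x u)\<close> and B from
  \<open>hs_norm (G x u)\<close>. The bound is independent of any other data of the control.\<close>

lemma Ham_term_diff:
  fixes F F' :: "'h path \<Rightarrow> 'u::metric_space \<Rightarrow> 'h" and G G' :: "'h path \<Rightarrow> 'u \<Rightarrow> 'x::{real_inner,banach} \<Rightarrow>\<^sub>L 'h"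
  assumes G: "hilbert_schmidt (G x u)" "hilbert_schmidt (G' x u)" and Q: "hyp_Q_const T S L q' \<phi>'" "0 \<le> L"
    and x: "x \<in> Lam T 0" and B: "norm (F x u) \<le> B" "hs_norm (G x u) \<le> B"
    and \<kappa>: "norm (F' x u - F x u) \<le> \<kappa>" "hs_norm (G' x u - G x u) \<le> \<kappa>"
      "\<And>r p. \<bar>q' x r (adjoint (blinfun_apply (G x u)) p) u - q x r (adjoint (blinfun_apply (G x u)) p) u\<bar> \<le> \<kappa>"
  shows "\<bar>Ham_term F' G' q' x r' p' l' u - Ham_term F G q x r p l u\<bar>
    \<le> norm p' * \<kappa> + norm (p' - p) * B
      + 1 / 2 * (norm l' * \<kappa> * (2 * \<kappa> + 3 * B) + norm (l' - l) * B\<^sup>2)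
      + (L * (\<bar>r' - r\<bar> + (\<kappa> * norm p' + B * norm (p' - p))) + \<kappa>)"
proof -
  have B0: "0 \<le> B" and \<kappa>0: "0 \<le> \<kappa>" using B(1) \<kappa>(1) norm_ge_zero order_trans by blast+
  note hD = hs_diff[OF G(2,1)]
  have "p' \<bullet> F' x u - p \<bullet> F x u = p' \<bullet> (F' x u - F x u) + (p' - p) \<bullet> F x u"
    by (simp add: inner_diff_left inner_diff_right)
  moreover have "\<bar>p' \<bullet> (F' x u - F x u)\<bar> \<le> norm p' * \<kappa>"
    by (rule order_trans[OF Cauchy_Schwarz_ineq2 mult_left_mono[OF \<kappa>(1)]]) simp
  moreover have "\<bar>(p' - p) \<bullet> F x u\<bar> \<le> norm (p' - p) * B"
    by (rule order_trans[OF Cauchy_Schwarz_ineq2 mult_left_mono[OF B(1)]]) simp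
  ultimately have 1: "\<bar>p' \<bullet> F' x u - p \<bullet> F x u\<bar> \<le> norm p' * \<kappa> + norm (p' - p) * B" by linarith
  have G': "hs_norm (G' x u) \<le> 2 * \<kappa> + 2 * B"
    using hs_norm_le_diff[OF G(2,1)] B(2) \<kappa>(2) by linarith
  have "norm l' * hs_norm (G' x u - G x u) * (hs_norm (G' x u) + hs_norm (G x u)) \<le> norm l' * \<kappa> * (2 * \<kappa> + 3 * B)"
    using G' B \<kappa> B0 \<kappa>0 hs_norm_nonneg
    by (intro mult_mono mult_left_mono add_nonneg_nonneg mult_nonneg_nonneg) auto
  moreover have "norm (l' - l) * (hs_norm (G x u))\<^sup>2 \<le> norm (l' - l) * B\<^sup>2"
    by (intro mult_left_mono power_mono B hs_norm_nonneg norm_ge_zero)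
  ultimately have 2: "\<bar>hs_inner (G' x u) (l' o\<^sub>L G' x u) - hs_inner (G x u) (l o\<^sub>L G x u)\<bar>
      \<le> norm l' * \<kappa> * (2 * \<kappa> + 3 * B) + norm (l' - l) * B\<^sup>2"
    using hs_trace_diff[OF G, of l' l] by linarith
  let ?z' = "adjoint (blinfun_apply (G' x u)) p'" and ?z = "adjoint (blinfun_apply (G x u)) p"
  have "?z' - ?z = adjoint (blinfun_apply (G' x u - G x u)) p' + adjoint (blinfun_apply (G x u)) (p' - p)"
    by (simp add: adjoint_blinfun_diff adjoint_blinfun_vec_diff)
  hence "norm (?z' - ?z) \<le> norm (adjoint (blinfun_apply (G' x u - G x u)) p') + norm (adjoint (blinfun_apply (G x u)) (p' - p))"
    by (metis norm_triangle_ineq)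
  also have "\<dots> \<le> \<kappa> * norm p' + B * norm (p' - p)"
    by (intro add_mono order_trans[OF norm_adjoint_le[OF hD] mult_right_mono[OF \<kappa>(2)]]
        order_trans[OF norm_adjoint_le[OF G(1)] mult_right_mono[OF B(2)]] norm_ge_zero)
  finally have "L * (\<bar>r' - r\<bar> + norm (?z' - ?z)) \<le> L * (\<bar>r' - r\<bar> + (\<kappa> * norm p' + B * norm (p' - p)))"
    using Q(2) by (intro mult_left_mono) auto
  hence 3: "\<bar>q' x r' ?z' u - q x r ?z u\<bar> \<le> L * (\<bar>r' - r\<bar> + (\<kappa> * norm p' + B * norm (p' - p))) + \<kappa>"
    using hyp_Q_const_bounds(2)[OF Q(1) x, of r' ?z' u r ?z] \<kappa>(3)[of r p] by linarith
  have split: "\<bar>a + 1 / 2 * b + c - (a' + 1 / 2 * b' + c')\<bar> \<le> A + 1 / 2 * B + C"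
    if "\<bar>a - a'\<bar> \<le> A" "\<bar>b - b'\<bar> \<le> B" "\<bar>c - c'\<bar> \<le> C" for a b c a' b' c' A B C :: real
    using that by linarith
  show ?thesis unfolding Ham_term_def by (rule split[OF 1 2 3])
qed

text \<open>Continuity for each control, without uniformity, makes the supremum lower
  semicontinuous; this is the direction that the supersolution inequality uses.\<close>

lemma Ham_term_continuous:
  fixes F :: "'h path \<Rightarrow> 'u::metric_space \<Rightarrow> 'h" and G :: "'h path \<Rightarrow> 'u \<Rightarrow> 'x::{real_inner,banach} \<Rightarrow>\<^sub>L 'h"
  assumes FG: "hyp_FG T S F G" and Q: "hyp_Q_const T S L q \<phi>" and xs: "conv xs x"
  shows "(\<lambda>n. Ham_term F G q (xs n) r p l u) \<longlonglongrightarrow> Ham_term F G q x r p l u"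
proof -
  note c = convD[OF xs]
  have xs': "filterlim xs (path_nhds T S (Lam T 0) x) sequentially"
    using xs by (intro filterlim_path_nhds) (auto simp: conv_def)
  have u: "filterlim (\<lambda>n. u) (nhds u) sequentially" by simp
  note xu = filterlim_Pair[OF xs' u]
  have "((\<lambda>(\<eta>, u'). F \<eta> u') \<longlongrightarrow> F x u) (path_nhds T S (Lam T 0) x \<times>\<^sub>F nhds u)"
    "((\<lambda>(\<eta>, u'). hs_norm (G \<eta> u' - G x u)) \<longlongrightarrow> 0) (path_nhds T S (Lam T 0) x \<times>\<^sub>F nhds u)"
    using FG c(2) by (auto simp: hyp_FG_def)
  from this[THEN filterlim_compose, OF xu]
  have F: "(\<lambda>n. F (xs n) u) \<longlonglongrightarrow> F x u" and G: "(\<lambda>n. hs_norm (G (xs n) u - G x u)) \<longlonglongrightarrow> 0" by simp_all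
  note hs = hyp_FG_hs[OF FG c(1), of _ u] hyp_FG_hs[OF FG c(2), of u]
  have hsle: "hs_norm (G (xs n) u) \<le> 2 * hs_norm (G (xs n) u - G x u) + 2 * hs_norm (G x u)" for n
    by (rule hs_norm_le_diff[OF hs])
  have tr: "(\<lambda>n. hs_inner (G (xs n) u) (l o\<^sub>L G (xs n) u)) \<longlonglongrightarrow> hs_inner (G x u) (l o\<^sub>L G x u)"
  proof (rule LIM_zero_cancel, rule Lim_null_comparison)
    show "\<forall>\<^sub>F n in sequentially. norm (hs_inner (G (xs n) u) (l o\<^sub>L G (xs n) u) - hs_inner (G x u) (l o\<^sub>L G x u))
       \<le> norm l * hs_norm (G (xs n) u - G x u) * (2 * hs_norm (G (xs n) u - G x u) + 3 * hs_norm (G x u))"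
    proof (intro always_eventually allI)
      fix n
      have "norm l * hs_norm (G (xs n) u - G x u) * (hs_norm (G (xs n) u) + hs_norm (G x u))
          \<le> norm l * hs_norm (G (xs n) u - G x u) * (2 * hs_norm (G (xs n) u - G x u) + 3 * hs_norm (G x u))"
        using hsle[of n] hs_norm_nonneg by (intro mult_left_mono mult_nonneg_nonneg) auto
      thus "norm (hs_inner (G (xs n) u) (l o\<^sub>L G (xs n) u) - hs_inner (G x u) (l o\<^sub>L G x u))
       \<le> norm l * hs_norm (G (xs n) u - G x u) * (2 * hs_norm (G (xs n) u - G x u) + 3 * hs_norm (G x u))"
        using hs_trace_diff[OF hs(2,1), of n l l] by simp
    qed
    have "(\<lambda>n. norm l * hs_norm (G (xs n) u - G x u) * (2 * hs_norm (G (xs n) u - G x u) + 3 * hs_norm (G x u)))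
       \<longlonglongrightarrow> norm l * 0 * (2 * 0 + 3 * hs_norm (G x u))"
      by (intro tendsto_intros G)
    thus "(\<lambda>n. norm l * hs_norm (G (xs n) u - G x u) * (2 * hs_norm (G (xs n) u - G x u) + 3 * hs_norm (G x u))) \<longlonglongrightarrow> 0"
      by simp
  qed
  have z: "(\<lambda>n. adjoint (blinfun_apply (G (xs n) u)) p) \<longlonglongrightarrow> adjoint (blinfun_apply (G x u)) p"
  proof (rule LIM_zero_cancel, rule Lim_null_comparison)
    show "\<forall>\<^sub>F n in sequentially. norm (adjoint (blinfun_apply (G (xs n) u)) p - adjoint (blinfun_apply (G x u)) p)
        \<le> hs_norm (G (xs n) u - G x u) * norm p"
      using norm_adjoint_le[OF hs_diff[OF hs]] by (simp add: adjoint_blinfun_diff)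
    show "(\<lambda>n. hs_norm (G (xs n) u - G x u) * norm p) \<longlonglongrightarrow> 0"
      using tendsto_mult_left_zero[OF G] .
  qed
  have "((\<lambda>(\<eta>, y', z', u'). q \<eta> y' z' u') \<longlongrightarrow> q x r (adjoint (blinfun_apply (G x u)) p) u)
          (path_nhds T S (Lam T 0) x \<times>\<^sub>F nhds r \<times>\<^sub>F nhds (adjoint (blinfun_apply (G x u)) p) \<times>\<^sub>F nhds u)"
    using Q c(2) by (simp add: hyp_Q_const_def)
  moreover have "filterlim (\<lambda>n. (xs n, r, adjoint (blinfun_apply (G (xs n) u)) p, u))
     (path_nhds T S (Lam T 0) x \<times>\<^sub>F nhds r \<times>\<^sub>F nhds (adjoint (blinfun_apply (G x u)) p) \<times>\<^sub>F nhds u) sequentially"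
    by (intro filterlim_Pair xs' z u) simp
  ultimately have "(\<lambda>n. q (xs n) r (adjoint (blinfun_apply (G (xs n) u)) p) u) \<longlonglongrightarrow> q x r (adjoint (blinfun_apply (G x u)) p) u"
    by (auto dest: filterlim_compose)
  thus ?thesis unfolding Ham_term_def by (intro tendsto_intros F tr)
qed

end

section \<open>Stability\<close>

lemma SUP_zero_iff:
  fixes w :: "'i \<Rightarrow> real"
  assumes "x \<in> X" "w x = 0"
  shows "0 = (SUP y\<in>X. ereal (w y)) \<longleftrightarrow> (\<forall>y\<in>X. w y \<le> 0)"
proof
  assume 0: "0 = (SUP y\<in>X. ereal (w y))"
  show "\<forall>y\<in>X. w y \<le> 0"
  proof
    fix y assume "y \<in> X"
    hence "ereal (w y) \<le> 0" unfolding 0 by (rule SUP_upper)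
    thus "w y \<le> 0" by simp
  qed
next
  assume "\<forall>y\<in>X. w y \<le> 0"
  hence "(SUP y\<in>X. ereal (w y)) \<le> 0" by (intro SUP_least) simp
  moreover have "ereal (w x) \<le> (SUP y\<in>X. ereal (w y))" by (rule SUP_upper) fact
  ultimately show "0 = (SUP y\<in>X. ereal (w y))" using assms(2) by (simp add: zero_ereal_def)
qed

lemma INF_zero_iff:
  fixes w :: "'i \<Rightarrow> real"
  assumes "x \<in> X" "w x = 0"
  shows "0 = (INF y\<in>X. ereal (w y)) \<longleftrightarrow> (\<forall>y\<in>X. 0 \<le> w y)"
proof
  assume 0: "0 = (INF y\<in>X. ereal (w y))"
  show "\<forall>y\<in>X. 0 \<le> w y"
  proof
    fix y assume "y \<in> X"
    hence "0 \<le> ereal (w y)" unfolding 0 by (rule INF_lower)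
    thus "0 \<le> w y" by simp
  qed
next
  assume "\<forall>y\<in>X. 0 \<le> w y"
  hence "0 \<le> (INF y\<in>X. ereal (w y))" by (intro INF_greatest) simp
  moreover have "(INF y\<in>X. ereal (w y)) \<le> ereal (w x)" by (rule INF_lower) fact
  ultimately show "0 = (INF y\<in>X. ereal (w y))" using assms(2) by (simp add: zero_ereal_def)
qed

lemma viscosity_subsolutionD:
  assumes vis: "viscosity_subsolution T S A F G q \<phi> w"
    and \<gamma>: "\<gamma> \<in> Cpaths t" "Phi_ext T S A f f'" "0 \<le> t" "t < T" "G_rep T S t g h h' \<delta> \<delta>' \<zeta>"
    and touch: "w \<gamma> = f \<gamma> + g \<gamma>" "\<And>\<eta>. \<eta> \<in> Lam T t \<Longrightarrow> w \<eta> \<le> f \<eta> + g \<eta>"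
  shows "0 \<le> pd_t T f' \<gamma> + G_dt h' \<delta> \<zeta> \<gamma> + adj_op A (pd_x f' \<gamma>) \<bullet> endpt \<gamma>
    + Ham F G q \<gamma> (w \<gamma>) (pd_x f' \<gamma> + G_dx S h \<delta> \<delta>' \<zeta> \<gamma>) (pd_xx f' \<gamma> + G_dxx S h \<delta> \<delta>' \<zeta> \<gamma>)"
proof -
  have \<gamma>t: "\<gamma> \<in> Lam T t" using \<gamma>(1,4) by (auto simp: Lam_def)
  have "0 = w \<gamma> - f \<gamma> - g \<gamma>" using touch(1) by simp
  moreover have "0 = (SUP \<eta>\<in>Lam T t. ereal (w \<eta> - f \<eta> - g \<eta>))"
    using touch by (subst SUP_zero_iff[OF \<gamma>t]) (auto simp: algebra_simps)
  ultimately show ?thesis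
    using vis[unfolded viscosity_subsolution_def, THEN conjunct2, THEN conjunct2, rule_format, OF \<gamma>] touch(1) by simp
qed

text \<open>Stated for - w touched from above by f + g, so that both cases can be passed to the
  limit by the same argument.\<close>

lemma viscosity_supersolutionD:
  assumes vis: "viscosity_supersolution T S A F G q \<phi> w"
    and \<gamma>: "\<gamma> \<in> Cpaths t" "Phi_ext T S A f f'" "0 \<le> t" "t < T" "G_rep T S t g h h' \<delta> \<delta>' \<zeta>"
    and touch: "- w \<gamma> = f \<gamma> + g \<gamma>" "\<And>\<eta>. \<eta> \<in> Lam T t \<Longrightarrow> - w \<eta> \<le> f \<eta> + g \<eta>"
  shows "Ham F G q \<gamma> (w \<gamma>) (- (pd_x f' \<gamma> + G_dx S h \<delta> \<delta>' \<zeta> \<gamma>)) (- (pd_xx f' \<gamma> + G_dxx S h \<delta> \<delta>' \<zeta> \<gamma>))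
    \<le> pd_t T f' \<gamma> + G_dt h' \<delta> \<zeta> \<gamma> + adj_op A (pd_x f' \<gamma>) \<bullet> endpt \<gamma>"
proof -
  have \<gamma>t: "\<gamma> \<in> Lam T t" using \<gamma>(1,4) by (auto simp: Lam_def)
  have w: "w \<gamma> = - (f \<gamma> + g \<gamma>)" using touch(1) by simp
  have "0 = w \<gamma> + f \<gamma> + g \<gamma>" using w by simp
  moreover have "0 \<le> w \<eta> + f \<eta> + g \<eta>" if "\<eta> \<in> Lam T t" for \<eta> using touch(2)[OF that] by simp
  hence "0 = (INF \<eta>\<in>Lam T t. ereal (w \<eta> + f \<eta> + g \<eta>))"
    using w by (subst INF_zero_iff[OF \<gamma>t]) auto
  ultimately show ?thesis
    using vis[unfolded viscosity_supersolution_def, THEN conjunct2, THEN conjunct2, rule_format, OF \<gamma>] by (simp add: w)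
qed

context path_space
begin

lemma Phi_ext_limits:
  assumes f: "Phi_ext T S A f f'" and xs: "conv xs x"
  shows "(\<lambda>n. pd_t T f' (xs n)) \<longlonglongrightarrow> pd_t T f' x" "(\<lambda>n. pd_x f' (xs n)) \<longlonglongrightarrow> pd_x f' x"
    "(\<lambda>n. pd_xx f' (xs n)) \<longlonglongrightarrow> pd_xx f' x" "(\<lambda>n. adj_op A (pd_x f' (xs n))) \<longlonglongrightarrow> adj_op A (pd_x f' x)"
    "self_adjoint (pd_xx f' x)"
proof -
  note c = convD[OF xs]
  have hat: "Lam T 0 \<subseteq> (Lam_hat T 0 :: 'h path set)" by (rule Lam_subset_Lam_hat) simp
  have pc: "path_continuous T S (Lam_hat T 0) (pd_t T f')" "path_continuous T S (Lam_hat T 0) (pd_x f')"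
    "path_continuous T S (Lam_hat T 0) (pd_xx f')" "path_continuous T S (Lam T 0) (\<lambda>\<gamma>. adj_op A (pd_x f' \<gamma>))"
    using f by (auto simp: Phi_ext_def C12p_ext_def C12p_hat_def C0p_def)
  have h: "\<And>n. xs n \<in> Lam_hat T 0" "x \<in> Lam_hat T 0" using c hat by blast+
  show "(\<lambda>n. pd_t T f' (xs n)) \<longlonglongrightarrow> pd_t T f' x" "(\<lambda>n. pd_x f' (xs n)) \<longlonglongrightarrow> pd_x f' x"
    "(\<lambda>n. pd_xx f' (xs n)) \<longlonglongrightarrow> pd_xx f' x"
    using pc(1-3)[THEN path_continuous_conv, OF xs h] by auto
  show "(\<lambda>n. adj_op A (pd_x f' (xs n))) \<longlonglongrightarrow> adj_op A (pd_x f' x)"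
    by (rule path_continuous_conv[OF pc(4) xs c(1,2)])
  obtain l where "self_adjoint l" "has_pd_xx f' l x"
    using f h(2) unfolding Phi_ext_def C12p_ext_def C12p_hat_def by blast
  thus "self_adjoint (pd_xx f' x)" using pd_xx_eqI by blast
qed

text \<open>\<open>R n x r a p l\<close> stands for the viscosity inequality of the \<open>n\<close>-th equation at the point \<open>x\<close>, in
  terms of the value \<open>r\<close>, the time derivative and transport terms \<open>a\<close>, the gradient \<open>p\<close> and the
  Hessian \<open>l\<close>.\<close>

lemma touching_limit:
  fixes R :: "nat \<Rightarrow> 'h path \<Rightarrow> real \<Rightarrow> real \<Rightarrow> 'h \<Rightarrow> ('h \<Rightarrow>\<^sub>L 'h) \<Rightarrow> bool"
  assumes \<gamma>: "\<gamma> \<in> Cpaths t" and Phi: "Phi_ext T S A f f'" and t: "0 \<le> t" "t < T"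
    and G: "G_rep T S t g h h' \<delta> \<delta>' \<zeta>"
    and touch: "V \<gamma> = f \<gamma> + g \<gamma>" "\<And>\<eta>. \<eta> \<in> Lam T t \<Longrightarrow> V \<eta> \<le> f \<eta> + g \<eta>"
    and V: "path_continuous T S (Lam T 0) V" and Vn: "\<And>n. path_continuous T S (Lam T 0) (Vn n)"
    and \<kappa>: "\<And>n \<eta>. \<eta> \<in> Lam T 0 \<Longrightarrow> \<bar>Vn n \<eta> - V \<eta>\<bar> \<le> \<kappa> n" "\<kappa> \<longlonglongrightarrow> 0"
    and R: "\<And>n x t f f' g h h' \<delta> \<delta>' \<zeta>. \<lbrakk>x \<in> Cpaths t; Phi_ext T S A f f'; 0 \<le> t; t < T; G_rep T S t g h h' \<delta> \<delta>' \<zeta>;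
        Vn n x = f x + g x; \<And>\<eta>. \<eta> \<in> Lam T t \<Longrightarrow> Vn n \<eta> \<le> f \<eta> + g \<eta>\<rbrakk> \<Longrightarrow>
      R n x (Vn n x) (pd_t T f' x + G_dt h' \<delta> \<zeta> x + adj_op A (pd_x f' x) \<bullet> endpt x)
        (pd_x f' x + G_dx S h \<delta> \<delta>' \<zeta> x) (pd_xx f' x + G_dxx S h \<delta> \<delta>' \<zeta> x)"
  obtains xs a p l where "conv xs \<gamma>" "\<forall>\<^sub>F n in sequentially. R n (xs n) (Vn n (xs n)) (a n) (p n) (l n)"
    "(\<lambda>n. Vn n (xs n)) \<longlonglongrightarrow> V \<gamma>"
    "a \<longlonglongrightarrow> pd_t T f' \<gamma> + G_dt h' \<delta> \<zeta> \<gamma> + adj_op A (pd_x f' \<gamma>) \<bullet> endpt \<gamma>"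
    "p \<longlonglongrightarrow> pd_x f' \<gamma> + G_dx S h \<delta> \<delta>' \<zeta> \<gamma>" "l \<longlonglongrightarrow> pd_xx f' \<gamma> + G_dxx S h \<delta> \<delta>' \<zeta> \<gamma>"
    "self_adjoint (pd_xx f' \<gamma> + G_dxx S h \<delta> \<delta>' \<zeta> \<gamma>)"
proof -
  let ?\<delta> = "weave \<delta> (\<lambda>i. (1 / 2) ^ i)" and ?\<delta>' = "weave \<delta>' (\<lambda>_. 0)"
  have touch': "V \<gamma> - f \<gamma> - g \<gamma> = 0" "V \<eta> - f \<eta> - g \<eta> \<le> 0" if "\<eta> \<in> Lam T t" for \<eta>
    using touch(1) touch(2)[OF that] by simp_all
  have \<gamma>t: "fst \<gamma> = t" "\<gamma> \<in> Lam T t" using \<gamma> t by (auto simp: Lam_iff Cpaths_iff)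
  obtain xs c gs ys where a: "conv xs \<gamma>" "\<And>n. t \<le> fst (xs n)"
    "\<And>n. G_rep T S (fst (xs n)) (gs n) h h' ?\<delta> ?\<delta>' (weave \<zeta> (ys n))"
    "\<And>n. Vn n (xs n) - (f (xs n) + c n) - gs n (xs n) = 0"
    "\<And>n \<eta>. \<eta> \<in> Lam T (fst (xs n)) \<Longrightarrow> Vn n \<eta> - (f \<eta> + c n) - gs n \<eta> \<le> 0"
    "(\<lambda>n. G_dt h' ?\<delta> (weave \<zeta> (ys n)) (xs n)) \<longlonglongrightarrow> G_dt h' \<delta> \<zeta> \<gamma>"
    "(\<lambda>n. G_dx S h ?\<delta> ?\<delta>' (weave \<zeta> (ys n)) (xs n)) \<longlonglongrightarrow> G_dx S h \<delta> \<delta>' \<zeta> \<gamma>"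
    "(\<lambda>n. G_dxx S h ?\<delta> ?\<delta>' (weave \<zeta> (ys n)) (xs n)) \<longlonglongrightarrow> G_dxx S h \<delta> \<delta>' \<zeta> \<gamma>"
    by (rule touching_approximation[where V = V, OF Phi_ext_continuous[OF Phi t(1)] t G \<gamma> Vn \<kappa> touch'(1)[OF \<gamma>t(2)] touch'(2)]) blast+
  note cv = convD[OF a(1)]
  note L = Phi_ext_limits[OF Phi a(1)]
  have "(\<lambda>n. Vn n (xs n) - V (xs n)) \<longlonglongrightarrow> 0"
    by (rule Lim_null_comparison[OF _ \<kappa>(2)]) (use \<kappa>(1)[OF cv(1)] in simp)
  from tendsto_add[OF this path_continuous_conv[OF V a(1) cv(1,2)]]
  have VV: "(\<lambda>n. Vn n (xs n)) \<longlonglongrightarrow> V \<gamma>" by simp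
  show thesis
  proof (rule that[OF a(1) _ VV])
    \<comment> \<open>The viscosity inequality is available only before T. The final times tend to t
      < T, so all but finitely many points qualify.\<close>
    have "\<forall>\<^sub>F n in sequentially. fst (xs n) < T" using order_tendstoD(2)[OF cv(4)] \<gamma>t t by simp
    thus "\<forall>\<^sub>F n in sequentially. R n (xs n) (Vn n (xs n))
        (pd_t T f' (xs n) + G_dt h' ?\<delta> (weave \<zeta> (ys n)) (xs n) + adj_op A (pd_x f' (xs n)) \<bullet> endpt (xs n))
        (pd_x f' (xs n) + G_dx S h ?\<delta> ?\<delta>' (weave \<zeta> (ys n)) (xs n))
        (pd_xx f' (xs n) + G_dxx S h ?\<delta> ?\<delta>' (weave \<zeta> (ys n)) (xs n))"
    proof eventually_elim
      case (elim n)
      have "xs n \<in> Cpaths (fst (xs n))" "0 \<le> fst (xs n)"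
        using cv(1)[of n] by (auto simp: Lam_iff Cpaths_iff)
      from R[OF this(1) Phi_ext_add_const[OF Phi, of "c n"] this(2) elim a(3)] show ?case
        unfolding pd_add_const using a(4)[of n] a(5)[of _ n] by (simp add: algebra_simps)
    qed
    show "self_adjoint (pd_xx f' \<gamma> + G_dxx S h \<delta> \<delta>' \<zeta> \<gamma>)"
      by (intro self_adjoint_add L self_adjoint_G_dxx[OF G \<gamma>t(2) t(1)])
  qed (intro tendsto_intros L a conv_endpt)+
qed

end

text \<open>A sequence with one rate \<kappa> replaces the family in \<epsilon>. The constant L is
  common to all \<open>qn\<close>, and \<open>qn\<close> is compared with q only at arguments of the
  form G^* p.\<close>

locale approximation = path_space S T
  for S :: "real \<Rightarrow> 'h::{real_inner,banach} \<Rightarrow>\<^sub>L 'h" and T :: real +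
  fixes F :: "'h path \<Rightarrow> 'u::metric_space \<Rightarrow> 'h" and G :: "'h path \<Rightarrow> 'u \<Rightarrow> 'x::{real_inner,banach} \<Rightarrow>\<^sub>L 'h"
    and q :: "'h path \<Rightarrow> real \<Rightarrow> 'x \<Rightarrow> 'u \<Rightarrow> real" and \<phi> v :: "'h path \<Rightarrow> real"
    and Fn :: "nat \<Rightarrow> 'h path \<Rightarrow> 'u \<Rightarrow> 'h" and Gn :: "nat \<Rightarrow> 'h path \<Rightarrow> 'u \<Rightarrow> 'x \<Rightarrow>\<^sub>L 'h"
    and qn :: "nat \<Rightarrow> 'h path \<Rightarrow> real \<Rightarrow> 'x \<Rightarrow> 'u \<Rightarrow> real" and \<phi>n vn :: "nat \<Rightarrow> 'h path \<Rightarrow> real"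
    and L :: real and \<kappa> :: "nat \<Rightarrow> real"
  assumes FG: "hyp_FG T S F G" "\<And>n. hyp_FG T S (Fn n) (Gn n)"
    and Q: "hyp_Q T S q \<phi>" "\<And>n. hyp_Q_const T S L (qn n) (\<phi>n n)" "0 \<le> L"
    and v: "path_continuous T S (Lam T 0) v" "\<And>n. path_continuous T S (Lam T 0) (vn n)"
    and \<kappa>: "\<kappa> \<longlonglongrightarrow> 0"
      "\<And>n \<eta> u. \<eta> \<in> Lam T 0 \<Longrightarrow> norm (Fn n \<eta> u - F \<eta> u) \<le> \<kappa> n"
      "\<And>n \<eta> u. \<eta> \<in> Lam T 0 \<Longrightarrow> hs_norm (Gn n \<eta> u - G \<eta> u) \<le> \<kappa> n"
      "\<And>n \<eta> u r p. \<eta> \<in> Lam T 0 \<Longrightarrow>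
        \<bar>qn n \<eta> r (adjoint (blinfun_apply (G \<eta> u)) p) u - q \<eta> r (adjoint (blinfun_apply (G \<eta> u)) p) u\<bar> \<le> \<kappa> n"
      "\<And>n \<eta>. \<eta> \<in> Cpaths T \<Longrightarrow> \<bar>\<phi>n n \<eta> - \<phi> \<eta>\<bar> \<le> \<kappa> n"
      "\<And>n \<eta>. \<eta> \<in> Lam T 0 \<Longrightarrow> \<bar>vn n \<eta> - v \<eta>\<bar> \<le> \<kappa> n"
begin

text \<open>The error is independent of the control and thus survives the supremum. A convergent
  sequence of paths has bounded norms, so one B bounds the coefficients along it.\<close>

lemma Ham_approx:
  assumes xs: "conv xs x" and lim: "r \<longlonglongrightarrow> r0" "p \<longlonglongrightarrow> p0" "l \<longlonglongrightarrow> l0"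
  obtains e where "e \<longlonglongrightarrow> 0"
    "\<And>n u. \<bar>Ham_term (Fn n) (Gn n) (qn n) (xs n) (r n) (p n) (l n) u - Ham_term F G q (xs n) r0 p0 l0 u\<bar> \<le> e n"
proof -
  note c = convD[OF xs]
  obtain K where K: "0 \<le> K" "\<And>x u. x \<in> Lam T 0 \<Longrightarrow> norm (F x u) \<le> K * (1 + pnorm x)"
    "\<And>x u. x \<in> Lam T 0 \<Longrightarrow> hs_norm (G x u) \<le> K * (1 + pnorm x)"
    using hyp_FG_growth[OF FG(1)] by blast
  obtain P where P: "\<And>n. pnorm (xs n) \<le> P" using conv_pnorm_bounded[OF xs] by blast
  define B where "B = K * (1 + P)"
  have "K * (1 + pnorm (xs n)) \<le> B" for n unfolding B_def using K(1) P by (intro mult_left_mono) auto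
  hence B: "norm (F (xs n) u) \<le> B" "hs_norm (G (xs n) u) \<le> B" for n u
    using K(2,3)[OF c(1)] order_trans by blast+
  define e where "e n = norm (p n) * \<kappa> n + norm (p n - p0) * B
      + 1 / 2 * (norm (l n) * \<kappa> n * (2 * \<kappa> n + 3 * B) + norm (l n - l0) * B\<^sup>2)
      + (L * (\<bar>r n - r0\<bar> + (\<kappa> n * norm (p n) + B * norm (p n - p0))) + \<kappa> n)" for n
  have "e \<longlonglongrightarrow> norm p0 * 0 + norm (p0 - p0) * B
      + 1 / 2 * (norm l0 * 0 * (2 * 0 + 3 * B) + norm (l0 - l0) * B\<^sup>2)
      + (L * (\<bar>r0 - r0\<bar> + (0 * norm p0 + B * norm (p0 - p0))) + 0)"
    unfolding e_def by (intro tendsto_intros lim \<kappa>(1))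
  hence "e \<longlonglongrightarrow> 0" by simp
  moreover have "\<bar>Ham_term (Fn n) (Gn n) (qn n) (xs n) (r n) (p n) (l n) u - Ham_term F G q (xs n) r0 p0 l0 u\<bar> \<le> e n" for n u
    unfolding e_def
    by (rule Ham_term_diff[where L = L and \<phi>' = "\<phi>n n"]) (intro hyp_FG_hs[OF FG(1)] hyp_FG_hs[OF FG(2)] Q(2,3) c B \<kappa>(2-4))+
  ultimately show thesis by (rule that)
qed

lemma bdd_above_range_Ham_term:
  assumes "x \<in> Lam T 0"
  shows "bdd_above (range (Ham_term F G q x r p l))" "bdd_above (range (Ham_term (Fn n) (Gn n) (qn n) x r p l))"
proof -
  obtain L' where "0 < L'" "hyp_Q_const T S L' q \<phi>" using Q(1) unfolding hyp_Q_def by blast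
  thus "bdd_above (range (Ham_term F G q x r p l))" by (intro bdd_above_Ham_term[OF FG(1) _ _ assms]) auto
  show "bdd_above (range (Ham_term (Fn n) (Gn n) (qn n) x r p l))"
    by (rule bdd_above_Ham_term[OF FG(2) Q(2,3) assms])
qed

text \<open>The sign c = 1 or c = - 1 serves the sub- and supersolution cases with one argument; the
  2 counts the errors of the solution and of the terminal datum.\<close>

lemma terminal_le:
  assumes "\<eta> \<in> Cpaths T" "\<And>n. c * vn n \<eta> \<le> c * \<phi>n n \<eta>" "\<bar>c\<bar> = 1"
  shows "c * v \<eta> \<le> c * \<phi> \<eta>"
proof -
  have \<eta>0: "\<eta> \<in> Lam T 0" using assms(1) T by (auto simp: Lam_iff Cpaths_iff)
  have "c * v \<eta> \<le> c * \<phi> \<eta> + 2 * \<kappa> n" for n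
  proof -
    have "\<bar>c * (vn n \<eta> - v \<eta>)\<bar> \<le> \<kappa> n" "\<bar>c * (\<phi>n n \<eta> - \<phi> \<eta>)\<bar> \<le> \<kappa> n"
      using \<kappa>(5)[OF assms(1), of n] \<kappa>(6)[OF \<eta>0, of n] assms(3) by (simp_all add: abs_mult)
    thus ?thesis using assms(2)[of n] unfolding right_diff_distrib by linarith
  qed
  moreover have "(\<lambda>n. c * \<phi> \<eta> + 2 * \<kappa> n) \<longlonglongrightarrow> c * \<phi> \<eta> + 2 * 0" by (intro tendsto_intros \<kappa>)
  ultimately have "c * v \<eta> \<le> c * \<phi> \<eta> + 2 * 0" by (intro LIMSEQ_le_const) auto
  thus ?thesis by simp
qed

lemma viscosity_subsolution_limit:
  assumes H: "\<And>r p l. self_adjoint l \<Longrightarrow> path_continuous T S (Lam T 0) (\<lambda>\<gamma>. Ham F G q \<gamma> r p l)"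
    and vis: "\<And>n. viscosity_subsolution T S A (Fn n) (Gn n) (qn n) (\<phi>n n) (vn n)"
  shows "viscosity_subsolution T S A F G q \<phi> v"
  unfolding viscosity_subsolution_def
proof (intro conjI allI ballI impI)
  show "path_continuous T S (Lam T 0) v" by (rule v)
  show "v \<eta> \<le> \<phi> \<eta>" if "\<eta> \<in> Cpaths T" for \<eta>
    using terminal_le[OF that, of 1] vis that unfolding viscosity_subsolution_def by simp
next
  fix f f' t g h h' \<delta> \<delta>' \<zeta> \<gamma>
  assume \<gamma>: "\<gamma> \<in> Cpaths t" and Phi: "Phi_ext T S A f f'" and t: "0 \<le> t" "t < T"
    and Gr: "G_rep T S t g h h' \<delta> \<delta>' \<zeta>" and touch: "0 = v \<gamma> - f \<gamma> - g \<gamma>"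
    and sup: "0 = (SUP \<eta>\<in>Lam T t. ereal (v \<eta> - f \<eta> - g \<eta>))"
  let ?a = "pd_t T f' \<gamma> + G_dt h' \<delta> \<zeta> \<gamma> + adj_op A (pd_x f' \<gamma>) \<bullet> endpt \<gamma>"
  let ?p = "pd_x f' \<gamma> + G_dx S h \<delta> \<delta>' \<zeta> \<gamma>" and ?l = "pd_xx f' \<gamma> + G_dxx S h \<delta> \<delta>' \<zeta> \<gamma>"
  have \<gamma>t: "\<gamma> \<in> Lam T t" using \<gamma> t by (auto simp: Lam_iff Cpaths_iff)
  have v\<gamma>: "v \<gamma> = f \<gamma> + g \<gamma>" using touch by simp
  have le: "v \<eta> \<le> f \<eta> + g \<eta>" if "\<eta> \<in> Lam T t" for \<eta>
    using SUP_zero_iff[where w = "\<lambda>\<eta>. v \<eta> - f \<eta> - g \<eta>", OF \<gamma>t] v\<gamma> sup that by force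
  obtain xs a p l where xs: "conv xs \<gamma>"
    and ineq: "\<forall>\<^sub>F n in sequentially. 0 \<le> a n + Ham (Fn n) (Gn n) (qn n) (xs n) (vn n (xs n)) (p n) (l n)"
    and lim: "(\<lambda>n. vn n (xs n)) \<longlonglongrightarrow> v \<gamma>" "a \<longlonglongrightarrow> ?a" "p \<longlonglongrightarrow> ?p" "l \<longlonglongrightarrow> ?l"
    and sa: "self_adjoint ?l"
    by (rule touching_limit[where R = "\<lambda>n x r a p l. 0 \<le> a + Ham (Fn n) (Gn n) (qn n) x r p l",
          OF \<gamma> Phi t Gr v\<gamma> le v \<kappa>(6,1) viscosity_subsolutionD[OF vis]])
  obtain e where e: "e \<longlonglongrightarrow> 0" "\<And>n u. \<bar>Ham_term (Fn n) (Gn n) (qn n) (xs n) (vn n (xs n)) (p n) (l n) u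
      - Ham_term F G q (xs n) (v \<gamma>) ?p ?l u\<bar> \<le> e n"
    using Ham_approx[OF xs lim(1,3,4)] by blast
  \<comment> \<open>The value, gradient and Hessian are first frozen at their limits at the cost
    \<open>e n\<close>. Only the path still moves, which is the dependence that \<open>H\<close>
    controls.\<close>
  have "\<forall>\<^sub>F n in sequentially. 0 \<le> a n + (Ham F G q (xs n) (v \<gamma>) ?p ?l + e n)"
    using ineq
  proof eventually_elim
    case (elim n)
    have "Ham (Fn n) (Gn n) (qn n) (xs n) (vn n (xs n)) (p n) (l n) \<le> Ham F G q (xs n) (v \<gamma>) ?p ?l + e n"
    proof (subst Ham_eq_SUP, rule cSUP_least)
      fix u
      have "Ham_term F G q (xs n) (v \<gamma>) ?p ?l u \<le> Ham F G q (xs n) (v \<gamma>) ?p ?l"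
        unfolding Ham_eq_SUP by (rule cSUP_upper[OF UNIV_I bdd_above_range_Ham_term(1)[OF convD(1)[OF xs]]])
      thus "Ham_term (Fn n) (Gn n) (qn n) (xs n) (vn n (xs n)) (p n) (l n) u \<le> Ham F G q (xs n) (v \<gamma>) ?p ?l + e n"
        using e(2)[of n u] by linarith
    qed simp
    thus ?case using elim by linarith
  qed
  moreover have "(\<lambda>n. a n + (Ham F G q (xs n) (v \<gamma>) ?p ?l + e n)) \<longlonglongrightarrow> ?a + (Ham F G q \<gamma> (v \<gamma>) ?p ?l + 0)"
    by (intro tendsto_add lim e path_continuous_conv[OF H[OF sa] xs convD(1,2)[OF xs]])
  ultimately have "0 \<le> ?a + (Ham F G q \<gamma> (v \<gamma>) ?p ?l + 0)"
    by (intro tendsto_lowerbound[where F = sequentially]) auto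
  thus "0 \<le> ?a + Ham F G q \<gamma> (f \<gamma> + g \<gamma>) ?p ?l" by (simp add: v\<gamma>)
qed

lemma viscosity_supersolution_limit:
  assumes vis: "\<And>n. viscosity_supersolution T S A (Fn n) (Gn n) (qn n) (\<phi>n n) (vn n)"
  shows "viscosity_supersolution T S A F G q \<phi> v"
  unfolding viscosity_supersolution_def
proof (intro conjI allI ballI impI)
  show "path_continuous T S (Lam T 0) v" by (rule v)
  show "\<phi> \<eta> \<le> v \<eta>" if "\<eta> \<in> Cpaths T" for \<eta>
    using terminal_le[OF that, of "- 1"] vis that unfolding viscosity_supersolution_def by simp
next
  fix f f' t g h h' \<delta> \<delta>' \<zeta> \<gamma>
  assume \<gamma>: "\<gamma> \<in> Cpaths t" and Phi: "Phi_ext T S A f f'" and t: "0 \<le> t" "t < T"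
    and Gr: "G_rep T S t g h h' \<delta> \<delta>' \<zeta>" and touch: "0 = v \<gamma> + f \<gamma> + g \<gamma>"
    and inf: "0 = (INF \<eta>\<in>Lam T t. ereal (v \<eta> + f \<eta> + g \<eta>))"
  let ?a = "pd_t T f' \<gamma> + G_dt h' \<delta> \<zeta> \<gamma> + adj_op A (pd_x f' \<gamma>) \<bullet> endpt \<gamma>"
  let ?p = "pd_x f' \<gamma> + G_dx S h \<delta> \<delta>' \<zeta> \<gamma>" and ?l = "pd_xx f' \<gamma> + G_dxx S h \<delta> \<delta>' \<zeta> \<gamma>"
  have \<gamma>t: "\<gamma> \<in> Lam T t" using \<gamma> t by (auto simp: Lam_iff Cpaths_iff)
  have v\<gamma>: "- v \<gamma> = f \<gamma> + g \<gamma>" using touch by simp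
  have le: "- v \<eta> \<le> f \<eta> + g \<eta>" if "\<eta> \<in> Lam T t" for \<eta>
    using INF_zero_iff[where w = "\<lambda>\<eta>. v \<eta> + f \<eta> + g \<eta>", OF \<gamma>t] touch inf that by force
  \<comment> \<open>The supersolution is handled by passing to negatives; the value slot then holds
    the negative of \<open>vn\<close>, which accounts for the double minus signs below.\<close>
  have neg: "path_continuous T S (Lam T 0) (\<lambda>x. - w x)" if "path_continuous T S (Lam T 0) w" for w :: "'h path \<Rightarrow> real"
    using that unfolding path_continuous_def by (auto intro: tendsto_minus)
  have \<kappa>6: "\<bar>- vn n \<eta> - - v \<eta>\<bar> \<le> \<kappa> n" if "\<eta> \<in> Lam T 0" for n \<eta>
    using \<kappa>(6)[OF that, of n] by linarith
  obtain xs a p l where xs: "conv xs \<gamma>"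
    and ineq: "\<forall>\<^sub>F n in sequentially. Ham (Fn n) (Gn n) (qn n) (xs n) (- (- vn n (xs n))) (- p n) (- l n) \<le> a n"
    and lim: "(\<lambda>n. - vn n (xs n)) \<longlonglongrightarrow> - v \<gamma>" "a \<longlonglongrightarrow> ?a" "p \<longlonglongrightarrow> ?p" "l \<longlonglongrightarrow> ?l"
  proof (rule touching_limit[where R = "\<lambda>n x r a p l. Ham (Fn n) (Gn n) (qn n) x (- r) (- p) (- l) \<le> a"
        and V = "\<lambda>x. - v x" and Vn = "\<lambda>n x. - vn n x", OF \<gamma> Phi t Gr v\<gamma> le neg[OF v(1)] neg[OF v(2)] \<kappa>6 \<kappa>(1)])
    fix n x t f f' g h h' \<delta> \<delta>' \<zeta>
    assume "x \<in> Cpaths t" "Phi_ext T S A f f'" "0 \<le> t" "t < T" "G_rep T S t g h h' \<delta> \<delta>' \<zeta>"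
      "- vn n x = f x + g x" "\<And>\<eta>. \<eta> \<in> Lam T t \<Longrightarrow> - vn n \<eta> \<le> f \<eta> + g \<eta>"
    thus "Ham (Fn n) (Gn n) (qn n) x (- (- vn n x)) (- (pd_x f' x + G_dx S h \<delta> \<delta>' \<zeta> x)) (- (pd_xx f' x + G_dxx S h \<delta> \<delta>' \<zeta> x))
        \<le> pd_t T f' x + G_dt h' \<delta> \<zeta> x + adj_op A (pd_x f' x) \<bullet> endpt x"
      unfolding minus_minus by (rule viscosity_supersolutionD[OF vis])
  qed
  obtain e where e: "e \<longlonglongrightarrow> 0" "\<And>n u. \<bar>Ham_term (Fn n) (Gn n) (qn n) (xs n) (- (- vn n (xs n))) (- p n) (- l n) u
      - Ham_term F G q (xs n) (- (- v \<gamma>)) (- ?p) (- ?l) u\<bar> \<le> e n"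
    using Ham_approx[OF xs lim(1,3,4)[THEN tendsto_minus]] by blast
  have "Ham_term F G q \<gamma> (v \<gamma>) (- ?p) (- ?l) u \<le> ?a" for u
  proof -
    have "\<forall>\<^sub>F n in sequentially. Ham_term F G q (xs n) (v \<gamma>) (- ?p) (- ?l) u \<le> a n + e n"
      using ineq
    proof eventually_elim
      case (elim n)
      have "Ham_term (Fn n) (Gn n) (qn n) (xs n) (- (- vn n (xs n))) (- p n) (- l n) u
          \<le> Ham (Fn n) (Gn n) (qn n) (xs n) (- (- vn n (xs n))) (- p n) (- l n)"
        unfolding Ham_eq_SUP by (rule cSUP_upper[OF UNIV_I bdd_above_range_Ham_term(2)[OF convD(1)[OF xs]]])
      thus ?case using e(2)[of n u] elim unfolding minus_minus by linarith
    qed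
    moreover obtain L' where "hyp_Q_const T S L' q \<phi>" using Q(1) unfolding hyp_Q_def by blast
    hence "(\<lambda>n. Ham_term F G q (xs n) (v \<gamma>) (- ?p) (- ?l) u) \<longlonglongrightarrow> Ham_term F G q \<gamma> (v \<gamma>) (- ?p) (- ?l) u"
      by (intro Ham_term_continuous[OF FG(1) _ xs])
    ultimately have "Ham_term F G q \<gamma> (v \<gamma>) (- ?p) (- ?l) u \<le> ?a + 0"
      using tendsto_le[OF _ tendsto_add[OF lim(2) e(1)]] by simp
    thus ?thesis by simp
  qed
  hence "Ham F G q \<gamma> (v \<gamma>) (- ?p) (- ?l) \<le> ?a"
    unfolding Ham_eq_SUP by (intro cSUP_least) auto
  moreover have "v \<gamma> = - (f \<gamma> + g \<gamma>)" using touch by simp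
  ultimately show "- pd_t T f' \<gamma> - G_dt h' \<delta> \<zeta> \<gamma> - adj_op A (pd_x f' \<gamma>) \<bullet> endpt \<gamma>
        + Ham F G q \<gamma> (- (f \<gamma> + g \<gamma>)) (- ?p) (- ?l) \<le> 0" by simp
qed

end

text \<open>The subsolution half carries continuity of \<open>Ham\<close> as a premise, because its
  inequality must be passed to the limit under a supremum, for which continuity at each control
  gives only lower semicontinuity. One \<open>L\<close> serves all \<epsilon> because the values of
  the approximating q at moving arguments are compared through it.\<close>

theorem theorem5p5:
  fixes T :: real
    and S :: "real \<Rightarrow> 'h::{real_inner,banach,second_countable_topology} \<Rightarrow>\<^sub>L 'h"
    and A :: "('h \<times> 'h) set"
    and F :: "'h path \<Rightarrow> 'u::metric_space \<Rightarrow> 'h"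
    and G :: "'h path \<Rightarrow> 'u \<Rightarrow> 'x::{real_inner,banach,second_countable_topology} \<Rightarrow>\<^sub>L 'h"
    and q :: "'h path \<Rightarrow> real \<Rightarrow> 'x \<Rightarrow> 'u \<Rightarrow> real"
    and \<phi> v :: "'h path \<Rightarrow> real"
    and F\<^sub>\<epsilon> :: "real \<Rightarrow> 'h path \<Rightarrow> 'u \<Rightarrow> 'h"
    and G\<^sub>\<epsilon> :: "real \<Rightarrow> 'h path \<Rightarrow> 'u \<Rightarrow> 'x \<Rightarrow>\<^sub>L 'h"
    and q\<^sub>\<epsilon> :: "real \<Rightarrow> 'h path \<Rightarrow> real \<Rightarrow> 'x \<Rightarrow> 'u \<Rightarrow> real"
    and \<phi>\<^sub>\<epsilon> v\<^sub>\<epsilon> :: "real \<Rightarrow> 'h path \<Rightarrow> real"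
  assumes "0 < T"
    and "generates A S"
    and "contraction_semigroup S"
    and "hyp_FG T S F G"
    and "hyp_Q T S q \<phi>"
    and "path_continuous T S (Lam T 0) v"
    and "\<forall>\<epsilon>>0. hyp_FG T S (F\<^sub>\<epsilon> \<epsilon>) (G\<^sub>\<epsilon> \<epsilon>)"
    and "\<exists>L>0. \<forall>\<epsilon>>0. hyp_Q_const T S L (q\<^sub>\<epsilon> \<epsilon>) (\<phi>\<^sub>\<epsilon> \<epsilon>)"
    and "\<forall>\<epsilon>>0. path_continuous T S (Lam T 0) (v\<^sub>\<epsilon> \<epsilon>)"
    and "((\<lambda>\<epsilon>. SUP (\<gamma>, x, y, u) \<in> Lam T 0 \<times> UNIV \<times> UNIV \<times> UNIV. SUP \<eta> \<in> Cpaths T.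
            ereal (norm (F\<^sub>\<epsilon> \<epsilon> \<gamma> u - F \<gamma> u) + hs_norm (G\<^sub>\<epsilon> \<epsilon> \<gamma> u - G \<gamma> u)
              + \<bar>q\<^sub>\<epsilon> \<epsilon> \<gamma> x (adjoint (G \<gamma> u) y) u - q \<gamma> x (adjoint (G \<gamma> u) y) u\<bar>
              + \<bar>\<phi>\<^sub>\<epsilon> \<epsilon> \<eta> - \<phi> \<eta>\<bar> + \<bar>v\<^sub>\<epsilon> \<epsilon> \<gamma> - v \<gamma>\<bar>)) \<longlongrightarrow> 0) (at_right 0)"
  shows
    "((\<forall>r p l. self_adjoint l \<longrightarrow> path_continuous T S (Lam T 0) (\<lambda>\<gamma>. Ham F G q \<gamma> r p l)) \<longrightarrow>
      (\<forall>\<epsilon>>0. viscosity_subsolution T S A (F\<^sub>\<epsilon> \<epsilon>) (G\<^sub>\<epsilon> \<epsilon>) (q\<^sub>\<epsilon> \<epsilon>) (\<phi>\<^sub>\<epsilon> \<epsilon>) (v\<^sub>\<epsilon> \<epsilon>)) \<longrightarrow>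
      viscosity_subsolution T S A F G q \<phi> v) \<and>
     ((\<forall>\<epsilon>>0. viscosity_supersolution T S A (F\<^sub>\<epsilon> \<epsilon>) (G\<^sub>\<epsilon> \<epsilon>) (q\<^sub>\<epsilon> \<epsilon>) (\<phi>\<^sub>\<epsilon> \<epsilon>) (v\<^sub>\<epsilon> \<epsilon>)) \<longrightarrow>
      viscosity_supersolution T S A F G q \<phi> v)"
proof -
  interpret path_space S T by unfold_locales fact+
  obtain L where L: "0 < L" "\<And>\<epsilon>. 0 < \<epsilon> \<Longrightarrow> hyp_Q_const T S L (q\<^sub>\<epsilon> \<epsilon>) (\<phi>\<^sub>\<epsilon> \<epsilon>)" using assms(8) by blast
  define \<Delta> where "\<Delta> \<epsilon> \<gamma> x y u \<eta> = norm (F\<^sub>\<epsilon> \<epsilon> \<gamma> u - F \<gamma> u) + hs_norm (G\<^sub>\<epsilon> \<epsilon> \<gamma> u - G \<gamma> u)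
              + \<bar>q\<^sub>\<epsilon> \<epsilon> \<gamma> x (adjoint (G \<gamma> u) y) u - q \<gamma> x (adjoint (G \<gamma> u) y) u\<bar>
              + \<bar>\<phi>\<^sub>\<epsilon> \<epsilon> \<eta> - \<phi> \<eta>\<bar> + \<bar>v\<^sub>\<epsilon> \<epsilon> \<gamma> - v \<gamma>\<bar>" for \<epsilon> \<gamma> x y u \<eta>
  \<comment> \<open>Choosing one \<epsilon> for each n turns the one-sided limit into a sequence
    with the explicit rate 1 / (n + 1).\<close>
  have "\<exists>\<epsilon>>0. \<forall>\<gamma>\<in>Lam T 0. \<forall>x y u. \<forall>\<eta>\<in>Cpaths T. \<Delta> \<epsilon> \<gamma> x y u \<eta> \<le> 1 / real (Suc n)" for n
  proof -
    have "\<forall>\<^sub>F \<epsilon> in at_right 0. (SUP (\<gamma>, x, y, u) \<in> Lam T 0 \<times> UNIV \<times> UNIV \<times> UNIV. SUP \<eta> \<in> Cpaths T. ereal (\<Delta> \<epsilon> \<gamma> x y u \<eta>))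
        < ereal (1 / real (Suc n))"
      using order_tendstoD(2)[OF assms(10), of "ereal (1 / real (Suc n))"] unfolding \<Delta>_def by simp
    moreover have "\<forall>\<^sub>F \<epsilon> in at_right 0. (0::real) < \<epsilon>" by (simp add: eventually_at_right_less)
    ultimately have "\<forall>\<^sub>F \<epsilon> in at_right (0::real). 0 < \<epsilon> \<and> (SUP (\<gamma>, x, y, u) \<in> Lam T 0 \<times> UNIV \<times> UNIV \<times> UNIV. SUP \<eta> \<in> Cpaths T. ereal (\<Delta> \<epsilon> \<gamma> x y u \<eta>))
        < ereal (1 / real (Suc n))" by eventually_elim simp
    then obtain \<epsilon> where \<epsilon>: "0 < \<epsilon>" "(SUP (\<gamma>, x, y, u) \<in> Lam T 0 \<times> UNIV \<times> UNIV \<times> UNIV. SUP \<eta> \<in> Cpaths T. ereal (\<Delta> \<epsilon> \<gamma> x y u \<eta>))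
        < ereal (1 / real (Suc n))"
      using eventually_happens'[OF trivial_limit_at_right_real] by blast
    have "\<Delta> \<epsilon> \<gamma> x y u \<eta> \<le> 1 / real (Suc n)" if "\<gamma> \<in> Lam T 0" "\<eta> \<in> Cpaths T" for \<gamma> x y u \<eta>
    proof -
      have "ereal (\<Delta> \<epsilon> \<gamma> x y u \<eta>) \<le> (SUP \<eta> \<in> Cpaths T. ereal (\<Delta> \<epsilon> \<gamma> x y u \<eta>))"
        by (rule SUP_upper) fact
      also have "\<dots> \<le> (SUP (\<gamma>, x, y, u) \<in> Lam T 0 \<times> UNIV \<times> UNIV \<times> UNIV. SUP \<eta> \<in> Cpaths T. ereal (\<Delta> \<epsilon> \<gamma> x y u \<eta>))"
        by (rule SUP_upper2[of "(\<gamma>, x, y, u)"]) (use that in auto)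
      also note \<epsilon>(2)
      finally show ?thesis by simp
    qed
    thus ?thesis using \<epsilon>(1) by blast
  qed
  then obtain \<epsilon>s where \<epsilon>s: "\<And>n. 0 < \<epsilon>s n"
    and \<Delta>: "\<And>n \<gamma> x y u \<eta>. \<gamma> \<in> Lam T 0 \<Longrightarrow> \<eta> \<in> Cpaths T \<Longrightarrow> \<Delta> (\<epsilon>s n) \<gamma> x y u \<eta> \<le> 1 / real (Suc n)"
    by metis
  have lim: "(\<lambda>n. 1 / real (Suc n)) \<longlonglongrightarrow> 0" by (rule LIMSEQ_Suc[OF lim_1_over_n])
  \<comment> \<open>A fixed terminal path to insert in the inner supremum when bounding the terms
    that do not involve it.\<close>
  obtain \<eta>0 where \<eta>0: "\<eta>0 \<in> (Cpaths T :: 'h path set)" using const_path by blast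
  have bounds: "norm (F\<^sub>\<epsilon> (\<epsilon>s n) \<eta> u - F \<eta> u) \<le> 1 / real (Suc n)"
      "hs_norm (G\<^sub>\<epsilon> (\<epsilon>s n) \<eta> u - G \<eta> u) \<le> 1 / real (Suc n)"
      "\<bar>q\<^sub>\<epsilon> (\<epsilon>s n) \<eta> r (adjoint (blinfun_apply (G \<eta> u)) p) u - q \<eta> r (adjoint (blinfun_apply (G \<eta> u)) p) u\<bar> \<le> 1 / real (Suc n)"
      "\<bar>v\<^sub>\<epsilon> (\<epsilon>s n) \<eta> - v \<eta>\<bar> \<le> 1 / real (Suc n)"
    if "\<eta> \<in> Lam T 0" for n \<eta> u r p
    using \<Delta>[OF that \<eta>0, of n r p u] hs_norm_nonneg[of "G\<^sub>\<epsilon> (\<epsilon>s n) \<eta> u - G \<eta> u"]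
      norm_ge_zero[of "F\<^sub>\<epsilon> (\<epsilon>s n) \<eta> u - F \<eta> u"]
    unfolding \<Delta>_def by linarith+
  have bound_\<phi>: "\<bar>\<phi>\<^sub>\<epsilon> (\<epsilon>s n) \<eta> - \<phi> \<eta>\<bar> \<le> 1 / real (Suc n)" if \<eta>: "\<eta> \<in> Cpaths T" for n \<eta>
  proof -
    have "\<eta> \<in> Lam T 0" using \<eta> T by (auto simp: Lam_iff Cpaths_iff)
    \<comment> \<open>All summands are nonnegative, so arbitrary values of the remaining variables
      do; \<eta> itself serves as the path in \<open>Lam T 0\<close>.\<close>
    from \<Delta>[OF this \<eta>, of n 0 0 undefined] show ?thesis
      using hs_norm_nonneg[of "G\<^sub>\<epsilon> (\<epsilon>s n) \<eta> undefined - G \<eta> undefined"]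
      norm_ge_zero[of "F\<^sub>\<epsilon> (\<epsilon>s n) \<eta> undefined - F \<eta> undefined"]
      unfolding \<Delta>_def by linarith
  qed
  have FG: "hyp_FG T S (F\<^sub>\<epsilon> (\<epsilon>s n)) (G\<^sub>\<epsilon> (\<epsilon>s n))" and Q: "hyp_Q_const T S L (q\<^sub>\<epsilon> (\<epsilon>s n)) (\<phi>\<^sub>\<epsilon> (\<epsilon>s n))"
    and v: "path_continuous T S (Lam T 0) (v\<^sub>\<epsilon> (\<epsilon>s n))" for n
    using assms(7,9) L(2) \<epsilon>s by blast+
  interpret approximation S T F G q \<phi> v "\<lambda>n. F\<^sub>\<epsilon> (\<epsilon>s n)" "\<lambda>n. G\<^sub>\<epsilon> (\<epsilon>s n)" "\<lambda>n. q\<^sub>\<epsilon> (\<epsilon>s n)"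
    "\<lambda>n. \<phi>\<^sub>\<epsilon> (\<epsilon>s n)" "\<lambda>n. v\<^sub>\<epsilon> (\<epsilon>s n)" L "\<lambda>n. 1 / real (Suc n)"
    by unfold_locales (use assms(4-6) FG Q v lim bounds bound_\<phi> L(1) in auto)
  show ?thesis
    using viscosity_subsolution_limit viscosity_supersolution_limit \<epsilon>s by blast
qed

end
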